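(* Let $H(t)$, $t\in\mathbb{R}$, be a family of self-adjoint operators in a separable complex Hilbert space $\mathcal{H}$ which is periodic in time, $H(t+T)=H(t)$ for some $T>0$, with propagators $U(t,s)$, so that $U(t+T,r+T)=U(t,r)$ for all $t,r\in\mathbb{R}$. Let $U_F=U(T,0)$ be the Floquet operator, let $\mathcal{H}_{\mathrm p}$ and $\mathcal{H}_{\mathrm c}$ be the point and continuous spectral subspaces of $U_F$, and let $A$ be a probe operator. Then, with $\mathcal{H}_{\mathrm{be}},\mathcal{H}_{\mathrm{pc}},\mathcal{H}_{\mathrm{ap}},\mathcal{H}_{\mathrm{ue}},\mathcal{H}_{\mathrm f}$ as defined in the context, (a) $\mathcal{H}_{\mathrm p}=\mathcal{H}_{\mathrm{be}}=\mathcal{H}_{\mathrm{pc}}=\mathcal{H}_{\mathrm{ap}}$; (b) $\mathcal{H}_{\mathrm c}=\mathcal{H}_{\mathrm{ue}}=\mathcal{H}_{\mathrm f}$.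
   Context: Standing assumptions: the Schrödinger equation $i\,\frac{d\psi}{dt}=H(t)\psi$ gives rise to propagators $U(t,s)$, $t,s\in\mathbb{R}$, which form a strongly continuous family of unitary operators on $\mathcal{H}$ with $U(t,r)U(r,s)=U(t,s)$ and $U(t,t)=I$; the solution with $\psi(0)=\psi$ is $\psi(t)=U(t,0)\psi$. A probe operator is an unbounded positive self-adjoint operator $A:\mathrm{dom}\,A\subset\mathcal{H}\to\mathcal{H}$ with discrete spectrum (isolated eigenvalues of finite multiplicity only), with $\mathrm{dom}\,A$ invariant under $U(t,0)$. For $E\in\mathbb{R}$, $F(A>E)$ is the orthogonal projection onto the closed span of the eigenvectors of $A$ with eigenvalues larger than $E$. $\mathcal{O}(\xi)=\{U(t,0)\xi:t\in\mathbb{R}\}$ is the orbit of $\xi$. Define: - $\mathcal{H}_{\mathrm{pc}}=\{\xi\in\mathcal{H}:\mathcal{O}(\xi)\text{ is precompact in }\mathcal{H}\}$; - $\mathcal{H}_{\mathrm f}=\{\xi\in\mathcal{H}:\lim_{\tau\to\infty}\frac1\tau\int_0^\tau\|CU(t,0)\xi\|\,dt=0\text{ for every compact operator }C\text{ on }\mathcal H\}$; - $\mathcal{H}_{\mathrm{be}}=\{0\ne\xi\in\mathcal{H}:\lim_{E\to\infty}\sup_{t\in\mathbb{R}}\|F(A>E)U(t,0)\frac{\xi}{\|\xi\|}\|=0\}\cup\{0\}$; - $\mathcal{H}_{\mathrm{ue}}=\{0\ne\xi\in\mathcal{H}:\lim_{E\to\infty}\sup_{t\in\mathbb{R}}\|F(A>E)U(t,0)\frac{\xi}{\|\xi\|}\|=1\}\cup\{0\}$;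 - $\mathcal{H}_{\mathrm{ap}}=\{\xi\in\mathcal{H}:\text{the function }t\mapsto U(t,0)\xi\text{ is almost periodic}\}$. A continuous function $f:\mathbb{R}\to\mathcal{B}$ ($\mathcal{B}$ a Banach space) is almost periodic if for every $\epsilon>0$ there is $l(\epsilon)>0$ such that every interval of length $l(\epsilon)$ contains a point $\tau$ with $\|f(t+\tau)-f(t)\|<\epsilon$ for all $t\in\mathbb{R}$. The point subspace of a unitary operator is the closed linear span of its eigenvectors; the continuous subspace is its orthogonal complement. *)

theory Defs
  imports "HOL-Analysis.Analysis"
begin

section \<open>Complex Hilbert spaces\<close>

text \<open>
  The norm and the topology are those of the underlying real inner product, which is the real part
  of the complex one. The complex inner product is antilinear in its first argument.
\<close>

class complex_hilbert_space = real_inner + banach +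
  fixes scaleC :: "complex \<Rightarrow> 'a \<Rightarrow> 'a" (infixr "*\<^sub>C" 75)
    and cinner :: "'a \<Rightarrow> 'a \<Rightarrow> complex"
  assumes scaleC_add_right: "c *\<^sub>C (x + y) = c *\<^sub>C x + c *\<^sub>C y"
    and scaleC_add_left: "(c + d) *\<^sub>C x = c *\<^sub>C x + d *\<^sub>C x"
    and scaleC_scaleC: "c *\<^sub>C d *\<^sub>C x = (c * d) *\<^sub>C x"
    and scaleC_of_real: "complex_of_real r *\<^sub>C x = r *\<^sub>R x"
    and cinner_commute: "cinner x y = cnj (cinner y x)"
    and cinner_add_right: "cinner x (y + z) = cinner x y + cinner x z"
    and cinner_scaleC_right: "cinner x (c *\<^sub>C y) = c * cinner x y"
    and Re_cinner: "Re (cinner x y) = inner x y"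

global_interpretation complex_vector:
  vector_space "scaleC :: complex \<Rightarrow> 'a \<Rightarrow> 'a :: complex_hilbert_space"
  defines csubspace = complex_vector.subspace
    and cspan = complex_vector.span
proof unfold_locales
  show "1 *\<^sub>C x = x" for x :: 'a
    using scaleC_of_real[of 1 x] by simp
qed (simp_all add: scaleC_add_right scaleC_add_left scaleC_scaleC)

definition clinear :: "('h :: complex_hilbert_space \<Rightarrow> 'h) \<Rightarrow> bool"
  where "clinear V \<longleftrightarrow> Vector_Spaces.linear scaleC scaleC V"

definition unitary :: "('h :: complex_hilbert_space \<Rightarrow> 'h) \<Rightarrow> bool"
  where "unitary V \<longleftrightarrow> clinear V \<and> surj V \<and> (\<forall>x y. cinner (V x) (V y) = cinner x y)"

definition compact_operator :: "('h :: complex_hilbert_space \<Rightarrow> 'h) \<Rightarrow> bool"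
  where "compact_operator C \<longleftrightarrow> clinear C \<and> compact (closure (C ` cball 0 1))"

definition orth_compl :: "'h :: complex_hilbert_space set \<Rightarrow> 'h set"
  where "orth_compl M = {x. \<forall>y\<in>M. cinner y x = 0}"

text \<open>Meaningful for closed subspaces, where the point exists and is unique.\<close>

definition orth_proj :: "'h :: complex_hilbert_space set \<Rightarrow> 'h \<Rightarrow> 'h"
  where "orth_proj M x = (THE y. y \<in> M \<and> x - y \<in> orth_compl M)"


section \<open>Unbounded operators\<close>

text \<open>
  An operator is a partial map; in particular, equality of operators includes equality of domains.
\<close>

definition linear_operator :: "('h :: complex_hilbert_space \<rightharpoonup> 'h) \<Rightarrow> bool"
  where "linear_operator A \<longleftrightarrow> csubspace (dom A) \<and>
    (\<forall>x\<in>dom A. \<forall>y\<in>dom A. the (A (x + y)) = the (A x) + the (A y)) \<and>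
    (\<forall>c. \<forall>x\<in>dom A. the (A (c *\<^sub>C x)) = c *\<^sub>C the (A x))"

text \<open>Used for densely defined operators only, for which the vector \<open>z\<close> below is unique.\<close>

definition adjoint_operator :: "('h :: complex_hilbert_space \<rightharpoonup> 'h) \<Rightarrow> ('h \<rightharpoonup> 'h)"
  where "adjoint_operator A = (\<lambda>y.
    if \<exists>z. \<forall>x\<in>dom A. cinner (the (A x)) y = cinner x z
    then Some (THE z. \<forall>x\<in>dom A. cinner (the (A x)) y = cinner x z)
    else None)"

definition self_adjoint :: "('h :: complex_hilbert_space \<rightharpoonup> 'h) \<Rightarrow> bool"
  where "self_adjoint A \<longleftrightarrow>
    linear_operator A \<and> closure (dom A) = UNIV \<and> adjoint_operator A = A"

definition positive_operator :: "('h :: complex_hilbert_space \<rightharpoonup> 'h) \<Rightarrow> bool"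
  where "positive_operator A \<longleftrightarrow>
    (\<forall>x\<in>dom A. cinner x (the (A x)) \<in> \<real> \<and> 0 \<le> Re (cinner x (the (A x))))"

definition bounded_operator :: "('h :: complex_hilbert_space \<rightharpoonup> 'h) \<Rightarrow> bool"
  where "bounded_operator A \<longleftrightarrow> (\<exists>K. \<forall>x\<in>dom A. norm (the (A x)) \<le> K * norm x)"

definition resolvent_set :: "('h :: complex_hilbert_space \<rightharpoonup> 'h) \<Rightarrow> complex set"
  where "resolvent_set A = {z.
    bij_betw (\<lambda>x. the (A x) - z *\<^sub>C x) (dom A) UNIV \<and>
    bounded_linear (inv_into (dom A) (\<lambda>x. the (A x) - z *\<^sub>C x))}"

definition spectrum :: "('h :: complex_hilbert_space \<rightharpoonup> 'h) \<Rightarrow> complex set"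
  where "spectrum A = - resolvent_set A"

definition eigenspace :: "('h :: complex_hilbert_space \<rightharpoonup> 'h) \<Rightarrow> complex \<Rightarrow> 'h set"
  where "eigenspace A z = {x. A x = Some (z *\<^sub>C x)}"

definition discrete_spectrum :: "('h :: complex_hilbert_space \<rightharpoonup> 'h) \<Rightarrow> bool"
  where "discrete_spectrum A \<longleftrightarrow> (\<forall>z\<in>spectrum A.
    \<not> z islimpt spectrum A \<and>
    (\<exists>x. x \<noteq> 0 \<and> x \<in> eigenspace A z) \<and>
    (\<exists>B. finite B \<and> eigenspace A z \<subseteq> cspan B))"

text \<open>The projection \<open>F(A > E)\<close>.\<close>

definition spectral_tail :: "('h :: complex_hilbert_space \<rightharpoonup> 'h) \<Rightarrow> real \<Rightarrow> 'h \<Rightarrow> 'h"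
  where "spectral_tail A E =
    orth_proj (closure (cspan (\<Union>e\<in>{E<..}. eigenspace A (complex_of_real e))))"


section \<open>Propagators of time-dependent Hamiltonians\<close>

definition schroedinger_solution ::
    "(real \<Rightarrow> ('h :: complex_hilbert_space \<rightharpoonup> 'h)) \<Rightarrow> (real \<Rightarrow> 'h) \<Rightarrow> bool"
  where "schroedinger_solution H \<psi> \<longleftrightarrow> (\<forall>t. \<exists>\<psi>'.
    (\<psi> has_vector_derivative \<psi>') (at t) \<and> H t (\<psi> t) = Some (\<i> *\<^sub>C \<psi>'))"

text \<open>
  Since the \<open>H t\<close> are unbounded, \<open>t \<mapsto> U t s \<xi>\<close> can be differentiable only for suitable
  initial data \<open>\<xi>\<close>; these are required to be dense, which determines \<open>U\<close> uniquely when all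
  \<open>H t\<close> are self-adjoint.
\<close>

definition propagator ::
    "(real \<Rightarrow> ('h :: complex_hilbert_space \<rightharpoonup> 'h)) \<Rightarrow> (real \<Rightarrow> real \<Rightarrow> 'h \<Rightarrow> 'h) \<Rightarrow> bool"
  where "propagator H U \<longleftrightarrow>
    (\<forall>t s. unitary (U t s)) \<and>
    (\<forall>\<xi>. continuous_on UNIV (\<lambda>(t, s). U t s \<xi>)) \<and>
    (\<forall>t r s. U t r \<circ> U r s = U t s) \<and>
    (\<forall>t. U t t = id) \<and>
    (\<forall>s. closure {\<xi>. schroedinger_solution H (\<lambda>t. U t s \<xi>)} = UNIV)"

lemma schroedinger_solutions_inner_eq:
  fixes H :: "real \<Rightarrow> ('h :: complex_hilbert_space \<rightharpoonup> 'h)"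
  assumes sa: "\<And>t. self_adjoint (H t)"
    and \<phi>: "schroedinger_solution H \<phi>" and \<psi>: "schroedinger_solution H \<psi>"
  shows "inner (\<phi> t) (\<psi> t) = inner (\<phi> r) (\<psi> r)"
proof -
  have "((\<lambda>t. inner (\<phi> t) (\<psi> t)) has_real_derivative 0) (at t)" for t
  proof -
    obtain x where x: "(\<phi> has_vector_derivative x) (at t)" "H t (\<phi> t) = Some (\<i> *\<^sub>C x)"
      using \<phi> unfolding schroedinger_solution_def by blast
    obtain y where y: "(\<psi> has_vector_derivative y) (at t)" "H t (\<psi> t) = Some (\<i> *\<^sub>C y)"
      using \<psi> unfolding schroedinger_solution_def by blast
    have dense: "closure (dom (H t)) = UNIV" and adj: "adjoint_operator (H t) = H t"
      using sa[of t] by (auto simp: self_adjoint_def)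
    have "adjoint_operator (H t) (\<psi> t) = Some (\<i> *\<^sub>C y)"
      using adj y(2) by simp
    then have ex: "\<exists>z. \<forall>u\<in>dom (H t). cinner (the (H t u)) (\<psi> t) = cinner u z"
      and the_y: "(THE z. \<forall>u\<in>dom (H t). cinner (the (H t u)) (\<psi> t) = cinner u z) = \<i> *\<^sub>C y"
      unfolding adjoint_operator_def by (auto split: if_splits)
    have uniq: "z = w" if zw: "\<forall>u\<in>dom (H t). cinner u z = cinner u w" for z w :: 'h
    proof -
      have "inner u (z - w) = 0" if "u \<in> dom (H t)" for u
        using zw that by (metis Re_cinner inner_diff_right right_minus_eq)
      moreover have "closed {u. inner u (z - w) = 0}"
        by (intro closed_Collect_eq continuous_intros)
      ultimately have "closure (dom (H t)) \<subseteq> {u. inner u (z - w) = 0}"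
        by (intro closure_minimal) auto
      then have "z - w \<in> {u. inner u (z - w) = 0}" unfolding dense by blast
      then show ?thesis by simp
    qed
    have "\<exists>!z. \<forall>u\<in>dom (H t). cinner (the (H t u)) (\<psi> t) = cinner u z"
      using ex uniq by (metis (no_types, lifting))
    from theI'[OF this] have "\<forall>u\<in>dom (H t). cinner (the (H t u)) (\<psi> t) = cinner u (\<i> *\<^sub>C y)"
      unfolding the_y .
    then have eq: "cinner (\<i> *\<^sub>C x) (\<psi> t) = cinner (\<phi> t) (\<i> *\<^sub>C y)"
      using x(2) by force
    have "cinner (\<i> *\<^sub>C x) (\<psi> t) = - \<i> * cinner x (\<psi> t)"
      by (metis cinner_commute cinner_scaleC_right complex_cnj_i complex_cnj_mult)
    then have "\<i> * (cinner x (\<psi> t) + cinner (\<phi> t) y) = 0"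
      using eq by (simp add: cinner_scaleC_right ring_distribs)
    then have "cinner x (\<psi> t) + cinner (\<phi> t) y = 0" by simp
    then have z: "inner x (\<psi> t) + inner (\<phi> t) y = 0"
      by (metis Re_cinner plus_complex.sel(1) zero_complex.sel(1))
    have "((\<lambda>t. inner (\<phi> t) (\<psi> t)) has_vector_derivative (inner (\<phi> t) y + inner x (\<psi> t))) (at t)"
      by (rule bounded_bilinear.has_vector_derivative[OF bounded_bilinear_inner x(1) y(1)])
    then show ?thesis
      using z by (simp add: has_real_derivative_iff_has_vector_derivative add.commute)
  qed
  then show ?thesis
    by (intro DERIV_isconst_all) auto
qed

lemma propagator_periodic:
  fixes H :: "real \<Rightarrow> ('h :: complex_hilbert_space \<rightharpoonup> 'h)"
  assumes sa: "\<And>t. self_adjoint (H t)" and per: "\<And>t. H (t + T) = H t"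
    and U: "propagator H U"
  shows "U (t + T) (r + T) = U t r"
proof -
  define V where "V = U (t + T) (r + T)"
  define W where "W = U t r"
  have iso: "inner (U a b x) (U a b y) = inner x y" for a b x y
    using U by (auto simp: propagator_def unitary_def simp flip: Re_cinner)
  have lin: "U a b (x - y) = U a b x - U a b y" for a b x y
  proof -
    have "Vector_Spaces.linear scaleC scaleC (U a b)"
      using U by (auto simp: propagator_def unitary_def clinear_def)
    then interpret Vector_Spaces.linear scaleC scaleC "U a b" .
    show ?thesis by (rule diff)
  qed
  have dist: "dist (U a b x) (U a b y) = dist x y" for a b x y
    by (simp add: dist_norm norm_eq_sqrt_inner iso flip: lin)
  have cont: "continuous_on UNIV (U a b)" for a b
    unfolding continuous_on_iff by (auto simp: dist)
  have cont': "continuous_on UNIV V" "continuous_on UNIV W"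
    unfolding V_def W_def by (rule cont)+
  define D where "D s = {\<xi>. schroedinger_solution H (\<lambda>t. U t s \<xi>)}" for s
  have dense: "closure (D s) = UNIV" for s
    using U by (auto simp: propagator_def D_def)
  have id: "U s s = id" for s using U by (auto simp: propagator_def)
  have shift: "schroedinger_solution H (\<lambda>t. U (t + T) (r + T) \<xi>)" if \<xi>: "\<xi> \<in> D (r + T)" for \<xi>
    unfolding schroedinger_solution_def
  proof
    fix t
    obtain x where x: "((\<lambda>t. U t (r + T) \<xi>) has_vector_derivative x) (at (t + T))"
        "H (t + T) (U (t + T) (r + T) \<xi>) = Some (\<i> *\<^sub>C x)"
      using \<xi>[unfolded D_def schroedinger_solution_def mem_Collect_eq, THEN spec, of "t + T"]
      by blast
    have "((\<lambda>t. U (t + T) (r + T) \<xi>) has_vector_derivative x) (at t)"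
      unfolding has_vector_derivative_def
      by (rule has_derivative_compose[where f = "\<lambda>t. t + T" and f' = "\<lambda>h. h",
            OF _ x(1)[unfolded has_vector_derivative_def]])
        (auto intro!: derivative_eq_intros)
    then show "\<exists>\<psi>'. ((\<lambda>t. U (t + T) (r + T) \<xi>) has_vector_derivative \<psi>') (at t) \<and>
        H t (U (t + T) (r + T) \<xi>) = Some (\<i> *\<^sub>C \<psi>')"
      using x(2) per by auto
  qed
  have 1: "inner (V \<xi>) (W \<eta>) = inner \<xi> \<eta>" if "\<xi> \<in> D (r + T)" "\<eta> \<in> D r" for \<xi> \<eta>
    using schroedinger_solutions_inner_eq[OF sa shift[OF that(1)], of "\<lambda>t. U t r \<eta>" t r] that(2)
    by (simp add: D_def V_def W_def id)
  have 2: "inner (V \<xi>) (W \<eta>) = inner \<xi> \<eta>" if "\<eta> \<in> D r" for \<xi> \<eta>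
  proof -
    have "closed {\<xi>. inner (V \<xi>) (W \<eta>) = inner \<xi> \<eta>}"
      by (intro closed_Collect_eq continuous_intros cont')
    then have "closure (D (r + T)) \<subseteq> {\<xi>. inner (V \<xi>) (W \<eta>) = inner \<xi> \<eta>}"
      using 1 that by (intro closure_minimal) auto
    then show ?thesis using dense by auto
  qed
  have 3: "inner (V \<xi>) (W \<eta>) = inner \<xi> \<eta>" for \<xi> \<eta>
  proof -
    have "closed {\<eta>. inner (V \<xi>) (W \<eta>) = inner \<xi> \<eta>}"
      by (intro closed_Collect_eq continuous_intros cont')
    then have "closure (D r) \<subseteq> {\<eta>. inner (V \<xi>) (W \<eta>) = inner \<xi> \<eta>}"
      using 2 by (intro closure_minimal) auto
    then show ?thesis using dense by auto
  qed
  have "inner (V \<xi> - W \<xi>) (V \<xi> - W \<xi>) = 0" for \<xi>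
    using 3[of \<xi> \<xi>] iso[of _ _ \<xi> \<xi>]
    by (simp add: V_def W_def inner_diff_left inner_diff_right inner_commute)
  then have "V = W" by auto
  then show ?thesis by (simp add: V_def W_def)
qed

definition probe_operator ::
    "(real \<Rightarrow> real \<Rightarrow> 'h \<Rightarrow> 'h) \<Rightarrow> ('h :: complex_hilbert_space \<rightharpoonup> 'h) \<Rightarrow> bool"
  where "probe_operator U A \<longleftrightarrow>
    self_adjoint A \<and> positive_operator A \<and> \<not> bounded_operator A \<and> discrete_spectrum A \<and>
    (\<forall>t. U t 0 ` dom A \<subseteq> dom A)"


section \<open>The subspaces\<close>

definition point_subspace :: "('h :: complex_hilbert_space \<Rightarrow> 'h) \<Rightarrow> 'h set"
  where "point_subspace V = closure (cspan {x. x \<noteq> 0 \<and> (\<exists>z. V x = z *\<^sub>C x)})"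

definition continuous_subspace :: "('h :: complex_hilbert_space \<Rightarrow> 'h) \<Rightarrow> 'h set"
  where "continuous_subspace V = orth_compl (point_subspace V)"

definition almost_periodic :: "(real \<Rightarrow> 'b :: banach) \<Rightarrow> bool"
  where "almost_periodic f \<longleftrightarrow> continuous_on UNIV f \<and>
    (\<forall>\<epsilon>>0. \<exists>l>0. \<forall>a. \<exists>\<tau>\<in>{a..a + l}. \<forall>t. norm (f (t + \<tau>) - f t) < \<epsilon>)"

definition orbit :: "(real \<Rightarrow> real \<Rightarrow> 'h \<Rightarrow> 'h) \<Rightarrow> 'h \<Rightarrow> 'h set"
  where "orbit U \<xi> = range (\<lambda>t. U t 0 \<xi>)"

definition H_pc :: "(real \<Rightarrow> real \<Rightarrow> 'h \<Rightarrow> 'h) \<Rightarrow> 'h :: complex_hilbert_space set"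
  where "H_pc U = {\<xi>. compact (closure (orbit U \<xi>))}"

definition H_f :: "(real \<Rightarrow> real \<Rightarrow> 'h \<Rightarrow> 'h) \<Rightarrow> 'h :: complex_hilbert_space set"
  where "H_f U = {\<xi>. \<forall>C. compact_operator C \<longrightarrow>
    ((\<lambda>\<tau>. 1 / \<tau> * integral {0..\<tau>} (\<lambda>t. norm (C (U t 0 \<xi>)))) \<longlongrightarrow> 0) at_top}"

definition H_be ::
    "(real \<Rightarrow> real \<Rightarrow> 'h \<Rightarrow> 'h) \<Rightarrow> ('h \<rightharpoonup> 'h) \<Rightarrow> 'h :: complex_hilbert_space set"
  where "H_be U A = {\<xi>. \<xi> \<noteq> 0 \<and>
    ((\<lambda>E. SUP t. norm (spectral_tail A E (U t 0 (\<xi> /\<^sub>R norm \<xi>)))) \<longlongrightarrow> 0) at_top} \<union> {0}"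

definition H_ue ::
    "(real \<Rightarrow> real \<Rightarrow> 'h \<Rightarrow> 'h) \<Rightarrow> ('h \<rightharpoonup> 'h) \<Rightarrow> 'h :: complex_hilbert_space set"
  where "H_ue U A = {\<xi>. \<xi> \<noteq> 0 \<and>
    ((\<lambda>E. SUP t. norm (spectral_tail A E (U t 0 (\<xi> /\<^sub>R norm \<xi>)))) \<longlongrightarrow> 1) at_top} \<union> {0}"

definition H_ap :: "(real \<Rightarrow> real \<Rightarrow> 'h \<Rightarrow> 'h) \<Rightarrow> 'h :: complex_hilbert_space set"
  where "H_ap U = {\<xi>. almost_periodic (\<lambda>t. U t 0 \<xi>)}"

end

theory Submission
  imports Defs
begin

text \<open>
  Write \<open>V = U T 0\<close>. Periodicity gives \<open>U (t + nT) 0 = U t 0 \<circ> V\<^sup>n\<close>, so orbits of eigenvectors of \<open>V\<close>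
  lie in the image of a circle times \<open>[0, T]\<close>; hence the point subspace consists of precompact
  orbits. For \<open>\<xi>\<close> in the continuous subspace, \<open>\<parallel>C V\<^sup>n \<xi>\<parallel>\<close> tends to \<open>0\<close> in the mean for compact \<open>C\<close>
  (RAGE). This rests on Wiener's lemma for \<open>\<langle>\<xi>, V\<^sup>n \<xi>\<rangle>\<close>, which is proved without the spectral measure:
  the ergodic means of the operators \<open>cnj z V\<close> at \<open>\<xi>\<close> tend to \<open>0\<close> for each \<open>z\<close> on the unit circle, uniformly
  by Dini, and their squared norms, as functions of \<open>z\<close>, have the Fejer-weighted correlations as
  Fourier coefficients. A vector with precompact orbit and the mean decay property vanishes, so
  splitting \<open>\<xi>\<close> into its point and continuous parts yields the remaining inclusions.

  For the probe operator one needs that its eigenvectors span a dense subspace, so that \<open>F(A > E)\<close>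
  tends strongly to \<open>0\<close> and has a complement of finite rank. On the orthogonal complement \<open>M\<close> of the eigenvectors,
  isolation of the spectrum makes \<open>A - t\<close> bounded below for every \<open>t\<close>, whereas a bounded symmetric
  operator attains its norm on the approximate spectrum; this forces \<open>M = 0\<close>.
\<close>

section \<open>Complex Hilbert spaces\<close>

text \<open>No spectral theorem is invoked, neither for the unitary \<open>V\<close> nor for the
  unbounded \<open>A\<close>: spectral facts are drawn from orthogonal complements, bounded
  resolvents and ergodic means. Uniformity in \<open>z\<close> is what allows the circle to be
  replaced by finitely many roots of unity whose number grows with the length of the mean; pointwise
  decay would not control such sums. Wiener's lemma speaks only of the correlations of a vector with
  its own orbit. A Gram matrix estimate carries the decay over to all bounded functionals, and a
  finite net of the image of the unit ball reduces a compact operator to finitely many functionals.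
  The two facts about \<open>F(A > E)\<close> do different work. Strong convergence to 0 is uniform
  on a precompact orbit, which gives bounded energy. Finite rank of the complement makes the
  low-energy part of any orbit precompact and, for vectors in the continuous subspace, small at
  suitable times \<open>n T\<close>, so that the supremum over time is already the full
  norm.\<close>

lemma cinner_add_left:
  fixes x :: "'h :: complex_hilbert_space"
  shows "cinner (x + y) z = cinner x z + cinner y z"
  by (metis cinner_commute cinner_add_right complex_cnj_add)

lemma cinner_scaleC_left:
  fixes x :: "'h :: complex_hilbert_space"
  shows "cinner (c *\<^sub>C x) y = cnj c * cinner x y"
  by (metis cinner_commute cinner_scaleC_right complex_cnj_mult)

lemma cinner_self:
  fixes x :: "'h :: complex_hilbert_space"
  shows "cinner x x = complex_of_real ((norm x)\<^sup>2)"
proof -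
  have "Im (cinner x x) = 0"
    using cinner_commute[of x x] by (metis Reals_cnj_iff complex_is_Real_iff)
  then show ?thesis
    by (simp add: complex_eq_iff Re_cinner power2_norm_eq_inner)
qed

lemma norm_scaleC:
  fixes x :: "'h :: complex_hilbert_space"
  shows "norm (c *\<^sub>C x) = cmod c * norm x"
proof -
  have "complex_of_real ((norm (c *\<^sub>C x))\<^sup>2) = cnj c * c * cinner x x"
    unfolding cinner_self[symmetric] by (simp add: cinner_scaleC_left cinner_scaleC_right)
  also have "\<dots> = complex_of_real ((cmod c * norm x)\<^sup>2)"
    using complex_norm_square[of c] by (simp add: cinner_self power_mult_distrib mult_ac)
  finally show ?thesis
    by (simp only: of_real_eq_iff power2_eq_iff_nonneg norm_ge_zero mult_nonneg_nonneg)
qed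

lemma cmod_cinner_le:
  fixes x :: "'h :: complex_hilbert_space"
  shows "cmod (cinner x y) \<le> norm x * norm y"
proof (cases "cinner x y = 0")
  case False
  \<comment> \<open>The phase \<open>u\<close> turns the inner product into a nonnegative real,
    which reduces the claim to the real Cauchy-Schwarz inequality.\<close>
  define u where "u = cnj (cinner x y) / cmod (cinner x y)"
  have u: "cmod u = 1" using False by (simp add: u_def norm_divide)
  have "u * cinner x y = complex_of_real (cmod (cinner x y))"
    using False complex_norm_square[of "cinner x y"]
    by (simp add: u_def power2_eq_square field_simps)
  then have "cmod (cinner x y) = inner x (u *\<^sub>C y)"
    by (metis Re_cinner Re_complex_of_real cinner_scaleC_right)
  also have "\<dots> \<le> norm x * norm (u *\<^sub>C y)" by (rule norm_cauchy_schwarz)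
  finally show ?thesis by (simp add: norm_scaleC u)
qed simp

lemma scaleR_scaleC_commute:
  fixes x :: "'h :: complex_hilbert_space"
  shows "c *\<^sub>C (r *\<^sub>R x) = r *\<^sub>R (c *\<^sub>C x)"
  by (metis scaleC_of_real scaleC_scaleC mult.commute)

lemma cinner_scaleR_right:
  fixes x :: "'h :: complex_hilbert_space"
  shows "cinner x (r *\<^sub>R y) = r *\<^sub>R cinner x y"
  by (metis cinner_scaleC_right scaleC_of_real scaleR_conv_of_real)

lemma cinner_scaleR_left:
  fixes x :: "'h :: complex_hilbert_space"
  shows "cinner (r *\<^sub>R x) y = r *\<^sub>R cinner x y"
  by (metis cinner_scaleC_left complex_cnj_complex_of_real scaleC_of_real scaleR_conv_of_real)

lemma bounded_bilinear_cinner: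
  "bounded_bilinear (cinner :: 'h :: complex_hilbert_space \<Rightarrow> 'h \<Rightarrow> complex)"
  by unfold_locales
    (auto simp: cinner_add_left cinner_add_right cinner_scaleR_left cinner_scaleR_right
      intro!: exI[of _ 1] cmod_cinner_le)

lemma bounded_bilinear_scaleC:
  "bounded_bilinear (scaleC :: complex \<Rightarrow> 'h :: complex_hilbert_space \<Rightarrow> 'h)"
proof unfold_locales
  show "\<exists>K. \<forall>a b. norm (a *\<^sub>C (b :: 'h)) \<le> norm a * norm b * K"
    by (auto simp: norm_scaleC intro!: exI[of _ 1])
  fix r :: real and a :: complex and b :: 'h
  show "(r *\<^sub>R a) *\<^sub>C b = r *\<^sub>R (a *\<^sub>C b)"
    by (metis scaleC_of_real scaleC_scaleC scaleR_conv_of_real)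
qed (simp_all add: scaleC_add_left scaleC_add_right scaleR_scaleC_commute)

lemmas cinner_simps =
  cinner_add_left cinner_add_right cinner_scaleC_left cinner_scaleC_right
  bounded_bilinear.diff_left[OF bounded_bilinear_cinner]
  bounded_bilinear.diff_right[OF bounded_bilinear_cinner]
  bounded_bilinear.minus_left[OF bounded_bilinear_cinner]
  bounded_bilinear.minus_right[OF bounded_bilinear_cinner]
  bounded_bilinear.zero_left[OF bounded_bilinear_cinner]
  bounded_bilinear.zero_right[OF bounded_bilinear_cinner]
  bounded_bilinear.sum_left[OF bounded_bilinear_cinner]
  bounded_bilinear.sum_right[OF bounded_bilinear_cinner]

lemmas scaleC_simps =
  scaleC_add_left scaleC_add_right scaleC_scaleC
  bounded_bilinear.diff_left[OF bounded_bilinear_scaleC]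
  bounded_bilinear.diff_right[OF bounded_bilinear_scaleC]
  bounded_bilinear.minus_left[OF bounded_bilinear_scaleC]
  bounded_bilinear.minus_right[OF bounded_bilinear_scaleC]
  bounded_bilinear.zero_left[OF bounded_bilinear_scaleC]
  bounded_bilinear.zero_right[OF bounded_bilinear_scaleC]
  bounded_bilinear.sum_left[OF bounded_bilinear_scaleC]
  bounded_bilinear.sum_right[OF bounded_bilinear_scaleC]

lemmas continuous_on_cinner [continuous_intros] =
  bounded_bilinear.continuous_on[OF bounded_bilinear_cinner]
lemmas continuous_on_scaleC [continuous_intros] =
  bounded_bilinear.continuous_on[OF bounded_bilinear_scaleC]

section \<open>Closed complex subspaces, orthogonal complements and projections\<close>

lemma csubspace_imp_subspace:
  assumes "csubspace M"
  shows "subspace M"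
  unfolding subspace_def
  by (metis assms complex_vector.subspace_def scaleC_of_real)

lemma csubspace_closure:
  assumes "csubspace M"
  shows "csubspace (closure M)"
proof (rule complex_vector.subspaceI)
  show "0 \<in> closure M"
    using closure_subset complex_vector.subspace_0[OF assms] by blast
  show "x + y \<in> closure M" if xy: "x \<in> closure M" "y \<in> closure M" for x y
  proof -
    obtain f g where "\<And>n. f n \<in> M" "f \<longlonglongrightarrow> x" "\<And>n. g n \<in> M" "g \<longlonglongrightarrow> y"
      using xy unfolding closure_sequential by blast
    then have "(\<forall>n. f n + g n \<in> M) \<and> (\<lambda>n. f n + g n) \<longlonglongrightarrow> x + y"
      by (auto intro: complex_vector.subspace_add[OF assms] tendsto_add)
    then show ?thesis unfolding closure_sequential by (intro exI[of _ "\<lambda>n. f n + g n"])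
  qed
  show "c *\<^sub>C x \<in> closure M" if "x \<in> closure M" for c x
  proof -
    have "(*\<^sub>C) c ` closure M \<subseteq> closure M"
    proof (rule image_closure_subset)
      show "continuous_on (closure M) ((*\<^sub>C) c)" by (intro continuous_intros)
      show "(*\<^sub>C) c ` M \<subseteq> closure M"
        using closure_subset complex_vector.subspace_scale[OF assms] by blast
    qed simp
    then show ?thesis using that by blast
  qed
qed

lemma csubspace_orth_compl: "csubspace (orth_compl M)"
  by (auto simp: complex_vector.subspace_def orth_compl_def cinner_simps)

lemma closed_orth_compl: "closed (orth_compl M)"
proof -
  have "orth_compl M = (\<Inter>y\<in>M. {x. cinner y x = 0})"
    by (auto simp: orth_compl_def)
  then show ?thesis by (auto intro!: closed_Collect_eq continuous_intros)
qed

lemma orth_compl_closure_cspan: "orth_compl (closure (cspan S)) = orth_compl S"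
proof
  show "orth_compl (closure (cspan S)) \<subseteq> orth_compl S"
    using closure_subset complex_vector.span_superset unfolding orth_compl_def by blast
  show "orth_compl S \<subseteq> orth_compl (closure (cspan S))"
  proof
    fix x assume x: "x \<in> orth_compl S"
    have sub: "csubspace {y. cinner y x = 0}"
      by (auto simp: complex_vector.subspace_def cinner_simps)
    have "S \<subseteq> {y. cinner y x = 0}" using x by (auto simp: orth_compl_def)
    then have "cspan S \<subseteq> {y. cinner y x = 0}"
      using sub by (rule complex_vector.span_minimal)
    moreover have "closed {y. cinner y x = 0}"
      by (intro closed_Collect_eq continuous_intros)
    ultimately have "closure (cspan S) \<subseteq> {y. cinner y x = 0}"
      by (rule closure_minimal)
    then show "x \<in> orth_compl (closure (cspan S))" by (auto simp: orth_compl_def)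
  qed
qed

text \<open>Since \<open>M\<close> is closed under multiplication by \<open>\<i>\<close>, testing
  against \<open>\<i> *\<^sub>C y\<close> also removes the imaginary part. This lets projections be
  constructed in the real inner product.\<close>

lemma cinner_eq_0_if_inner:
  assumes M: "csubspace M" and "\<And>y. y \<in> M \<Longrightarrow> inner y x = 0" and "y \<in> M"
  shows "cinner y x = 0"
proof -
  have "Re (cinner y x) = 0" using assms by (simp add: Re_cinner)
  moreover have "Re (cinner (\<i> *\<^sub>C y) x) = 0"
    using assms by (simp add: Re_cinner complex_vector.subspace_scale[OF M])
  ultimately show ?thesis by (simp add: cinner_simps complex_eq_iff)
qed

lemma parallelogram:
  fixes x y :: "'a :: real_inner"
  shows "(norm (x + y))\<^sup>2 + (norm (x - y))\<^sup>2 = 2 * (norm x)\<^sup>2 + 2 * (norm y)\<^sup>2"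
  by (simp add: power2_norm_eq_inner inner_simps inner_commute)

text \<open>A sequence in \<open>S\<close> minimizing the distance to \<open>x\<close> is Cauchy by
  the parallelogram law, because midpoints stay in \<open>S\<close>. Its limit is the nearest point,
  and there the first variation vanishes.\<close>

lemma projection_exists:
  fixes S :: "'a :: {real_inner, banach} set"
  assumes S: "subspace S" "closed S"
  obtains y where "y \<in> S" "\<And>s. s \<in> S \<Longrightarrow> inner s (x - y) = 0"
proof -
  define d where "d = (INF s\<in>S. norm (x - s))"
  have bdd: "bdd_below ((\<lambda>s. norm (x - s)) ` S)" by (rule bdd_belowI[of _ 0]) auto
  have ne: "S \<noteq> {}" using subspace_0[OF S(1)] by auto
  have d_le: "d \<le> norm (x - s)" if "s \<in> S" for s
    unfolding d_def using bdd that by (rule cINF_lower)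
  have d0: "0 \<le> d" unfolding d_def using ne by (intro cINF_greatest) auto
  have "\<exists>s\<in>S. norm (x - s) < d + 1 / Suc n" for n
    using cINF_less_iff[OF ne bdd, of "d + 1 / Suc n"] unfolding d_def by auto
  then obtain s where s: "\<And>n. s n \<in> S" "\<And>n. norm (x - s n) < d + 1 / Suc n"
    by metis
  have lim: "(\<lambda>n. norm (x - s n)) \<longlonglongrightarrow> d"
  proof (rule tendsto_sandwich[of "\<lambda>_. d"])
    show "(\<lambda>n. d + 1 / Suc n) \<longlonglongrightarrow> d"
      using tendsto_add[OF tendsto_const LIMSEQ_inverse_real_of_nat, of d]
      by (simp add: inverse_eq_divide)
  qed (use d_le s in \<open>auto intro!: always_eventually less_imp_le\<close>)
  have bound: "(norm (s m - s n))\<^sup>2 \<le> 2 * (norm (x - s m))\<^sup>2 + 2 * (norm (x - s n))\<^sup>2 - 4 * d\<^sup>2" for m n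
  proof -
    have "(1/2) *\<^sub>R (s m + s n) \<in> S" using S s by (simp add: subspace_add subspace_scale)
    then have "d \<le> norm (x - (1/2) *\<^sub>R (s m + s n))" by (rule d_le)
    then have "d\<^sup>2 \<le> (norm (x - (1/2) *\<^sub>R (s m + s n)))\<^sup>2" using d0 by simp
    moreover have "(x - s m) + (x - s n) = 2 *\<^sub>R (x - (1/2) *\<^sub>R (s m + s n))"
      by (simp add: algebra_simps scaleR_2)
    then have "(norm ((x - s m) + (x - s n)))\<^sup>2 = 4 * (norm (x - (1/2) *\<^sub>R (s m + s n)))\<^sup>2"
      by (simp add: power_mult_distrib)
    ultimately show ?thesis
      using parallelogram[of "x - s m" "x - s n"] by (simp add: norm_minus_commute)
  qed
  have "Cauchy s"
  proof (rule metric_CauchyI)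
    fix e :: real assume e: "0 < e"
    have "(\<lambda>n. (norm (x - s n))\<^sup>2) \<longlonglongrightarrow> d\<^sup>2" by (intro tendsto_intros lim)
    then have "eventually (\<lambda>n. (norm (x - s n))\<^sup>2 < d\<^sup>2 + e\<^sup>2/4) sequentially"
      by (rule order_tendstoD) (use e in auto)
    then obtain N where N: "\<And>n. n \<ge> N \<Longrightarrow> (norm (x - s n))\<^sup>2 < d\<^sup>2 + e\<^sup>2/4"
      unfolding eventually_sequentially by auto
    have "dist (s m) (s n) < e" if "m \<ge> N" "n \<ge> N" for m n
    proof -
      have "(norm (s m - s n))\<^sup>2 < e\<^sup>2"
        using bound[of m n] N[OF that(1)] N[OF that(2)] by linarith
      then show ?thesis using e by (simp add: dist_norm power2_less_imp_less)
    qed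
    then show "\<exists>M. \<forall>m\<ge>M. \<forall>n\<ge>M. dist (s m) (s n) < e" by auto
  qed
  then obtain y where y: "s \<longlonglongrightarrow> y" using Cauchy_convergent convergent_def by blast
  have yS: "y \<in> S" using closed_sequentially[OF S(2)] s(1) y by blast
  have "(\<lambda>n. norm (x - s n)) \<longlonglongrightarrow> norm (x - y)" by (intro tendsto_intros y)
  with lim have ny: "norm (x - y) = d" using LIMSEQ_unique by blast
  have "inner w (x - y) = 0" if w: "w \<in> S" for w
  proof (cases "w = 0")
    case False
    \<comment> \<open>The minimizer of the quadratic function
      \<open>norm ((x - y) - a *\<^sub>R w)\<close> squared in \<open>a\<close>.\<close>
    define a where "a = inner w (x - y) / (norm w)\<^sup>2"
    have "y + a *\<^sub>R w \<in> S" using S yS w by (simp add: subspace_add subspace_scale)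
    then have "d \<le> norm ((x - y) - a *\<^sub>R w)" using d_le by (simp add: algebra_simps)
    then have "d\<^sup>2 \<le> (norm ((x - y) - a *\<^sub>R w))\<^sup>2" using d0 by simp
    also have "\<dots> = d\<^sup>2 - 2 * a * inner w (x - y) + a\<^sup>2 * (norm w)\<^sup>2"
      unfolding ny[symmetric] power2_norm_eq_inner
      by (simp add: inner_simps inner_commute power2_eq_square algebra_simps)
    also have "\<dots> = d\<^sup>2 - (inner w (x - y))\<^sup>2 / (norm w)\<^sup>2"
      using False by (simp add: a_def power2_eq_square field_simps)
    finally have "(inner w (x - y))\<^sup>2 / (norm w)\<^sup>2 \<le> 0" by simp
    then show ?thesis using False by (simp add: divide_le_0_iff)
  qed simp
  with yS that show thesis by blast
qed

lemma closed_csubspace_decomp: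
  fixes M :: "'h :: complex_hilbert_space set"
  assumes M: "csubspace M" "closed M"
  obtains y where "y \<in> M" "x - y \<in> orth_compl M"
proof -
  obtain y where y: "y \<in> M" "\<And>s. s \<in> M \<Longrightarrow> inner s (x - y) = 0"
    using projection_exists[OF csubspace_imp_subspace[OF M(1)] M(2)] by metis
  have "x - y \<in> orth_compl M"
    unfolding orth_compl_def using cinner_eq_0_if_inner[OF M(1) y(2)] by blast
  with y(1) that show thesis by blast
qed

lemma orth_compl_Int: "x \<in> M \<Longrightarrow> x \<in> orth_compl M \<Longrightarrow> x = 0"
  by (auto simp: orth_compl_def cinner_self dest!: bspec)

lemma orth_compl_orth_compl:
  assumes M: "csubspace M" "closed M"
  shows "orth_compl (orth_compl M) = M"
proof
  show "M \<subseteq> orth_compl (orth_compl M)"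
    unfolding orth_compl_def by (auto, metis cinner_commute complex_cnj_zero)
  show "orth_compl (orth_compl M) \<subseteq> M"
  proof
    fix x assume x: "x \<in> orth_compl (orth_compl M)"
    obtain y where y: "y \<in> M" "x - y \<in> orth_compl M"
      using closed_csubspace_decomp[OF M] by blast
    have "y \<in> orth_compl (orth_compl M)"
      using \<open>M \<subseteq> _\<close> y by blast
    then have "x - y \<in> orth_compl (orth_compl M)"
      using x complex_vector.subspace_diff[OF csubspace_orth_compl] by blast
    then have "x - y = 0" using y(2) orth_compl_Int by blast
    then show "x \<in> M" using y(1) by simp
  qed
qed

lemma orth_proj_eqI:
  assumes M: "csubspace M" and y: "y \<in> M" "x - y \<in> orth_compl M"
  shows "orth_proj M x = y"
  unfolding orth_proj_def
proof (rule the_equality)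
  fix z assume z: "z \<in> M \<and> x - z \<in> orth_compl M"
  have "(x - y) - (x - z) \<in> orth_compl M"
    using z y complex_vector.subspace_diff[OF csubspace_orth_compl] by blast
  moreover have "z - y \<in> M" using z y complex_vector.subspace_diff[OF M] by blast
  ultimately have "z - y = 0" by (intro orth_compl_Int) auto
  then show "z = y" by simp
qed (use y in auto)

lemma cinner_orth_0:
  "x \<in> M \<Longrightarrow> y \<in> orth_compl M \<Longrightarrow> cinner x y = 0" "x \<in> M \<Longrightarrow> y \<in> orth_compl M \<Longrightarrow> cinner y x = 0"
  by (auto simp: orth_compl_def) (metis cinner_commute complex_cnj_zero)

lemma inner_orth_0:
  assumes "x \<in> M" "y \<in> orth_compl M"
  shows "inner x y = 0" "inner y x = 0"
  using cinner_orth_0[OF assms] Re_cinner by (metis zero_complex.sel(1))+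

lemma pythagoras:
  assumes "x \<in> M" "y \<in> orth_compl M"
  shows "(norm (x + y))\<^sup>2 = (norm x)\<^sup>2 + (norm y)\<^sup>2"
  using inner_orth_0[OF assms] by (simp add: power2_norm_eq_inner inner_simps)

lemma orth_proj:
  assumes M: "csubspace M" "closed M"
  shows orth_proj_in: "orth_proj M x \<in> M"
    and orth_proj_orth: "x - orth_proj M x \<in> orth_compl M"
proof -
  obtain y where y: "y \<in> M" "x - y \<in> orth_compl M"
    using closed_csubspace_decomp[OF M] by blast
  then show "orth_proj M x \<in> M" "x - orth_proj M x \<in> orth_compl M"
    using orth_proj_eqI[OF M(1) y] by auto
qed

lemma clinear_iff:
  "clinear V \<longleftrightarrow> (\<forall>x y. V (x + y) = V x + V y) \<and> (\<forall>c x. V (c *\<^sub>C x) = c *\<^sub>C V x)"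
  unfolding clinear_def
  by (simp add: Vector_Spaces.linear_iff complex_vector.vector_space_axioms)

lemma clinear_diff: "clinear V \<Longrightarrow> V (x - y) = V x - V y"
  unfolding clinear_iff by (metis add_diff_cancel diff_add_cancel)

lemma clinear_0: "clinear V \<Longrightarrow> V 0 = 0"
  using clinear_diff[of V 0 0] by simp

lemma clinear_scaleR: "clinear V \<Longrightarrow> V (r *\<^sub>R x) = r *\<^sub>R V x"
  unfolding clinear_iff by (metis scaleC_of_real)

lemma clinear_sum: "clinear V \<Longrightarrow> V (\<Sum>i\<in>I. f i) = (\<Sum>i\<in>I. V (f i))"
  by (induction I rule: infinite_finite_induct) (auto simp: clinear_0 clinear_iff)

lemma clinear_orth_proj:
  assumes M: "csubspace M" "closed M"
  shows "clinear (orth_proj M)"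
  unfolding clinear_iff
proof (intro conjI allI)
  note sub = csubspace_orth_compl[of M]
  show "orth_proj M (x + y) = orth_proj M x + orth_proj M y" for x y
  proof (rule orth_proj_eqI[OF M(1)])
    have "(x - orth_proj M x) + (y - orth_proj M y) \<in> orth_compl M"
      by (intro complex_vector.subspace_add[OF sub] orth_proj_orth M)
    then show "x + y - (orth_proj M x + orth_proj M y) \<in> orth_compl M"
      by (simp add: algebra_simps)
  qed (intro complex_vector.subspace_add[OF M(1)] orth_proj_in M)
  show "orth_proj M (c *\<^sub>C x) = c *\<^sub>C orth_proj M x" for c x
  proof (rule orth_proj_eqI[OF M(1)])
    show "c *\<^sub>C x - c *\<^sub>C orth_proj M x \<in> orth_compl M"
      using complex_vector.subspace_scale[OF sub orth_proj_orth[OF M]]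
      by (simp flip: scaleC_simps)
  qed (intro complex_vector.subspace_scale[OF M(1)] orth_proj_in M)
qed

lemma norm_orth_proj_le:
  assumes M: "csubspace M" "closed M"
  shows "norm (orth_proj M x) \<le> norm x" "norm (x - orth_proj M x) \<le> norm x"
proof -
  have "(norm x)\<^sup>2 = (norm (orth_proj M x))\<^sup>2 + (norm (x - orth_proj M x))\<^sup>2"
    using pythagoras[OF orth_proj_in[OF M] orth_proj_orth[OF M], of x x] by simp
  then show "norm (orth_proj M x) \<le> norm x" "norm (x - orth_proj M x) \<le> norm x"
    by (auto intro: power2_le_imp_le)
qed

section \<open>Precompact sets and finite-dimensional spans\<close>

lemma compact_closure_iff:
  fixes S :: "'a :: banach set"
  shows "compact (closure S) \<longleftrightarrow> (\<forall>e>0. \<exists>k. finite k \<and> S \<subseteq> (\<Union>x\<in>k. ball x e))"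
proof
  assume "compact (closure S)"
  then have "\<forall>e>0. \<exists>k. finite k \<and> closure S \<subseteq> (\<Union>x\<in>k. ball x e)"
    unfolding compact_eq_totally_bounded by auto
  then show "\<forall>e>0. \<exists>k. finite k \<and> S \<subseteq> (\<Union>x\<in>k. ball x e)"
    using closure_subset by (metis subset_trans)
next
  assume R: "\<forall>e>0. \<exists>k. finite k \<and> S \<subseteq> (\<Union>x\<in>k. ball x e)"
  show "compact (closure S)"
    unfolding compact_eq_totally_bounded
  proof (intro conjI allI impI)
    show "complete (closure S)" by (simp add: complete_eq_closed)
    fix e :: real assume e: "0 < e"
    obtain k where k: "finite k" "S \<subseteq> (\<Union>x\<in>k. ball x (e/2))"
      using R e half_gt_zero by blast
    have "closure S \<subseteq> closure (\<Union>x\<in>k. ball x (e/2))" by (rule closure_mono[OF k(2)])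
    also have "\<dots> \<subseteq> (\<Union>x\<in>k. cball x (e/2))"
      using k(1) by (intro closure_minimal UN_mono ball_subset_cball closed_UN) auto
    also have "\<dots> \<subseteq> (\<Union>x\<in>k. ball x e)" using e by auto
    finally show "\<exists>k. finite k \<and> closure S \<subseteq> (\<Union>x\<in>k. ball x e)" using k(1) by blast
  qed
qed

lemma compact_closure_subset:
  fixes S :: "'a :: t2_space set"
  assumes "compact K" "S \<subseteq> K"
  shows "compact (closure S)"
proof -
  have "closure S \<subseteq> K" using assms by (intro closure_minimal compact_imp_closed)
  then have "K \<inter> closure S = closure S" by blast
  then show ?thesis using compact_Int_closed[OF assms(1) closed_closure, of S] by simp
qed

text \<open>An \<open>e/2\<close>-net of the approximating set is an \<open>e\<close>-net of
  \<open>S\<close>. This yields closedness of \<open>H_pc U\<close>, precompactness of almost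
  periodic orbits and precompactness of orbits of bounded energy.\<close>

lemma compact_closure_approx:
  fixes S :: "'a :: banach set"
  assumes "\<And>e. e > 0 \<Longrightarrow> \<exists>K. compact (closure K) \<and> (\<forall>x\<in>S. \<exists>y\<in>K. dist x y < e)"
  shows "compact (closure S)"
  unfolding compact_closure_iff
proof (intro allI impI)
  fix e :: real assume e: "0 < e"
  obtain K where K: "compact (closure K)" "\<And>x. x \<in> S \<Longrightarrow> \<exists>y\<in>K. dist x y < e/2"
    using assms[of "e/2"] e by auto
  obtain k where k: "finite k" "K \<subseteq> (\<Union>x\<in>k. ball x (e/2))"
    using K(1) e half_gt_zero unfolding compact_closure_iff by blast
  have "S \<subseteq> (\<Union>x\<in>k. ball x e)"
  proof
    fix x assume "x \<in> S"
    then obtain y where y: "y \<in> K" "dist x y < e/2" using K(2) by blast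
    then obtain z where z: "z \<in> k" "dist z y < e/2" using k(2) by (auto simp: subset_iff)
    have "dist z x < e"
      using dist_triangle_half_l[of z y e x] y(2) z(2) by (simp add: dist_commute)
    then show "x \<in> (\<Union>x\<in>k. ball x e)" using z(1) by auto
  qed
  then show "\<exists>k. finite k \<and> S \<subseteq> (\<Union>x\<in>k. ball x e)" using k(1) by blast
qed

text \<open>The library has the two facts below only for spans in Euclidean spaces.\<close>

lemma finite_cspan_orthonormal:
  fixes B :: "'h :: complex_hilbert_space set"
  assumes "finite B"
  shows "\<exists>E. finite E \<and> cspan B \<subseteq> cspan E \<and> E \<subseteq> cspan B \<and>
    (\<forall>e\<in>E. \<forall>f\<in>E. cinner e f = (if e = f then 1 else 0))"
  using assms
proof (induction B)
  case empty
  show ?case by (rule exI[of _ "{}"]) auto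
next
  case (insert b B)
  then obtain E where E: "finite E" "cspan B \<subseteq> cspan E" "E \<subseteq> cspan B"
    "\<And>e f. e \<in> E \<Longrightarrow> f \<in> E \<Longrightarrow> cinner e f = (if e = f then 1 else 0)"
    by blast
  have B_sub: "cspan B \<subseteq> cspan (insert b B)" by (rule complex_vector.span_mono) blast
  \<comment> \<open>Gram-Schmidt: \<open>p\<close> is the projection of \<open>b\<close> onto the
    span already treated, and \<open>b - p\<close> is normalized unless it vanishes.\<close>
  define p where "p = (\<Sum>e\<in>E. cinner e b *\<^sub>C e)"
  have pE: "p \<in> cspan E" unfolding p_def
    by (intro complex_vector.span_sum complex_vector.span_scale complex_vector.span_base)
  have p_orth: "cinner f (b - p) = 0" if "f \<in> E" for f
  proof -
    have "cinner f p = (\<Sum>e\<in>E. cinner e b * cinner f e)" by (simp add: p_def cinner_simps)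
    also have "\<dots> = (\<Sum>e\<in>E. if e = f then cinner e b else 0)"
      by (rule sum.cong) (use E(4) that in auto)
    also have "\<dots> = cinner f b" using that E(1) by simp
    finally show ?thesis by (simp add: cinner_simps)
  qed
  show ?case
  proof (cases "b = p")
    case True
    have "cspan (insert b B) \<subseteq> cspan E"
      using True pE E(2) complex_vector.span_superset[of B]
      by (intro complex_vector.span_minimal complex_vector.subspace_span) auto
    then show ?thesis using E B_sub by (intro exI[of _ E]) auto
  next
    case False
    define u where "u = complex_of_real (1 / norm (b - p)) *\<^sub>C (b - p)"
    have uu: "cinner u u = 1" using False by (simp add: u_def cinner_self norm_scaleC norm_divide)
    have fu: "cinner f u = 0" if "f \<in> E" for f using p_orth[OF that] by (simp add: u_def cinner_simps(4))
    have uf: "cinner u f = 0" if "f \<in> E" for f using fu[OF that] by (metis cinner_commute complex_cnj_zero)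
    have "b = p + complex_of_real (norm (b - p)) *\<^sub>C u"
      using False by (simp add: u_def scaleC_scaleC)
    moreover have "p + complex_of_real (norm (b - p)) *\<^sub>C u \<in> cspan (insert u E)"
      using pE complex_vector.span_mono[of E "insert u E"]
      by (intro complex_vector.span_add complex_vector.span_scale[OF complex_vector.span_base]) auto
    ultimately have b: "b \<in> cspan (insert u E)" by simp
    have "B \<subseteq> cspan (insert u E)"
      using E(2) complex_vector.span_superset[of B] complex_vector.span_mono[of E "insert u E"] by blast
    with b have 1: "cspan (insert b B) \<subseteq> cspan (insert u E)"
      by (intro complex_vector.span_minimal complex_vector.subspace_span) auto
    have "p \<in> cspan (insert b B)"
      using pE E(3) B_sub complex_vector.span_minimal[OF E(3) complex_vector.subspace_span] by blast
    then have "u \<in> cspan (insert b B)"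
      unfolding u_def
      using complex_vector.span_base[of b "insert b B"]
      by (intro complex_vector.span_scale complex_vector.span_diff) auto
    then have 2: "insert u E \<subseteq> cspan (insert b B)" using E(3) B_sub by blast
    have "u \<notin> E" using uu fu by fastforce
    then show ?thesis
      using 1 2 E(1,4) uu uf fu by (intro exI[of _ "insert u E"]) auto
  qed
qed

lemma finite_cspan:
  fixes B :: "'h :: complex_hilbert_space set"
  assumes "finite B"
  shows closed_finite_cspan: "closed (cspan B)"
    and compact_closure_finite_cspan: "S \<subseteq> cspan B \<Longrightarrow> bounded S \<Longrightarrow> compact (closure S)"
proof -
  obtain E where E: "finite E" "cspan B \<subseteq> cspan E" "E \<subseteq> cspan B"
    "\<And>e f. e \<in> E \<Longrightarrow> f \<in> E \<Longrightarrow> cinner e f = (if e = f then 1 else 0)"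
    using finite_cspan_orthonormal[OF assms] by blast
  \<comment> \<open>The orthogonal projection onto the span. The span is its fixed point set, hence
    closed by continuity of \<open>P\<close>.\<close>
  define P where "P x = (\<Sum>e\<in>E. cinner e x *\<^sub>C e)" for x
  have P_in: "P x \<in> cspan B" for x
    unfolding P_def using E(3)
    by (intro complex_vector.span_sum complex_vector.span_scale) auto
  have "csubspace {x. P x = x}"
    unfolding complex_vector.subspace_def
  proof (intro conjI ballI allI)
    show "0 \<in> {x. P x = x}" by (simp add: P_def cinner_simps scaleC_simps)
    show "x + y \<in> {x. P x = x}" if "x \<in> {x. P x = x}" "y \<in> {x. P x = x}" for x y
      using that by (simp add: P_def cinner_simps scaleC_simps sum.distrib)
    show "c *\<^sub>C x \<in> {x. P x = x}" if "x \<in> {x. P x = x}" for c x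
    proof -
      have "P (c *\<^sub>C x) = c *\<^sub>C P x" by (simp add: P_def cinner_simps scaleC_simps)
      then show ?thesis using that by simp
    qed
  qed
  moreover have "E \<subseteq> {x. P x = x}"
  proof
    fix f assume f: "f \<in> E"
    have "P f = (\<Sum>e\<in>E. if e = f then f else 0)"
      unfolding P_def by (rule sum.cong) (use E(4) f in auto)
    then show "f \<in> {x. P x = x}" using f E(1) by simp
  qed
  ultimately have "cspan E \<subseteq> {x. P x = x}"
    by (intro complex_vector.span_minimal)
  with E(2) P_in have eq: "cspan B = {x. P x = x}"
    using P_in by (intro equalityI subsetI) (auto, metis)
  show "closed (cspan B)"
    unfolding eq P_def by (intro closed_Collect_eq continuous_intros)
  show "compact (closure S)" if S: "S \<subseteq> cspan B" "bounded S"
  proof -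
    obtain R where R: "\<And>x. x \<in> S \<Longrightarrow> norm x \<le> R" using S(2) by (auto simp: bounded_iff)
    \<comment> \<open>All combinations with coefficients in the disc of radius \<open>R\<close> lie
      in one compact set, built by adding one basis vector at a time. Bounded vectors have such
      coefficients by Cauchy-Schwarz.\<close>
    have "\<exists>K. compact K \<and> (\<forall>g. (\<forall>e\<in>F. cmod (g e) \<le> R) \<longrightarrow> (\<Sum>e\<in>F. g e *\<^sub>C e) \<in> K)"
      if "finite F" for F :: "'h set"
      using that
    proof (induction F)
      case empty
      show ?case by (rule exI[of _ "{0}"]) auto
    next
      case (insert e F)
      then obtain K where K: "compact K"
        "\<And>g. (\<forall>e\<in>F. cmod (g e) \<le> R) \<Longrightarrow> (\<Sum>e\<in>F. g e *\<^sub>C e) \<in> K" by blast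
      let ?K = "(\<lambda>(z, y). z *\<^sub>C e + y) ` (cball 0 R \<times> K)"
      have "compact ?K"
        using K(1) unfolding split_beta
        by (intro compact_continuous_image compact_Times continuous_intros) auto
      moreover have "(\<Sum>e\<in>insert e F. g e *\<^sub>C e) \<in> ?K" if "\<forall>e\<in>insert e F. cmod (g e) \<le> R" for g
        using insert.hyps that K(2)[of g]
        by (intro image_eqI[of _ _ "(g e, \<Sum>e\<in>F. g e *\<^sub>C e)"]) auto
      ultimately show ?case by blast
    qed
    from this[OF E(1)] obtain K where K: "compact K"
      "\<And>g. (\<forall>e\<in>E. cmod (g e) \<le> R) \<Longrightarrow> (\<Sum>e\<in>E. g e *\<^sub>C e) \<in> K" by blast
    have "S \<subseteq> K"
    proof
      fix x assume x: "x \<in> S"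
      have "cmod (cinner e x) \<le> R" if "e \<in> E" for e
      proof -
        have "norm e = 1"
          using E(4)[OF that that] by (simp add: cinner_self power2_eq_1_iff flip: of_real_power)
          (smt (verit) norm_ge_zero)
        then show ?thesis using cmod_cinner_le[of e x] R[OF x] by simp
      qed
      then have "P x \<in> K" unfolding P_def using K(2)[of "\<lambda>e. cinner e x"] by blast
      then show "x \<in> K" using x S(1) eq by auto
    qed
    with K(1) show ?thesis by (rule compact_closure_subset)
  qed
qed


section \<open>Self-adjoint operators with discrete spectrum\<close>

text \<open>If both \<open>R - \<rho>\<close> and \<open>R + \<rho>\<close> were bounded below, so
  would be their product \<open>R^2 - \<rho>^2\<close>. Expanding the square of its norm by symmetry
  then gives a bound for \<open>R\<close> strictly better than \<open>\<rho>\<close>, against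
  \<open>sharp\<close>.\<close>

lemma symmetric_norm_not_both_bounded_below:
  fixes R :: "'a :: real_inner \<Rightarrow> 'a"
  assumes M: "subspace M" and R: "linear R" "\<And>x. x \<in> M \<Longrightarrow> R x \<in> M"
    and sym: "\<And>x y. x \<in> M \<Longrightarrow> y \<in> M \<Longrightarrow> inner (R x) y = inner x (R y)"
    and \<rho>: "\<rho> > 0" "\<And>y. y \<in> M \<Longrightarrow> norm (R y) \<le> \<rho> * norm y"
    and sharp: "\<And>\<rho>'. 0 \<le> \<rho>' \<Longrightarrow> \<rho>' < \<rho> \<Longrightarrow> \<exists>y\<in>M. \<rho>' * norm y < norm (R y)"
  shows "\<exists>\<sigma>\<in>{-1, 1}. \<not> (\<exists>c>0. \<forall>y\<in>M. c * norm y \<le> norm (R y - (\<sigma> * \<rho>) *\<^sub>R y))"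
proof (rule ccontr)
  assume "\<not> ?thesis"
  then obtain c1 c2 where c1: "c1 > 0" "\<And>y. y \<in> M \<Longrightarrow> c1 * norm y \<le> norm (R y - \<rho> *\<^sub>R y)"
    and c2: "c2 > 0" "\<And>y. y \<in> M \<Longrightarrow> c2 * norm y \<le> norm (R y + \<rho> *\<^sub>R y)"
    by auto
  define b where "b = c1 * c2"
  have b: "b > 0" using c1(1) c2(1) by (simp add: b_def)
  have le: "\<rho>\<^sup>2 * (norm (R y))\<^sup>2 \<le> (\<rho>\<^sup>2 * \<rho>\<^sup>2 - b\<^sup>2) * (norm y)\<^sup>2" if y: "y \<in> M" for y
  proof -
    let ?w = "R y + \<rho> *\<^sub>R y"
    have w: "?w \<in> M" using y M R(2) by (simp add: subspace_add subspace_scale)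
    have "R ?w - \<rho> *\<^sub>R ?w = R (R y) - \<rho>\<^sup>2 *\<^sub>R y"
      using R(1) by (simp add: linear_add linear_scale algebra_simps power2_eq_square)
    then have "b * norm y \<le> norm (R (R y) - \<rho>\<^sup>2 *\<^sub>R y)"
      using c1(2)[OF w] mult_left_mono[OF c2(2)[OF y], of c1] c1(1)
      by (simp only: b_def mult.assoc) linarith
    then have "b\<^sup>2 * (norm y)\<^sup>2 \<le> (norm (R (R y) - \<rho>\<^sup>2 *\<^sub>R y))\<^sup>2"
      using b by (metis mult_nonneg_nonneg norm_ge_zero order_less_imp_le power_mono power_mult_distrib)
    also have "\<dots> = (norm (R (R y)))\<^sup>2 - 2 * \<rho>\<^sup>2 * inner (R (R y)) y + \<rho>\<^sup>2 * \<rho>\<^sup>2 * (norm y)\<^sup>2"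
      unfolding power2_norm_eq_inner by (simp add: inner_simps inner_commute algebra_simps)
    also have "inner (R (R y)) y = (norm (R y))\<^sup>2"
      using sym[OF R(2)[OF y] y] by (simp add: power2_norm_eq_inner)
    also have "(norm (R (R y)))\<^sup>2 \<le> \<rho>\<^sup>2 * (norm (R y))\<^sup>2"
      using power_mono[OF \<rho>(2)[OF R(2)[OF y]], of 2] by (simp add: power_mult_distrib)
    finally show ?thesis by (simp add: algebra_simps)
  qed
  \<comment> \<open>The maximum with 0 keeps the improved constant nonnegative, as
    \<open>sharp\<close> requires.\<close>
  define m where "m = max 0 (\<rho>\<^sup>2 - b\<^sup>2 / \<rho>\<^sup>2)"
  have m: "0 \<le> m" "m < \<rho>\<^sup>2" using b \<rho>(1) by (auto simp: m_def)
  have "sqrt m < \<rho>" using m \<rho>(1) by (intro real_less_lsqrt) auto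
  then obtain y where y: "y \<in> M" "sqrt m * norm y < norm (R y)" using sharp[of "sqrt m"] m by auto
  have "(sqrt m * norm y)\<^sup>2 < (norm (R y))\<^sup>2"
    using y(2) m by (intro power_strict_mono) auto
  then have "m * (norm y)\<^sup>2 < (norm (R y))\<^sup>2" using m by (simp add: power_mult_distrib)
  moreover have "(norm (R y))\<^sup>2 \<le> (\<rho>\<^sup>2 - b\<^sup>2 / \<rho>\<^sup>2) * (norm y)\<^sup>2"
    using le[OF y(1)] \<rho>(1) by (simp add: field_simps)
  moreover have "(\<rho>\<^sup>2 - b\<^sup>2 / \<rho>\<^sup>2) * (norm y)\<^sup>2 \<le> m * (norm y)\<^sup>2"
    by (intro mult_right_mono) (auto simp: m_def)
  ultimately show False by linarith
qed

lemma dense_cinner_eq: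
  fixes z w :: "'h :: complex_hilbert_space"
  assumes "closure D = UNIV" "\<And>u. u \<in> D \<Longrightarrow> cinner u z = cinner u w"
  shows "z = w"
proof -
  have "closed {u. cinner u z = cinner u w}"
    by (intro closed_Collect_eq continuous_intros)
  then have "closure D \<subseteq> {u. cinner u z = cinner u w}"
    using assms(2) by (intro closure_minimal) auto
  then have "cinner (z - w) z = cinner (z - w) w" using assms(1) by auto
  then have "cinner (z - w) (z - w) = 0" by (simp add: cinner_simps)
  then show ?thesis by (simp add: cinner_self)
qed

text \<open>\<open>adjoint_operator\<close> hides its value behind \<open>THE\<close>; density of
  the domain makes the witness unique, so that its defining identity can be recovered.\<close>

lemma self_adjoint_symmetric:
  assumes A: "self_adjoint A" and x: "x \<in> dom A" and y: "y \<in> dom A"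
  shows "cinner (the (A x)) y = cinner x (the (A y))"
proof -
  let ?P = "\<lambda>z. \<forall>u\<in>dom A. cinner (the (A u)) y = cinner u z"
  have dense: "closure (dom A) = UNIV" and adj: "adjoint_operator A = A"
    using A by (auto simp: self_adjoint_def)
  have y': "adjoint_operator A y = Some (the (A y))" using y adj by auto
  then have ex: "\<exists>z. ?P z" and the: "(THE z. ?P z) = the (A y)"
    unfolding adjoint_operator_def by (auto split: if_splits)
  have "\<exists>!z. ?P z" using ex dense_cinner_eq[OF dense] by (metis (no_types, lifting))
  from theI'[OF this] have "?P (the (A y))" unfolding the .
  then show ?thesis using x by blast
qed

section \<open>Completeness of the eigenvectors\<close>

locale discrete_self_adjoint =
  fixes A :: "'h :: complex_hilbert_space \<rightharpoonup> 'h"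
  assumes sa: "self_adjoint A" and ds: "discrete_spectrum A"
begin

definition act :: "'h \<Rightarrow> 'h" where "act x = the (A x)"
definition eigvecs :: "'h set" where "eigvecs = (\<Union>e. eigenspace A (complex_of_real e))"
definition M :: "'h set" where "M = orth_compl eigvecs"

text \<open>Tested on \<open>dom A \<inter> M\<close> only: failure at \<open>t\<close> means that
  \<open>t\<close> is in the approximate spectrum of the part of \<open>A\<close> in
  \<open>M\<close>.\<close>

definition bounded_below :: "real \<Rightarrow> bool"
  where "bounded_below t \<longleftrightarrow> (\<exists>c>0. \<forall>x\<in>dom A \<inter> M. c * norm x \<le> norm (act x - t *\<^sub>R x))"

lemma dom_csubspace: "csubspace (dom A)"
  and act_add: "x \<in> dom A \<Longrightarrow> y \<in> dom A \<Longrightarrow> act (x + y) = act x + act y"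
  and act_scaleC: "x \<in> dom A \<Longrightarrow> act (c *\<^sub>C x) = c *\<^sub>C act x"
  using sa unfolding self_adjoint_def linear_operator_def act_def by blast+

lemmas dom_subspace = csubspace_imp_subspace[OF dom_csubspace]

lemma act_scaleR: "x \<in> dom A \<Longrightarrow> act (c *\<^sub>R x) = c *\<^sub>R act x"
  by (metis act_scaleC scaleC_of_real)

lemma act_diff: "x \<in> dom A \<Longrightarrow> y \<in> dom A \<Longrightarrow> act (x - y) = act x - act y"
  using act_add[of x "(-1) *\<^sub>R y"] act_scaleR[of y "-1"] dom_subspace
  by (simp add: subspace_neg)

lemma act_csymmetric: "x \<in> dom A \<Longrightarrow> y \<in> dom A \<Longrightarrow> cinner (act x) y = cinner x (act y)"
  using self_adjoint_symmetric[OF sa] by (simp add: act_def)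

lemma act_symmetric: "x \<in> dom A \<Longrightarrow> y \<in> dom A \<Longrightarrow> inner (act x) y = inner x (act y)"
  using act_csymmetric by (metis Re_cinner)

lemma eigenspace_iff: "x \<in> eigenspace A (complex_of_real e) \<longleftrightarrow> x \<in> dom A \<and> act x = e *\<^sub>R x"
  unfolding eigenspace_def act_def by (auto simp: scaleC_of_real)

lemma eigenvalue_in_spectrum:
  assumes "x \<noteq> 0" "x \<in> eigenspace A (complex_of_real e)"
  shows "complex_of_real e \<in> spectrum A"
proof -
  have "\<not> inj_on (\<lambda>x. the (A x) - complex_of_real e *\<^sub>C x) (dom A)"
  proof
    assume "inj_on (\<lambda>x. the (A x) - complex_of_real e *\<^sub>C x) (dom A)"
    moreover have "0 \<in> dom A" by (rule subspace_0[OF dom_subspace])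
    moreover have "act 0 = 0" using act_scaleR[OF \<open>0 \<in> dom A\<close>, of 0] by simp
    ultimately show False
      using assms unfolding eigenspace_iff inj_on_def
      by (auto simp: act_def scaleC_of_real dest!: bspec[of _ _ x])
  qed
  then show ?thesis by (auto simp: spectrum_def resolvent_set_def bij_betw_def)
qed

lemma resolventE:
  assumes "complex_of_real t \<notin> spectrum A"
  obtains R where "bounded_linear R" "\<And>y. R y \<in> dom A" "\<And>y. act (R y) - t *\<^sub>R R y = y"
    "\<And>x. x \<in> dom A \<Longrightarrow> R (act x - t *\<^sub>R x) = x"
proof
  let ?f = "\<lambda>x. the (A x) - complex_of_real t *\<^sub>C x"
  define R where "R = inv_into (dom A) ?f"
  have bij: "bij_betw ?f (dom A) UNIV" and bl: "bounded_linear R"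
    using assms unfolding R_def spectrum_def resolvent_set_def by auto
  show "bounded_linear R" by (rule bl)
  show "R y \<in> dom A" for y
    unfolding R_def using bij by (intro inv_into_into) (auto simp: bij_betw_def)
  show "act (R y) - t *\<^sub>R R y = y" for y
    using bij_betw_inv_into_right[OF bij, of y] by (simp add: R_def act_def scaleC_of_real)
  show "R (act x - t *\<^sub>R x) = x" if "x \<in> dom A" for x
    using bij_betw_inv_into_left[OF bij that] by (simp add: R_def act_def scaleC_of_real)
qed

lemma resolvent_symmetric:
  assumes "\<And>y. R y \<in> dom A" "\<And>y. act (R y) - t *\<^sub>R R y = y"
  shows "inner (R x) y = inner x (R y)"
proof -
  have "inner (R x) (act (R y) - t *\<^sub>R R y) = inner (act (R x) - t *\<^sub>R R x) (R y)"
    using act_symmetric[OF assms(1) assms(1), of x y] by (simp add: inner_simps)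
  then show ?thesis by (simp add: assms(2))
qed

lemma M_csubspace: "csubspace M" and M_closed: "closed M"
  unfolding M_def by (rule csubspace_orth_compl closed_orth_compl)+

lemmas M_subspace = csubspace_imp_subspace[OF M_csubspace]

lemma in_M_iff: "x \<in> M \<longleftrightarrow> (\<forall>e. \<forall>v\<in>eigenspace A (complex_of_real e). cinner v x = 0)"
  by (auto simp: M_def eigvecs_def orth_compl_def)

lemma act_in_M:
  assumes "x \<in> dom A" "x \<in> M"
  shows "act x \<in> M"
  unfolding in_M_iff
proof (intro allI ballI)
  fix e v assume v: "v \<in> eigenspace A (complex_of_real e)"
  then have "cinner v (act x) = cinner (e *\<^sub>R v) x"
    using act_csymmetric[of v x] assms(1) by (simp add: eigenspace_iff)
  then show "cinner v (act x) = 0" using assms(2) v by (simp add: in_M_iff cinner_scaleR_left)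
qed

text \<open>Pairing with an eigenvector \<open>v\<close> for \<open>e\<close> produces the factor
  \<open>e - t\<close>, which is nonzero because \<open>t\<close> is not an eigenvalue. Hence the
  resolvent at \<open>t\<close> maps \<open>M\<close> into itself.\<close>

lemma resolvent_in_M:
  assumes t: "complex_of_real t \<notin> spectrum A" and x: "x \<in> dom A" and y: "act x - t *\<^sub>R x \<in> M"
  shows "x \<in> M"
  unfolding in_M_iff
proof (intro allI ballI)
  fix e v assume v: "v \<in> eigenspace A (complex_of_real e)"
  show "cinner v x = 0"
  proof (cases "v = 0")
    case False
    then have "e \<noteq> t" using eigenvalue_in_spectrum[OF _ v] t by auto
    have "0 = cinner v (act x - t *\<^sub>R x)" using y v by (simp add: in_M_iff)
    also have "\<dots> = cinner (act v) x - t * cinner v x"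
      using act_csymmetric[of v x] x v
      by (simp add: cinner_simps cinner_scaleR_right eigenspace_iff scaleR_conv_of_real)
    also have "\<dots> = (e - t) * cinner v x"
      using v by (simp add: eigenspace_iff cinner_scaleR_left scaleR_conv_of_real algebra_simps)
    finally show ?thesis using \<open>e \<noteq> t\<close> by simp
  qed (simp add: cinner_simps)
qed

lemma bounded_below_resolvent:
  assumes t: "complex_of_real t \<notin> spectrum A"
  shows "bounded_below t"
proof -
  obtain R where R: "bounded_linear R" "\<And>x. x \<in> dom A \<Longrightarrow> R (act x - t *\<^sub>R x) = x"
    using resolventE[OF t] by metis
  obtain K where K: "K > 0" "\<And>x. norm (R x) \<le> norm x * K"
    using bounded_linear.pos_bounded[OF R(1)] by blast
  have "1 / K * norm x \<le> norm (act x - t *\<^sub>R x)" if "x \<in> dom A" for x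
    using K(2)[of "act x - t *\<^sub>R x"] R(2)[OF that] K(1) by (simp add: field_simps)
  then show ?thesis unfolding bounded_below_def using K(1) by (intro exI[of _ "1/K"]) auto
qed

text \<open>Let \<open>\<rho>\<close> be the norm on \<open>M\<close> of the resolvent
  \<open>R\<close> at \<open>t\<close>. For one sign \<open>\<sigma>\<close> the operator
  \<open>R - \<sigma> \<rho>\<close> is not bounded below, and inverting moves this to
  \<open>A\<close> at \<open>s = t + \<sigma> / \<rho>\<close>. So \<open>\<bar>s - t\<bar>\<close>
  is \<open>1 / \<rho>\<close>, and the second claim is the norm bound for \<open>R\<close>.\<close>

lemma nearest_not_bounded_below:
  assumes t: "complex_of_real t \<notin> spectrum A" and ne: "M \<noteq> {0}"
  obtains s where "\<not> bounded_below s"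
    "\<And>x. x \<in> dom A \<inter> M \<Longrightarrow> \<bar>s - t\<bar> * norm x \<le> norm (act x - t *\<^sub>R x)"
proof -
  obtain R where R: "bounded_linear R" "\<And>y. R y \<in> dom A" "\<And>y. act (R y) - t *\<^sub>R R y = y"
    "\<And>x. x \<in> dom A \<Longrightarrow> R (act x - t *\<^sub>R x) = x"
    using resolventE[OF t] by blast
  have lin: "linear R" using R(1) by (rule bounded_linear.linear)
  have RM: "R y \<in> M" if "y \<in> M" for y
    using resolvent_in_M[OF t R(2)] R(3) that by simp
  note sym = resolvent_symmetric[OF R(2,3)]
  obtain K where K: "K > 0" "\<And>x. norm (R x) \<le> norm x * K"
    using bounded_linear.pos_bounded[OF R(1)] by blast
  define S where "S = {norm (R y) / norm y |y. y \<in> M \<and> y \<noteq> 0}"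
  define \<rho> where "\<rho> = Sup S"
  have "bdd_above S" unfolding S_def
    using K(2) by (intro bdd_aboveI[of _ K]) (auto simp: field_simps)
  obtain v where v: "v \<in> M" "v \<noteq> 0" using ne subspace_0[OF M_subspace] by auto
  have S_ne: "S \<noteq> {}" using v by (auto simp: S_def)
  have bound: "norm (R y) \<le> \<rho> * norm y" if "y \<in> M" for y
  proof (cases "y = 0")
    case False
    then have "norm (R y) / norm y \<le> \<rho>"
      unfolding \<rho>_def using that \<open>bdd_above S\<close> by (intro cSup_upper) (auto simp: S_def)
    then show ?thesis using False by (simp add: field_simps)
  qed (simp add: linear_0[OF lin])
  have T0: "act 0 = 0" using act_scaleR[OF subspace_0[OF dom_subspace], of 0] by simp
  have "R v \<noteq> 0" using R(3)[of v] v(2) T0 by auto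
  then have "0 < \<rho> * norm v" using bound[OF v(1)] by (smt (verit) norm_le_zero_iff)
  then have \<rho>: "\<rho> > 0" using v(2) by (simp add: zero_less_mult_iff)
  have sharp: "\<exists>y\<in>M. \<rho>' * norm y < norm (R y)" if less: "\<rho>' < \<rho>" for \<rho>'
  proof -
    obtain q where "q \<in> S" "\<rho>' < q"
      using less less_cSupD[OF S_ne] unfolding \<rho>_def by metis
    then obtain y where "y \<in> M" "y \<noteq> 0" "\<rho>' < norm (R y) / norm y" by (auto simp: S_def)
    then show ?thesis by (intro bexI[of _ y]) (simp_all add: pos_less_divide_eq)
  qed
  obtain \<sigma> where \<sigma>: "\<sigma> \<in> {-1, 1}"
    "\<not> (\<exists>c>0. \<forall>y\<in>M. c * norm y \<le> norm (R y - (\<sigma> * \<rho>) *\<^sub>R y))"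
    using symmetric_norm_not_both_bounded_below[OF M_subspace lin RM sym \<rho> bound sharp] by blast
  define s where "s = t + \<sigma> / \<rho>"
  have \<sigma>1: "\<bar>\<sigma>\<bar> = 1" "\<sigma> * \<sigma> = 1" using \<sigma>(1) by auto
  show thesis
  proof (rule that)
    show "\<not> bounded_below s"
    proof
      assume "bounded_below s"
      then obtain c where c: "c > 0" "\<And>x. x \<in> dom A \<inter> M \<Longrightarrow> c * norm x \<le> norm (act x - s *\<^sub>R x)"
        unfolding bounded_below_def by blast
      \<comment> \<open>On \<open>R y\<close> the operator \<open>A - s\<close> acts as
        \<open>- \<sigma> / \<rho>\<close> times \<open>R - \<sigma> \<rho>\<close> on
        \<open>y\<close>. The constant results from combining the lower bound at \<open>s\<close>
        with \<open>\<rho> \<parallel>y\<parallel> \<le> \<parallel>R y\<parallel> + \<parallel>R y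
        - \<sigma> \<rho> y\<parallel>\<close>.\<close>
      have "(c * \<rho> / (c + 1 / \<rho>)) * norm y \<le> norm (R y - (\<sigma> * \<rho>) *\<^sub>R y)" if y: "y \<in> M" for y
      proof -
        have "act (R y) - s *\<^sub>R R y = y - (\<sigma> / \<rho>) *\<^sub>R R y"
          using R(3)[of y] by (simp add: s_def algebra_simps)
        also have "\<dots> = (- \<sigma> / \<rho>) *\<^sub>R (R y - (\<sigma> * \<rho>) *\<^sub>R y)"
          using \<rho> \<sigma>1 by (simp add: algebra_simps)
        finally have 1: "c * norm (R y) \<le> norm (R y - (\<sigma> * \<rho>) *\<^sub>R y) / \<rho>"
          using c(2)[of "R y"] R(2) RM[OF y] \<sigma>1 \<rho> by simp
        have "\<rho> * norm y = norm ((\<sigma> * \<rho>) *\<^sub>R y)" using \<sigma>1 \<rho> by (simp add: abs_mult)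
        also have "\<dots> \<le> norm (R y) + norm (R y - (\<sigma> * \<rho>) *\<^sub>R y)"
          using norm_triangle_ineq4[of "R y" "R y - (\<sigma> * \<rho>) *\<^sub>R y"] by simp
        finally have "c * (\<rho> * norm y) \<le> c * norm (R y) + c * norm (R y - (\<sigma> * \<rho>) *\<^sub>R y)"
          using c(1) by (metis distrib_left mult_le_cancel_left_pos)
        with 1 have "c * \<rho> * norm y \<le> (c + 1 / \<rho>) * norm (R y - (\<sigma> * \<rho>) *\<^sub>R y)"
          by (simp add: algebra_simps)
        moreover have "0 < c + 1 / \<rho>" using c(1) \<rho> by (simp add: add_pos_pos)
        ultimately show ?thesis by (simp add: pos_divide_le_eq mult.commute)
      qed
      moreover have "0 < c * \<rho> / (c + 1 / \<rho>)"
        using c(1) \<rho> by (intro divide_pos_pos add_pos_pos) auto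
      ultimately show False using \<sigma>(2) by blast
    qed
    show "\<bar>s - t\<bar> * norm x \<le> norm (act x - t *\<^sub>R x)" if x: "x \<in> dom A \<inter> M" for x
    proof -
      have "act x - t *\<^sub>R x \<in> M"
        using x act_in_M M_subspace by (simp add: subspace_diff subspace_scale)
      from bound[OF this] have "norm x \<le> \<rho> * norm (act x - t *\<^sub>R x)" using R(4) x by auto
      then show ?thesis using \<rho> \<sigma>1 by (simp add: s_def field_simps)
    qed
  qed
qed

lemma spectrum_isolated:
  assumes "complex_of_real s \<in> spectrum A"
  obtains d where "d > 0" "\<And>t. t \<noteq> s \<Longrightarrow> \<bar>t - s\<bar> < d \<Longrightarrow> complex_of_real t \<notin> spectrum A"
proof -
  obtain d where d: "d > 0" "\<And>z. z \<in> spectrum A \<Longrightarrow> z \<noteq> complex_of_real s \<Longrightarrow> d \<le> dist z (complex_of_real s)"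
    using ds assms unfolding discrete_spectrum_def islimpt_approachable by (meson not_le)
  show thesis
  proof (rule that[OF d(1)])
    show "complex_of_real t \<notin> spectrum A" if "t \<noteq> s" "\<bar>t - s\<bar> < d" for t
      using d(2)[of "complex_of_real t"] that by (auto simp: dist_real_def)
  qed
qed

lemma ex_not_in_spectrum: "\<exists>t::real. complex_of_real t \<notin> spectrum A"
proof (rule ccontr)
  assume "\<not> ?thesis"
  then have all: "complex_of_real t \<in> spectrum A" for t by blast
  obtain d where "d > 0" "\<And>t. t \<noteq> 0 \<Longrightarrow> \<bar>t - 0\<bar> < d \<Longrightarrow> complex_of_real t \<notin> spectrum A"
    using spectrum_isolated[OF all[of 0]] by blast
  from this(1) this(2)[of "d/2"] all[of "d/2"] show False by auto
qed

text \<open>Near a spectral point \<open>s\<close> at which \<open>A\<close> is not bounded below on \<open>M\<close>, the distance from \<open>t\<close>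
  to the spectrum is \<open>\<bar>t - s\<bar>\<close>. With \<open>B = A - s\<close> this gives \<open>d \<bar>\<langle>Bx, x\<rangle>\<bar> \<le> \<parallel>Bx\<parallel>\<^sup>2\<close>, and
  polarization in the variable \<open>Bx\<close>, which ranges over a dense subset of \<open>M\<close>, gives
  \<open>d \<parallel>x\<parallel> \<le> \<parallel>Bx\<parallel>\<close>.\<close>

lemma M_trivial: "M = {0}"
proof (rule ccontr)
  assume ne: "M \<noteq> {0}"
  obtain t0 where t0: "complex_of_real t0 \<notin> spectrum A" using ex_not_in_spectrum by blast
  obtain s where s: "\<not> bounded_below s" by (rule nearest_not_bounded_below[OF t0 ne])
  then have s_spec: "complex_of_real s \<in> spectrum A" using bounded_below_resolvent by blast
  obtain d where d: "d > 0" "\<And>t. t \<noteq> s \<Longrightarrow> \<bar>t - s\<bar> < d \<Longrightarrow> complex_of_real t \<notin> spectrum A"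
    using spectrum_isolated[OF s_spec] by blast
  define B where "B x = act x - s *\<^sub>R x" for x
  have B_add: "B (x + y) = B x + B y" and B_diff: "B (x - y) = B x - B y"
    if "x \<in> dom A" "y \<in> dom A" for x y
    using that by (simp_all add: B_def act_add act_diff algebra_simps)
  have B_scale: "B (c *\<^sub>R x) = c *\<^sub>R B x" if "x \<in> dom A" for x c
    using that by (simp add: B_def act_scaleR algebra_simps)
  have B_sym: "inner (B x) y = inner x (B y)" if "x \<in> dom A" "y \<in> dom A" for x y
    using act_symmetric[OF that] by (simp add: B_def inner_simps)
  have DM: "subspace (dom A \<inter> M)" by (intro subspace_inter dom_subspace M_subspace)
  have gap: "\<bar>h\<bar> * norm x \<le> norm (B x - h *\<^sub>R x)"
    if h: "h \<noteq> 0" "\<bar>h\<bar> < d / 2" and x: "x \<in> dom A \<inter> M" for h x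
  proof -
    have t: "complex_of_real (s + h) \<notin> spectrum A" by (rule d(2)) (use h in auto)
    obtain s' where s': "\<not> bounded_below s'"
      "\<And>x. x \<in> dom A \<inter> M \<Longrightarrow> \<bar>s' - (s + h)\<bar> * norm x \<le> norm (act x - (s + h) *\<^sub>R x)"
      by (rule nearest_not_bounded_below[OF t ne]) blast
    \<comment> \<open>A larger distance would survive the perturbation from \<open>s + h\<close> to
      \<open>s\<close> and make \<open>A\<close> bounded below at \<open>s\<close>. With the bound,
      \<open>s'\<close> is within \<open>d\<close> of \<open>s\<close> and isolation forces
      \<open>s' = s\<close>.\<close>
    have "\<bar>s' - (s + h)\<bar> \<le> \<bar>h\<bar>"
    proof (rule ccontr)
      assume "\<not> ?thesis"
      moreover have "(\<bar>s' - (s + h)\<bar> - \<bar>h\<bar>) * norm x \<le> norm (act x - s *\<^sub>R x)"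
        if x: "x \<in> dom A \<inter> M" for x
      proof -
        have "norm (act x - (s + h) *\<^sub>R x) \<le> norm (act x - s *\<^sub>R x) + \<bar>h\<bar> * norm x"
          using norm_triangle_ineq4[of "act x - s *\<^sub>R x" "h *\<^sub>R x"] by (simp add: algebra_simps)
        with s'(2)[OF x] show ?thesis by (simp add: algebra_simps)
      qed
      ultimately have "bounded_below s"
        unfolding bounded_below_def by (intro exI[of _ "\<bar>s' - (s + h)\<bar> - \<bar>h\<bar>"]) auto
      with s show False by blast
    qed
    then have "\<bar>s' - s\<bar> < d" using h by linarith
    then have "s' = s" using d(2)[of s'] s'(1) bounded_below_resolvent by blast
    then show ?thesis using s'(2)[OF x] by (simp add: B_def algebra_simps)
  qed
  define k where "k = d / 2"
  have k: "k > 0" using d(1) by (simp add: k_def)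
  have form: "k * \<bar>inner (B x) x\<bar> \<le> (norm (B x))\<^sup>2" if x: "x \<in> dom A \<inter> M" for x
  proof -
    have 1: "2 * h * inner (B x) x \<le> (norm (B x))\<^sup>2" if h: "h \<noteq> 0" "\<bar>h\<bar> < d / 2" for h
    proof -
      have "(\<bar>h\<bar> * norm x)\<^sup>2 \<le> (norm (B x - h *\<^sub>R x))\<^sup>2"
        using gap[OF h x] by (intro power_mono) auto
      also have "\<dots> = (norm (B x))\<^sup>2 - 2 * h * inner (B x) x + h\<^sup>2 * (norm x)\<^sup>2"
        unfolding power2_norm_eq_inner by (simp add: inner_simps inner_commute power2_eq_square algebra_simps)
      finally show ?thesis by (simp add: power_mult_distrib)
    qed
    \<comment> \<open>Squaring the gap estimate cancels the quadratic term in \<open>h\<close>; the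
      two signs of \<open>h\<close> give the absolute value, and \<open>h = d/4\<close> gives
      \<open>k = d/2\<close>.\<close>
    from 1[of "d/4"] 1[of "-d/4"] d(1) show ?thesis by (simp add: k_def abs_if)
  qed
  have pol: "k * inner (B x) y \<le> norm (B x) * norm (B y)"
    if x: "x \<in> dom A \<inter> M" and y: "y \<in> dom A \<inter> M" for x y
  proof -
    have half: "2 * k * inner (B x) y \<le> (norm (B x))\<^sup>2 + (norm (B y))\<^sup>2"
      if x: "x \<in> dom A \<inter> M" and y: "y \<in> dom A \<inter> M" for x y
    proof -
      have "4 * inner (B x) y = inner (B (x + y)) (x + y) - inner (B (x - y)) (x - y)"
        using x y B_sym[of x y]
        by (simp add: B_add B_diff inner_simps inner_commute)
      then have "4 * k * inner (B x) y = k * inner (B (x + y)) (x + y) - k * inner (B (x - y)) (x - y)"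
        by (simp flip: right_diff_distrib)
      also have "\<dots> \<le> k * \<bar>inner (B (x + y)) (x + y)\<bar> + k * \<bar>inner (B (x - y)) (x - y)\<bar>"
        using k by (smt (verit) mult_left_mono mult_minus_right)
      also have "\<dots> \<le> (norm (B (x + y)))\<^sup>2 + (norm (B (x - y)))\<^sup>2"
        by (intro add_mono form subspace_add[OF DM] subspace_diff[OF DM] x y)
      also have "\<dots> = 2 * (norm (B x))\<^sup>2 + 2 * (norm (B y))\<^sup>2"
        using x y parallelogram by (simp add: B_add B_diff)
      finally show ?thesis by simp
    qed
    \<comment> \<open>Scaling \<open>x\<close> by \<open>c\<close> and \<open>y\<close> by
      \<open>1/c\<close> leaves the left side alone; the choice
      \<open>c^2 = \<parallel>B y\<parallel> / \<parallel>B x\<parallel>\<close> below turns the sum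
      of squares into a product.\<close>
    have sc: "2 * k * inner (B x) y \<le> c\<^sup>2 * (norm (B x))\<^sup>2 + (norm (B y))\<^sup>2 / c\<^sup>2" if "c > 0" for c
      using half[OF subspace_scale[OF DM x, of c] subspace_scale[OF DM y, of "1/c"]] x y that
      by (simp add: B_scale power_mult_distrib power_divide)
    show ?thesis
    proof (cases "norm (B x) = 0 \<or> norm (B y) = 0")
      case True
      then have "inner (B x) y = 0" using B_sym[of x y] x y by auto
      then show ?thesis by simp
    next
      case False
      then show ?thesis
        using sc[of "sqrt (norm (B y) / norm (B x))"] by (simp add: field_simps power2_eq_square)
    qed
  qed
  define S where "S = B ` (dom A \<inter> M)"
  have S: "csubspace (closure S)"
  proof (intro csubspace_closure complex_vector.subspaceI)
    show "0 \<in> S" unfolding S_def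
      using subspace_0[OF DM] B_scale[of 0 0] by force
    show "x + y \<in> S" if xy: "x \<in> S" "y \<in> S" for x y
    proof -
      obtain u v where "u \<in> dom A \<inter> M" "x = B u" "v \<in> dom A \<inter> M" "y = B v"
        using xy by (auto simp: S_def)
      then show ?thesis
        unfolding S_def using B_add subspace_add[OF DM, of u v] by (intro image_eqI[of _ _ "u + v"]) auto
    qed
    show "c *\<^sub>C x \<in> S" if x: "x \<in> S" for c x
    proof -
      obtain y where y: "y \<in> dom A \<inter> M" "x = B y" using x by (auto simp: S_def)
      have "B (c *\<^sub>C y) = c *\<^sub>C x"
        using y by (simp add: B_def act_scaleC scaleC_simps scaleR_scaleC_commute)
      moreover have "c *\<^sub>C y \<in> dom A \<inter> M"
        using y(1) complex_vector.subspace_scale dom_csubspace M_csubspace by blast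
      ultimately show ?thesis unfolding S_def by (metis image_eqI)
    qed
  qed
  have dense: "M \<subseteq> closure S"
  proof
    fix m assume m: "m \<in> M"
    obtain y where y: "y \<in> closure S" "m - y \<in> orth_compl (closure S)"
      using closed_csubspace_decomp[OF S closed_closure] by blast
    have "S \<subseteq> M"
      unfolding S_def B_def
      by (auto intro!: subspace_diff[OF M_subspace] subspace_scale[OF M_subspace] act_in_M)
    then have "y \<in> M" using y(1) M_closed closure_minimal by blast
    define z where "z = m - y"
    have zM: "z \<in> M" using m \<open>y \<in> M\<close> M_subspace by (simp add: z_def subspace_diff)
    obtain R where R: "bounded_linear R" "\<And>y. R y \<in> dom A" "\<And>y. act (R y) - t0 *\<^sub>R R y = y"
      using resolventE[OF t0] by metis
    have RM: "R y \<in> M" if "y \<in> M" for y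
      using resolvent_in_M[OF t0 R(2)] R(3) that by simp
    have orth: "inner (B u) z = 0" if "u \<in> dom A \<inter> M" for u
      using y(2) that closure_subset[of S] inner_orth_0(1)[of "B u" "closure S" z]
      by (auto simp: S_def z_def)
    \<comment> \<open>It is not yet known that \<open>z\<close> lies in the domain, so symmetry of
      \<open>B\<close> cannot be applied to it. Instead \<open>w\<close> is \<open>B (R z)\<close>,
      and orthogonality of \<open>z\<close> to \<open>B (R w)\<close> gives
      \<open>\<langle>w, w\<rangle> = 0\<close> by symmetry of \<open>R\<close>. Then
      \<open>z\<close> is a multiple of \<open>R z\<close>, hence in the domain, and an eigenvector
      inside \<open>M\<close>.\<close>
    define w where "w = z + (t0 - s) *\<^sub>R R z"
    have wM: "w \<in> M" unfolding w_def
      by (intro subspace_add[OF M_subspace] subspace_scale[OF M_subspace] zM RM)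
    note Rsym = resolvent_symmetric[OF R(2,3)]
    have "B (R w) = w + (t0 - s) *\<^sub>R R w"
      using R(3)[of w] by (simp add: B_def algebra_simps)
    then have "inner w w = 0"
      using orth[of "R w"] R(2) RM[OF wM] Rsym[of w z]
      by (simp add: inner_simps w_def inner_commute) (simp add: algebra_simps)
    then have w0: "w = 0" by simp
    have zR: "z = (s - t0) *\<^sub>R R z" using w0 by (simp add: w_def algebra_simps)
    then have "z \<in> dom A" and "act z = s *\<^sub>R z"
    proof -
      show zD: "z \<in> dom A"
        by (subst zR) (intro subspace_scale[OF dom_subspace] R(2))
      have "act z = (s - t0) *\<^sub>R act (R z)"
        by (subst zR) (rule act_scaleR[OF R(2)])
      also have "act (R z) = z + t0 *\<^sub>R R z" using R(3)[of z] by (simp add: algebra_simps)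
      also have "(s - t0) *\<^sub>R (z + t0 *\<^sub>R R z) = (s - t0) *\<^sub>R z + t0 *\<^sub>R ((s - t0) *\<^sub>R R z)"
        by (simp add: algebra_simps)
      also have "\<dots> = s *\<^sub>R z" by (subst zR[symmetric]) (simp add: algebra_simps)
      finally show "act z = s *\<^sub>R z" .
    qed
    then have "z \<in> eigenspace A (complex_of_real s)" by (simp add: eigenspace_iff)
    then have "cinner z z = 0" using zM by (simp add: in_M_iff)
    then have "m = y" by (simp add: cinner_self z_def)
    then show "m \<in> closure S" using y(1) by simp
  qed
  have "k * norm x \<le> norm (B x)" if x: "x \<in> dom A \<inter> M" for x
  proof -
    have "closed {v. k * inner v x \<le> norm v * norm (B x)}"
      by (intro closed_Collect_le continuous_intros)
    moreover have "S \<subseteq> {v. k * inner v x \<le> norm v * norm (B x)}"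
      using pol[OF _ x] by (auto simp: S_def)
    ultimately have "closure S \<subseteq> {v. k * inner v x \<le> norm v * norm (B x)}"
      by (intro closure_minimal)
    then have "k * inner x x \<le> norm x * norm (B x)" using dense x by blast
    then show ?thesis
      by (cases "x = 0") (auto simp: power2_norm_eq_inner[symmetric] power2_eq_square mult.left_commute)
  qed
  then have "bounded_below s" unfolding bounded_below_def B_def using k by blast
  with s show False by blast
qed

lemma closure_cspan_eigvecs: "closure (cspan eigvecs) = UNIV"
proof -
  have "orth_compl (orth_compl (closure (cspan eigvecs))) = closure (cspan eigvecs)"
    by (intro orth_compl_orth_compl csubspace_closure complex_vector.subspace_span closed_closure)
  moreover have "orth_compl (closure (cspan eigvecs)) = {0}"
    using M_trivial by (simp add: orth_compl_closure_cspan M_def)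
  moreover have "orth_compl {0::'h} = UNIV" by (auto simp: orth_compl_def cinner_simps)
  ultimately show ?thesis by simp
qed

end

section \<open>The projections \<open>F(A > E)\<close>\<close>

lemma bounded_linear_clinear:
  assumes "clinear V" "\<And>x. norm (V x) \<le> norm x * K"
  shows "bounded_linear V"
  by (rule bounded_linear_intro[of _ K]) (use assms in \<open>auto simp: clinear_iff clinear_scaleR\<close>)

lemma bounded_linear_orth_proj:
  assumes "csubspace M" "closed M"
  shows "bounded_linear (orth_proj M)"
  using clinear_orth_proj[OF assms] norm_orth_proj_le(1)[OF assms]
  by (intro bounded_linear_clinear[of _ 1]) auto

lemma closed_csubspace_cspan: "csubspace (closure (cspan S))" "closed (closure (cspan S))"
  by (auto intro: csubspace_closure complex_vector.subspace_span)

lemma spectral_tail_bounds: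
  shows clinear_spectral_tail: "clinear (spectral_tail A E)"
    and norm_spectral_tail_le: "norm (spectral_tail A E x) \<le> norm x"
    and norm_spectral_tail_compl_le: "norm (x - spectral_tail A E x) \<le> norm x"
  unfolding spectral_tail_def
  by (intro clinear_orth_proj norm_orth_proj_le closed_csubspace_cspan)+

lemma bounded_linear_spectral_tail: "bounded_linear (spectral_tail A E)"
  unfolding spectral_tail_def by (intro bounded_linear_orth_proj closed_csubspace_cspan)

context discrete_self_adjoint
begin

lemma eigenspace_orth:
  assumes "u \<in> eigenspace A (complex_of_real e)" "v \<in> eigenspace A (complex_of_real f)" "e \<noteq> f"
  shows "cinner u v = 0"
proof -
  have "complex_of_real e * cinner u v = cinner (act u) v"
    using assms(1) by (simp add: eigenspace_iff cinner_scaleR_left scaleR_conv_of_real)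
  also have "\<dots> = cinner u (act v)" using assms by (intro act_csymmetric) (auto simp: eigenspace_iff)
  also have "\<dots> = complex_of_real f * cinner u v"
    using assms(2) by (simp add: eigenspace_iff cinner_scaleR_right scaleR_conv_of_real)
  finally show ?thesis using assms(3) by simp
qed

lemma spectral_tail_eigenspace:
  assumes v: "v \<in> eigenspace A (complex_of_real e)"
  shows "spectral_tail A E v = (if e \<le> E then 0 else v)"
proof (cases "e \<le> E")
  case True
  have "v \<in> orth_compl (\<Union>e\<in>{E<..}. eigenspace A (complex_of_real e))"
    unfolding orth_compl_def using eigenspace_orth[OF _ v] True by fastforce
  then have "spectral_tail A E v = 0"
    unfolding spectral_tail_def
    by (intro orth_proj_eqI closed_csubspace_cspan complex_vector.subspace_0)
      (simp_all add: orth_compl_closure_cspan)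
  then show ?thesis using True by simp
next
  case False
  have "v \<in> cspan (\<Union>e\<in>{E<..}. eigenspace A (complex_of_real e))"
    using False v by (intro complex_vector.span_base) force
  then have "v \<in> closure (cspan (\<Union>e\<in>{E<..}. eigenspace A (complex_of_real e)))"
    using closure_subset by blast
  then have "spectral_tail A E v = v"
    unfolding spectral_tail_def
    by (intro orth_proj_eqI closed_csubspace_cspan)
      (simp_all add: complex_vector.subspace_0[OF csubspace_orth_compl])
  then show ?thesis using False by simp
qed

text \<open>On finite combinations of eigenvectors the tail is exactly 0 for large \<open>E\<close>.
  Since all tails are contractions, density of these combinations suffices.\<close>

lemma spectral_tail_tendsto_0: "((\<lambda>E. spectral_tail A E x) \<longlongrightarrow> 0) at_top"
proof (rule tendstoI)
  fix \<epsilon> :: real assume \<epsilon>: "0 < \<epsilon>"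
  define P where "P = {y. eventually (\<lambda>E. spectral_tail A E y = 0) at_top}"
  have "csubspace P"
  proof (rule complex_vector.subspaceI)
    show "0 \<in> P" by (simp add: P_def clinear_0[OF clinear_spectral_tail])
    show "y + z \<in> P" if "y \<in> P" "z \<in> P" for y z
      using that unfolding P_def mem_Collect_eq
      by eventually_elim (simp add: clinear_spectral_tail[unfolded clinear_iff])
    show "c *\<^sub>C y \<in> P" if "y \<in> P" for c y
      using that unfolding P_def mem_Collect_eq
      by eventually_elim (simp add: clinear_spectral_tail[unfolded clinear_iff] scaleC_simps)
  qed
  moreover have "eigvecs \<subseteq> P"
  proof
    fix v assume "v \<in> eigvecs"
    then obtain e where e: "v \<in> eigenspace A (complex_of_real e)" by (auto simp: eigvecs_def)
    show "v \<in> P" unfolding P_def mem_Collect_eq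
      using eventually_ge_at_top[of e] by eventually_elim (simp add: spectral_tail_eigenspace[OF e])
  qed
  ultimately have "cspan eigvecs \<subseteq> P" by (intro complex_vector.span_minimal)
  moreover have "x \<in> closure (cspan eigvecs)" by (simp add: closure_cspan_eigvecs)
  ultimately obtain y where y: "y \<in> P" "dist y x < \<epsilon>"
    using \<epsilon> unfolding closure_approachable by blast
  from y(1) have "eventually (\<lambda>E. spectral_tail A E y = 0) at_top" by (simp add: P_def)
  then show "eventually (\<lambda>E. dist (spectral_tail A E x) 0 < \<epsilon>) at_top"
  proof eventually_elim
    case (elim E)
    have "norm (spectral_tail A E x) = norm (spectral_tail A E (x - y))"
      using elim by (simp add: clinear_diff[OF clinear_spectral_tail])
    also have "\<dots> \<le> norm (x - y)" by (rule norm_spectral_tail_le)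
    finally show ?case using y(2) by (simp add: dist_norm norm_minus_commute)
  qed
qed

text \<open>Positivity confines the eigenvalues up to \<open>E\<close> to a compact interval.
  Infinitely many would accumulate there, which is excluded both at spectral and at resolvent
  points; finite multiplicity does the rest.\<close>

lemma spectral_tail_compl_finite_rank:
  assumes pos: "positive_operator A"
  obtains B where "finite B" "\<And>x. x - spectral_tail A E x \<in> cspan B"
proof -
  define L where "L = {e. e \<le> E \<and> (\<exists>x. x \<noteq> 0 \<and> x \<in> eigenspace A (complex_of_real e))}"
  have L_ge: "0 \<le> e" if e: "e \<in> L" for e
  proof -
    obtain x where x: "x \<noteq> 0" "x \<in> eigenspace A (complex_of_real e)" using e by (auto simp: L_def)
    then have "x \<in> dom A" "the (A x) = e *\<^sub>R x" by (auto simp: eigenspace_iff act_def)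
    then have "0 \<le> inner x (e *\<^sub>R x)"
      using pos unfolding positive_operator_def Re_cinner by metis
    moreover have "0 < inner x x" using x(1) by simp
    ultimately show ?thesis by (simp add: zero_le_mult_iff)
  qed
  have "finite L"
  proof (rule ccontr)
    assume inf: "infinite L"
    have "\<And>e. e \<in> L \<Longrightarrow> e \<le> E" by (simp add: L_def)
    then have "L \<subseteq> {0..E}" using L_ge by auto
    then obtain z where z: "z islimpt L"
      using inf compact_Icc[of 0 E] unfolding compact_eq_Bolzano_Weierstrass by blast
    show False
    proof (cases "complex_of_real z \<in> spectrum A")
      case True
      obtain d where d: "d > 0" "\<And>t. t \<noteq> z \<Longrightarrow> \<bar>t - z\<bar> < d \<Longrightarrow> complex_of_real t \<notin> spectrum A"
        by (rule spectrum_isolated[OF True]) blast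
      obtain e where "e \<in> L" "e \<noteq> z" "dist e z < d" using z d(1) unfolding islimpt_approachable by blast
      then show False using d(2)[of e] eigenvalue_in_spectrum by (auto simp: L_def dist_real_def)
    next
      \<comment> \<open>In place of closedness of the spectrum, the resolvent bound \<open>K\<close>
        keeps every eigenvalue at distance at least \<open>1/K\<close> from
        \<open>z\<close>.\<close>
      case False
      obtain R where R: "bounded_linear R" "\<And>x. x \<in> dom A \<Longrightarrow> R (act x - z *\<^sub>R x) = x"
        using resolventE[OF False] by metis
      obtain K where K: "K > 0" "\<And>x. norm (R x) \<le> norm x * K"
        using bounded_linear.pos_bounded[OF R(1)] by blast
      obtain e where e: "e \<in> L" "dist e z < 1 / K"
        using z K(1) unfolding islimpt_approachable by (meson zero_less_divide_1_iff)
      then obtain x where x: "x \<noteq> 0" "x \<in> dom A" "act x = e *\<^sub>R x" by (auto simp: L_def eigenspace_iff)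
      have "R ((e - z) *\<^sub>R x) = x" using R(2)[OF x(2)] x(3) by (simp add: algebra_simps)
      then have "norm x \<le> \<bar>e - z\<bar> * norm x * K" using K(2)[of "(e - z) *\<^sub>R x"] by simp
      then have "1 \<le> \<bar>e - z\<bar> * K" using x(1) by (simp add: mult.assoc mult.left_commute)
      then show False using e(2) K(1) by (simp add: dist_real_def field_simps)
    qed
  qed
  have "\<exists>B. finite B \<and> eigenspace A (complex_of_real e) \<subseteq> cspan B" if "e \<in> L" for e
    using that ds eigenvalue_in_spectrum unfolding discrete_spectrum_def L_def by blast
  then obtain Bf where Bf: "\<And>e. e \<in> L \<Longrightarrow> finite (Bf e)"
    "\<And>e. e \<in> L \<Longrightarrow> eigenspace A (complex_of_real e) \<subseteq> cspan (Bf e)" by metis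
  define B where "B = (\<Union>e\<in>L. Bf e)"
  have fin: "finite B" unfolding B_def using \<open>finite L\<close> Bf(1) by blast
  define Q where "Q x = x - spectral_tail A E x" for x
  have "eigvecs \<subseteq> {x. Q x \<in> cspan B}"
  proof
    fix v assume "v \<in> eigvecs"
    then obtain e where e: "v \<in> eigenspace A (complex_of_real e)" by (auto simp: eigvecs_def)
    have "Q v \<in> cspan B"
    proof (cases "v = 0 \<or> E < e")
      case True
      then have "Q v = 0"
        using spectral_tail_eigenspace[OF e, of E] clinear_0[OF clinear_spectral_tail]
        by (auto simp: Q_def)
      then show ?thesis by (simp add: complex_vector.span_zero)
    next
      case False
      then have "e \<in> L" using e by (auto simp: L_def)
      then have "v \<in> cspan (Bf e)" "Bf e \<subseteq> B" using Bf(2) e by (auto simp: B_def)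
      then have "v \<in> cspan B" using complex_vector.span_mono by blast
      then show ?thesis using False spectral_tail_eigenspace[OF e, of E] by (simp add: Q_def)
    qed
    then show "v \<in> {x. Q x \<in> cspan B}" by simp
  qed
  moreover have "csubspace {x. Q x \<in> cspan B}"
  proof (rule complex_vector.subspaceI)
    have Q: "Q (x + y) = Q x + Q y" "Q (c *\<^sub>C x) = c *\<^sub>C Q x" "Q 0 = 0" for x y c
      by (simp_all add: Q_def scaleC_simps clinear_spectral_tail[unfolded clinear_iff]
          clinear_0[OF clinear_spectral_tail])
    show "0 \<in> {x. Q x \<in> cspan B}" by (simp add: Q complex_vector.span_zero)
    show "x + y \<in> {x. Q x \<in> cspan B}" if "x \<in> {x. Q x \<in> cspan B}" "y \<in> {x. Q x \<in> cspan B}" for x y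
      using that by (simp add: Q complex_vector.span_add)
    show "c *\<^sub>C x \<in> {x. Q x \<in> cspan B}" if "x \<in> {x. Q x \<in> cspan B}" for c x
      using that by (simp add: Q complex_vector.span_scale)
  qed
  ultimately have "cspan eigvecs \<subseteq> {x. Q x \<in> cspan B}" by (rule complex_vector.span_minimal)
  moreover have "closed (Q -` cspan B)"
    unfolding Q_def
    by (intro continuous_closed_vimage closed_finite_cspan fin)
      (intro continuous_intros linear_continuous_at bounded_linear_spectral_tail)
  ultimately have "closure (cspan eigvecs) \<subseteq> Q -` cspan B"
    by (intro closure_minimal) auto
  then have "Q x \<in> cspan B" for x by (auto simp: closure_cspan_eigvecs)
  with fin that show thesis by (auto simp: Q_def)
qed

end


section \<open>Ergodic means of unitary operators\<close>

lemma unitaryD: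
  assumes "unitary V"
  shows unitary_clinear: "clinear V"
    and unitary_cinner: "cinner (V x) (V y) = cinner x y"
    and unitary_norm: "norm (V x) = norm x"
proof -
  show "clinear V" and c: "cinner (V x) (V y) = cinner x y" for x y
    using assms by (auto simp: unitary_def)
  have "complex_of_real ((norm (V x))\<^sup>2) = complex_of_real ((norm x)\<^sup>2)"
    by (metis c cinner_self)
  then show "norm (V x) = norm x" by (simp only: of_real_eq_iff power2_eq_iff_nonneg norm_ge_zero)
qed

lemma clinear_funpow: "clinear V \<Longrightarrow> clinear (V ^^ n)"
  by (induction n) (auto simp: clinear_iff)

lemma unitary_funpow:
  assumes "unitary V"
  shows unitary_funpow_clinear: "clinear (V ^^ n)"
    and unitary_funpow_cinner: "cinner ((V ^^ n) x) ((V ^^ n) y) = cinner x y"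
    and unitary_funpow_norm: "norm ((V ^^ n) x) = norm x"
proof -
  show "clinear (V ^^ n)" by (rule clinear_funpow[OF unitary_clinear[OF assms]])
  show "cinner ((V ^^ n) x) ((V ^^ n) y) = cinner x y" "norm ((V ^^ n) x) = norm x"
    by (induction n) (simp_all add: unitaryD[OF assms])
qed

lemma orth_compl_mono: "M \<subseteq> N \<Longrightarrow> orth_compl N \<subseteq> orth_compl M"
  by (auto simp: orth_compl_def)

text \<open>Von Neumann's argument: \<open>x\<close> is a limit of vectors \<open>W y - y\<close>,
  whose sums telescope to at most \<open>2 \<parallel>y\<parallel>\<close>.\<close>

lemma mean_ergodic:
  assumes W: "unitary W" and x: "x \<in> orth_compl {y. W y = y}"
  shows "(\<lambda>N. (1 / real N) *\<^sub>R (\<Sum>n<N. (W ^^ n) x)) \<longlonglongrightarrow> 0"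
proof (rule LIMSEQ_I)
  fix e :: real assume e: "0 < e"
  note W_lin = unitary_clinear[OF W]
  define S where "S = range (\<lambda>y. W y - y)"
  have "csubspace S"
  proof (rule complex_vector.subspaceI)
    show "0 \<in> S" unfolding S_def by (intro range_eqI[of _ _ 0]) (simp add: clinear_0[OF W_lin])
    show "u + v \<in> S" if uv: "u \<in> S" "v \<in> S" for u v
    proof -
      obtain y z where "u = W y - y" "v = W z - z" using uv by (auto simp: S_def)
      then show ?thesis unfolding S_def using W_lin by (intro range_eqI[of _ _ "y + z"]) (simp add: clinear_iff)
    qed
    show "c *\<^sub>C u \<in> S" if u: "u \<in> S" for c u
    proof -
      obtain y where "u = W y - y" using u by (auto simp: S_def)
      then show ?thesis unfolding S_def using W_lin
        by (intro range_eqI[of _ _ "c *\<^sub>C y"]) (simp add: clinear_iff scaleC_simps)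
    qed
  qed
  then have S: "cspan S = S" by (rule complex_vector.span_eq_iff[THEN iffD2])
  have "orth_compl S \<subseteq> {y. W y = y}"
  proof
    fix u assume "u \<in> orth_compl S"
    then have "cinner (W u - u) u = 0" by (auto simp: orth_compl_def S_def)
    then have "Re (cinner (W u - u) u) = Re 0" by (rule arg_cong)
    then have "inner (W u) u = inner u u" by (simp add: Re_cinner inner_simps)
    moreover have "inner (W u) (W u) = inner u u"
      using unitary_norm[OF W, of u] by (simp flip: power2_norm_eq_inner)
    \<comment> \<open>Isometry replaces the usual argument with the adjoint of
      \<open>W\<close>.\<close>
    ultimately have "inner (W u - u) (W u - u) = 0" by (simp add: inner_simps inner_commute)
    then show "u \<in> {y. W y = y}" by simp
  qed
  then have "x \<in> orth_compl (orth_compl (closure (cspan S)))"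
    using x orth_compl_mono by (auto simp: orth_compl_closure_cspan)
  then have "x \<in> closure S"
    using orth_compl_orth_compl[OF csubspace_closure[OF \<open>csubspace S\<close>]] S by simp
  then obtain y where y: "norm (x - (W y - y)) < e / 2"
    using e unfolding closure_approachable S_def
    by (auto simp: dist_norm norm_minus_commute dest!: spec[of _ "e/2"])
  have tel: "(\<Sum>n<N. (W ^^ n) (W y - y)) = (W ^^ N) y - y" for N
    by (induction N) (auto simp: clinear_diff[OF clinear_funpow[OF W_lin]] funpow_swap1)
  \<comment> \<open>Large enough for the telescoped part to stay below \<open>N e / 2\<close>; the
    approximation error contributes the other half.\<close>
  obtain N0 where N0: "real N0 > 4 * norm y / e" using reals_Archimedean2 by blast
  have "norm ((1 / real N) *\<^sub>R (\<Sum>n<N. (W ^^ n) x)) < e" if N: "N \<ge> Suc N0" for N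
  proof -
    have "(\<Sum>n<N. (W ^^ n) x) = (\<Sum>n<N. (W ^^ n) (x - (W y - y))) + ((W ^^ N) y - y)"
      by (subst tel[symmetric]) (simp add: clinear_diff[OF clinear_funpow[OF W_lin]] flip: sum.distrib)
    then have "norm (\<Sum>n<N. (W ^^ n) x) \<le> norm (\<Sum>n<N. (W ^^ n) (x - (W y - y))) + norm ((W ^^ N) y - y)"
      by (metis norm_triangle_ineq)
    also have "norm (\<Sum>n<N. (W ^^ n) (x - (W y - y))) \<le> (\<Sum>n<N. norm (x - (W y - y)))"
      by (rule order_trans[OF norm_sum]) (simp add: unitary_funpow_norm[OF W])
    also have "norm ((W ^^ N) y - y) \<le> 2 * norm y"
      using norm_triangle_ineq4[of "(W ^^ N) y" y] by (simp add: unitary_funpow_norm[OF W])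
    also have "2 * norm y < real N * (e / 2)"
    proof -
      have "4 * norm y / e < real N" using N0 N by simp
      then show ?thesis using e by (simp add: field_simps)
    qed
    also have "(\<Sum>n<N. norm (x - (W y - y))) \<le> real N * (e / 2)"
      using y by (simp only: sum_constant card_lessThan) (intro mult_left_mono, auto)
    finally have "norm (\<Sum>n<N. (W ^^ n) x) < real N * e" by (simp add: mult.commute)
    then show ?thesis using N by (simp add: field_simps)
  qed
  then show "\<exists>N0. \<forall>N\<ge>N0. norm ((1 / real N) *\<^sub>R (\<Sum>n<N. (W ^^ n) x) - 0) < e" by auto
qed

section \<open>Ergodic means with a phase\<close>

definition twisted_mean :: "('h :: complex_hilbert_space \<Rightarrow> 'h) \<Rightarrow> 'h \<Rightarrow> nat \<Rightarrow> complex \<Rightarrow> 'h"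
  where "twisted_mean V x N z = (1 / real N) *\<^sub>R (\<Sum>n<N. cnj z ^ n *\<^sub>C (V ^^ n) x)"

lemma funpow_scaleC:
  assumes "clinear V"
  shows "((\<lambda>y. c *\<^sub>C V y) ^^ n) x = c ^ n *\<^sub>C (V ^^ n) x"
proof (induction n)
  case (Suc n)
  then show ?case using assms by (simp add: clinear_iff scaleC_scaleC mult.commute)
qed (simp add: scaleC_of_real[of 1, simplified])

lemma unitary_scaleC:
  assumes V: "unitary V" and z: "cmod z = 1"
  shows "unitary (\<lambda>y. z *\<^sub>C V y)"
proof -
  have zz: "z * cnj z = 1" using z complex_norm_square[of z] by simp
  have "surj (\<lambda>y. z *\<^sub>C V y)"
  proof (rule surjI)
    fix y
    have "V (inv V (cnj z *\<^sub>C y)) = cnj z *\<^sub>C y"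
      by (rule surj_f_inv_f) (use V in \<open>simp add: unitary_def\<close>)
    then show "z *\<^sub>C V (inv V (cnj z *\<^sub>C y)) = y"
      by (simp only: scaleC_scaleC zz complex_vector.scale_one)
  qed
  moreover have "clinear (\<lambda>y. z *\<^sub>C V y)"
    using unitary_clinear[OF V] by (simp add: clinear_iff scaleC_simps mult.commute)
  moreover have "cinner (z *\<^sub>C V x) (z *\<^sub>C V y) = cinner x y" for x y
  proof -
    have "cinner (z *\<^sub>C V x) (z *\<^sub>C V y) = (z * cnj z) * cinner (V x) (V y)"
      by (simp only: cinner_scaleC_left cinner_scaleC_right mult_ac)
    then show ?thesis by (simp only: zz mult_1 unitary_cinner[OF V])
  qed
  ultimately show ?thesis unfolding unitary_def by blast
qed

text \<open>The vectors fixed by \<open>cnj z *\<^sub>C V\<close> are eigenvectors of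
  \<open>V\<close> for \<open>z\<close> or 0, and \<open>x\<close> is orthogonal to all of
  them.\<close>

lemma twisted_mean_tendsto_0:
  assumes V: "unitary V" and x: "x \<in> continuous_subspace V" and z: "cmod z = 1"
  shows "(\<lambda>N. twisted_mean V x N z) \<longlonglongrightarrow> 0"
proof -
  have zz: "z * cnj z = 1" using z complex_norm_square[of z] by simp
  have "{y. cnj z *\<^sub>C V y = y} \<subseteq> point_subspace V"
  proof
    fix y assume "y \<in> {y. cnj z *\<^sub>C V y = y}"
    then have "z *\<^sub>C cnj z *\<^sub>C V y = z *\<^sub>C y" by simp
    then have "V y = z *\<^sub>C y" by (simp add: scaleC_scaleC zz)
    then have "y \<in> cspan {x. x \<noteq> 0 \<and> (\<exists>z. V x = z *\<^sub>C x)}"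
      by (cases "y = 0") (auto intro: complex_vector.span_base complex_vector.span_zero)
    then show "y \<in> point_subspace V" unfolding point_subspace_def using closure_subset by blast
  qed
  then have "x \<in> orth_compl {y. cnj z *\<^sub>C V y = y}"
    using x orth_compl_mono unfolding continuous_subspace_def by blast
  then have "(\<lambda>N. (1 / real N) *\<^sub>R (\<Sum>n<N. ((\<lambda>y. cnj z *\<^sub>C V y) ^^ n) x)) \<longlonglongrightarrow> 0"
    using z by (intro mean_ergodic unitary_scaleC V) auto
  then show ?thesis
    by (simp add: twisted_mean_def funpow_scaleC[OF unitary_clinear[OF V]])
qed

text \<open>The second half of the sum is the image of the first under the isometry
  \<open>cnj z ^ N\<close> times \<open>V ^^ N\<close>, so the long mean averages two vectors of
  equal norm.\<close>

lemma norm_twisted_mean_double: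
  assumes V: "unitary V" and z: "cmod z = 1"
  shows "norm (twisted_mean V x (2 * N) z) \<le> norm (twisted_mean V x N z)"
proof -
  note lin = unitary_funpow_clinear[OF V, of N]
  let ?S = "\<Sum>n<N. cnj z ^ n *\<^sub>C (V ^^ n) x"
  have "(\<Sum>n<2 * N. cnj z ^ n *\<^sub>C (V ^^ n) x) = ?S + (\<Sum>n<N. cnj z ^ (n + N) *\<^sub>C (V ^^ (n + N)) x)"
    using sum.atLeastLessThan_concat[of 0 N "2 * N" "\<lambda>n. cnj z ^ n *\<^sub>C (V ^^ n) x"]
      sum.shift_bounds_nat_ivl[of "\<lambda>n. cnj z ^ n *\<^sub>C (V ^^ n) x" 0 N N]
    by (simp add: mult_2 atLeast0LessThan)
  also have "(\<Sum>n<N. cnj z ^ (n + N) *\<^sub>C (V ^^ (n + N)) x) = cnj z ^ N *\<^sub>C (V ^^ N) ?S"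
    using lin by (simp add: clinear_sum clinear_iff scaleC_simps power_add mult.commute add.commute[of N]
        flip: funpow_add comp_apply[of "V ^^ N" "V ^^ _"])
  also have "norm (?S + cnj z ^ N *\<^sub>C (V ^^ N) ?S) \<le> norm ?S + norm (cnj z ^ N *\<^sub>C (V ^^ N) ?S)"
    by (rule norm_triangle_ineq)
  also have "\<dots> = 2 * norm ?S" using z by (simp add: norm_scaleC norm_power unitary_funpow_norm[OF V])
  finally show ?thesis by (cases "N = 0") (simp_all add: twisted_mean_def field_simps)
qed

text \<open>Dini's argument along powers of two, where the norms decrease by the previous lemma.\<close>

lemma twisted_mean_uniform:
  assumes V: "unitary V" and x: "x \<in> continuous_subspace V" and e: "e > 0"
  shows "\<exists>k. \<forall>j\<ge>k. \<forall>z. cmod z = 1 \<longrightarrow> norm (twisted_mean V x (2 ^ j) z) < e"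
proof (rule ccontr)
  assume "\<not> ?thesis"
  then have "\<forall>k. \<exists>j z. j \<ge> k \<and> cmod z = 1 \<and> e \<le> norm (twisted_mean V x (2 ^ j) z)"
    by (auto simp: not_less)
  then obtain j z where jz: "\<And>k. j k \<ge> k" "\<And>k. cmod (z k) = 1"
    "\<And>k. e \<le> norm (twisted_mean V x (2 ^ j k) (z k))" by metis
  have anti: "norm (twisted_mean V x (2 ^ (i + d)) w) \<le> norm (twisted_mean V x (2 ^ i) w)"
    if "cmod w = 1" for w i d
  proof (induction d)
    case (Suc d)
    then show ?case using norm_twisted_mean_double[OF V that, of x "2 ^ (i + d)"] by simp
  qed simp
  have "\<And>k. z k \<in> sphere 0 1" using jz(2) by simp
  then obtain w r where w: "w \<in> sphere 0 1" "strict_mono r" "(z \<circ> r) \<longlonglongrightarrow> w"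
    using compact_sphere[of "0::complex" 1] unfolding compact_def by (metis (no_types, lifting))
  have "e \<le> norm (twisted_mean V x (2 ^ i) w)" for i
  proof -
    have "continuous_on UNIV (\<lambda>z. norm (twisted_mean V x (2 ^ i) z))"
      unfolding twisted_mean_def by (intro continuous_intros)
    then have "isCont (\<lambda>z. norm (twisted_mean V x (2 ^ i) z)) w"
      by (simp add: continuous_on_eq_continuous_at)
    then have "(\<lambda>k. norm (twisted_mean V x (2 ^ i) ((z \<circ> r) k))) \<longlonglongrightarrow> norm (twisted_mean V x (2 ^ i) w)"
      using w(3) by (rule isCont_tendsto_compose)
    \<comment> \<open>A lower bound at the late stage \<open>j (r k)\<close> holds at every earlier
      stage \<open>i\<close> by monotonicity, and so passes to the limit point \<open>w\<close> with
      \<open>i\<close> fixed.\<close>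
    moreover have "e \<le> norm (twisted_mean V x (2 ^ i) ((z \<circ> r) k))" if "k \<ge> i" for k
    proof -
      have "i \<le> j (r k)" using that seq_suble[OF w(2), of k] jz(1)[of "r k"] by linarith
      then show ?thesis
        using anti[OF jz(2), of i "j (r k) - i" "r k"] jz(3)[of "r k"] by simp
    qed
    ultimately show ?thesis by (intro LIMSEQ_le_const) auto
  qed
  moreover have "(\<lambda>i. norm (twisted_mean V x (2 ^ i) w)) \<longlonglongrightarrow> 0"
  proof -
    have "(\<lambda>N. norm (twisted_mean V x N w)) \<longlonglongrightarrow> 0"
      using w(1) by (intro tendsto_norm_zero twisted_mean_tendsto_0 V x) auto
    moreover have "filterlim (\<lambda>i. 2 ^ i :: nat) at_top sequentially"
      by (rule filterlim_subseq) (simp add: strict_mono_def)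
    ultimately show ?thesis by (rule filterlim_compose)
  qed
  ultimately have "e \<le> 0" by (intro LIMSEQ_le_const) auto
  with e show False by simp
qed

section \<open>Wiener's lemma through finite Fourier sums\<close>

lemma sum_roots_of_unity_orth:
  fixes j k L :: nat
  assumes "j < L" "k < L"
  defines "\<omega> \<equiv> cis (2 * pi / real L)"
  shows "(\<Sum>i<L. \<omega> ^ (i * j) * cnj (\<omega> ^ (i * k))) = (if j = k then of_nat L else 0)"
proof (cases "j = k")
  case True
  have "\<omega> ^ n * cnj (\<omega> ^ n) = 1" for n
    using complex_norm_square[of "\<omega> ^ n"] by (simp add: \<omega>_def norm_power)
  then show ?thesis using True by simp
next
  case False
  define q where "q = cis (2 * pi * (real j - real k) / real L)"
  have L: "real L > 0" using assms by simp
  have "\<omega> ^ (i * j) * cnj (\<omega> ^ (i * k)) = q ^ i" for i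
    by (simp add: \<omega>_def q_def Complex.DeMoivre cis_cnj cis_mult algebra_simps diff_divide_distrib)
  \<comment> \<open>\<open>q = 1\<close> would make \<open>j - k\<close> a multiple of
    \<open>L\<close>, while its absolute value is below \<open>L\<close>.\<close>
  moreover have "q \<noteq> 1"
  proof
    assume "q = 1"
    then have "cis (2 * pi * (real j - real k) / real L) = cis 0" by (simp add: q_def)
    then obtain n :: int where "2 * pi * (real j - real k) / real L = 2 * pi * of_int n"
      by (auto simp: complex_eq_iff cos_one_2pi_int)
    then have "2 * pi * (real j - real k) = 2 * pi * (of_int n * real L)"
      using L by (simp add: divide_eq_eq mult.assoc)
    then have "real j - real k = of_int n * real L" by simp
    then have "int j - int k = n * int L" by (metis of_int_diff of_int_eq_iff of_int_mult of_int_of_nat_eq)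
    moreover have "\<bar>int j - int k\<bar> < int L" using assms by linarith
    ultimately have "\<bar>n\<bar> * int L < 1 * int L" by (simp add: abs_mult)
    then have "n = 0" using mult_less_cancel_right_pos[of "int L" "\<bar>n\<bar>" 1] L by simp
    then show False using \<open>int j - int k = n * int L\<close> False by simp
  qed
  moreover have "q ^ L = 1"
    using L by (simp add: q_def Complex.DeMoivre complex_eq_iff)
  ultimately show ?thesis using False by (simp add: geometric_sum)
qed

text \<open>A nonnegative function \<open>p\<close> with Fourier coefficients \<open>d\<close> satisfies
  \<open>\<parallel>p\<parallel>\<^sub>2\<^sup>2 \<le> sup p \<cdot> \<parallel>p\<parallel>\<^sub>1\<close>; the \<open>L\<close>-th roots of unity stand in for the circle.\<close>

lemma discrete_parseval_le:
  fixes p :: "nat \<Rightarrow> real" and \<omega> :: complex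
  assumes p: "\<And>j. j < L \<Longrightarrow> 0 \<le> p j" "\<And>j. j < L \<Longrightarrow> p j \<le> S"
  defines "\<omega> \<equiv> cis (2 * pi / real L)"
  shows "(\<Sum>k<L. (cmod (\<Sum>j<L. p j * \<omega> ^ (k * j)))\<^sup>2) \<le> real L * S * (\<Sum>j<L. p j)"
proof -
  have "complex_of_real (\<Sum>k<L. (cmod (\<Sum>j<L. p j * \<omega> ^ (k * j)))\<^sup>2) =
      (\<Sum>k<L. \<Sum>j<L. \<Sum>i<L. (p j * p i) * (\<omega> ^ (k * j) * cnj (\<omega> ^ (k * i))))"
    unfolding of_real_sum complex_norm_square cnj_sum sum_product
    by (intro sum.cong refl) (simp add: algebra_simps)
  \<comment> \<open>With the sum over \<open>k\<close> innermost, orthogonality leaves only the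
    diagonal.\<close>
  also have "\<dots> = (\<Sum>j<L. \<Sum>i<L. (p j * p i) * (\<Sum>k<L. \<omega> ^ (k * j) * cnj (\<omega> ^ (k * i))))"
    unfolding sum_distrib_left
    by (subst sum.swap, rule sum.cong[OF refl], subst sum.swap) simp
  also have "\<dots> = (\<Sum>j<L. \<Sum>i<L. if j = i then complex_of_real (p j * p i) * of_nat L else 0)"
    unfolding \<omega>_def by (intro sum.cong refl) (simp add: sum_roots_of_unity_orth del: complex_cnj_power)
  also have "\<dots> = complex_of_real (\<Sum>j<L. p j * p j * real L)" by simp
  finally have "(\<Sum>k<L. (cmod (\<Sum>j<L. p j * \<omega> ^ (k * j)))\<^sup>2) = (\<Sum>j<L. p j * p j * real L)"
    by (simp only: of_real_eq_iff)
  also have "\<dots> \<le> (\<Sum>j<L. real L * S * p j)"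
    using p by (intro sum_mono) (simp add: mult_right_mono mult.commute mult.left_commute)
  finally show ?thesis by (simp add: sum_distrib_left)
qed

text \<open>The squared mean of length \<open>N\<close> is a trigonometric polynomial with
  coefficients \<open>(N - k) c k / N^2\<close> for \<open>0 \<le> k < N\<close>. Taking
  \<open>N = 2 K\<close> keeps the weight \<open>N - k\<close> at least \<open>K\<close> for
  \<open>k < K\<close>, and \<open>discrete_parseval_le\<close> bounds the squares of the
  coefficients.\<close>

lemma correlation_sum_le:
  fixes x :: "'h :: complex_hilbert_space"
  assumes V: "unitary V" and S: "\<And>z. cmod z = 1 \<Longrightarrow> (norm (twisted_mean V x (2 * K) z))\<^sup>2 \<le> S"
    and K: "K > 0"
  shows "(\<Sum>k<K. (cmod (cinner x ((V ^^ k) x)))\<^sup>2) \<le> 8 * real K * S * (norm x)\<^sup>2"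
proof -
  define N where "N = 2 * K"
  \<comment> \<open>Twice as many roots as the length of the mean: the indices \<open>n + k\<close>
    and \<open>m\<close> stay below \<open>L\<close>, so no frequencies are confused.\<close>
  define L where "L = 2 * N"
  define \<omega> where "\<omega> = cis (2 * pi / real L)"
  define p where "p j = (norm (twisted_mean V x N (\<omega> ^ j)))\<^sup>2" for j
  define c where "c k = cinner x ((V ^^ k) x)" for k
  have c_shift: "cinner ((V ^^ n) x) ((V ^^ (n + k)) x) = c k" for n k
    using unitary_funpow_cinner[OF V, of n x "(V ^^ k) x"] by (simp add: c_def funpow_add)
  have \<omega>1: "cmod (\<omega> ^ j) = 1" for j by (simp add: \<omega>_def norm_power)
  have d: "(\<Sum>j<L. p j * \<omega> ^ (k * j)) = of_nat L * (of_nat (N - k) * c k) / (of_nat N)\<^sup>2" if k: "k < N" for k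
  proof -
    have pj: "complex_of_real (p j) = (\<Sum>n<N. \<Sum>m<N. \<omega> ^ (j * n) * cnj (\<omega> ^ (j * m)) *
        cinner ((V ^^ n) x) ((V ^^ m) x)) / (of_nat N)\<^sup>2" for j
    proof -
      have "complex_of_real (p j) = (1 / of_nat N)\<^sup>2 *
          cinner (\<Sum>n<N. cnj (\<omega> ^ j) ^ n *\<^sub>C (V ^^ n) x) (\<Sum>n<N. cnj (\<omega> ^ j) ^ n *\<^sub>C (V ^^ n) x)"
        unfolding p_def twisted_mean_def cinner_self[symmetric]
        by (simp add: cinner_scaleR_left cinner_scaleR_right scaleR_conv_of_real power2_eq_square)
      also have "cinner (\<Sum>n<N. cnj (\<omega> ^ j) ^ n *\<^sub>C (V ^^ n) x) (\<Sum>n<N. cnj (\<omega> ^ j) ^ n *\<^sub>C (V ^^ n) x) =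
          (\<Sum>n<N. \<Sum>m<N. \<omega> ^ (j * n) * cnj (\<omega> ^ (j * m)) * cinner ((V ^^ n) x) ((V ^^ m) x))"
        unfolding bounded_bilinear.sum_left[OF bounded_bilinear_cinner]
        unfolding bounded_bilinear.sum_right[OF bounded_bilinear_cinner]
        by (simp add: cinner_scaleC_left cinner_scaleC_right mult.assoc mult.left_commute flip: power_mult)
      finally show ?thesis by (simp add: power_one_over)
    qed
    have "(\<Sum>j<L. p j * \<omega> ^ (k * j)) = (\<Sum>j<L. \<Sum>n<N. \<Sum>m<N.
        cinner ((V ^^ n) x) ((V ^^ m) x) / (of_nat N)\<^sup>2 * (\<omega> ^ (j * (n + k)) * cnj (\<omega> ^ (j * m))))"
      unfolding pj sum_divide_distrib sum_distrib_right
      by (intro sum.cong refl) (simp add: power_add algebra_simps)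
    also have "\<dots> = (\<Sum>n<N. \<Sum>m<N. cinner ((V ^^ n) x) ((V ^^ m) x) / (of_nat N)\<^sup>2 *
        (\<Sum>j<L. \<omega> ^ (j * (n + k)) * cnj (\<omega> ^ (j * m))))"
      unfolding sum_distrib_left
      by (subst sum.swap, rule sum.cong[OF refl], subst sum.swap) simp
    also have "\<dots> = (\<Sum>n<N. \<Sum>m<N. if n + k = m then cinner ((V ^^ n) x) ((V ^^ m) x) / (of_nat N)\<^sup>2 * of_nat L else 0)"
    proof (intro sum.cong refl)
      fix n m assume "n \<in> {..<N}" "m \<in> {..<N}"
      then have nm: "n + k < L" "m < L" using k by (auto simp: L_def)
      show "cinner ((V ^^ n) x) ((V ^^ m) x) / (of_nat N)\<^sup>2 * (\<Sum>j<L. \<omega> ^ (j * (n + k)) * cnj (\<omega> ^ (j * m))) =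
          (if n + k = m then cinner ((V ^^ n) x) ((V ^^ m) x) / (of_nat N)\<^sup>2 * of_nat L else 0)"
        unfolding sum_roots_of_unity_orth[OF nm, folded \<omega>_def] by simp
    qed
    also have "\<dots> = (\<Sum>n<N. if n + k < N then c k / (of_nat N)\<^sup>2 * of_nat L else 0)"
      by (intro sum.cong refl) (simp add: c_shift)
    also have "\<dots> = (\<Sum>n\<in>{..<N - k}. c k / (of_nat N)\<^sup>2 * of_nat L)"
      by (rule sum.mono_neutral_cong_right) auto
    finally show ?thesis by simp
  qed
  have N: "N > 0" "K \<le> N" "K \<le> L" and NK: "real N = 2 * real K" and LN: "real L = 2 * real N"
    using K by (auto simp: N_def L_def)
  have "(\<Sum>j<L. p j) = real L * (norm x)\<^sup>2 / real N"
  proof -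
    have "complex_of_real (\<Sum>j<L. p j) = complex_of_real (real L * (norm x)\<^sup>2 / real N)"
      using d[of 0] N by (simp add: c_def cinner_self power2_eq_square)
    then show ?thesis by (simp only: of_real_eq_iff)
  qed
  moreover have "(\<Sum>k<L. (cmod (\<Sum>j<L. p j * \<omega> ^ (k * j)))\<^sup>2) \<le> real L * S * (\<Sum>j<L. p j)"
    unfolding \<omega>_def
    by (rule discrete_parseval_le) (use S \<omega>1 in \<open>auto simp: p_def N_def \<omega>_def\<close>)
  ultimately have 1: "(\<Sum>k<L. (cmod (\<Sum>j<L. p j * \<omega> ^ (k * j)))\<^sup>2) \<le> real L * S * (real L * (norm x)\<^sup>2 / real N)"
    by simp
  have "(\<Sum>k<K. (real L * real K / (real N)\<^sup>2)\<^sup>2 * (cmod (c k))\<^sup>2) \<le> (\<Sum>k<K. (cmod (\<Sum>j<L. p j * \<omega> ^ (k * j)))\<^sup>2)"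
  proof (rule sum_mono)
    fix k assume "k \<in> {..<K}"
    then have k: "k < N" "K \<le> N - k" by (auto simp: N_def)
    have "real L * real K / (real N)\<^sup>2 * cmod (c k) \<le> real L * real (N - k) / (real N)\<^sup>2 * cmod (c k)"
      using k by (intro mult_right_mono divide_right_mono mult_left_mono) auto
    also have "\<dots> = cmod (\<Sum>j<L. p j * \<omega> ^ (k * j))"
      unfolding d[OF k(1)] by (simp add: norm_mult norm_divide norm_power)
    finally show "(real L * real K / (real N)\<^sup>2)\<^sup>2 * (cmod (c k))\<^sup>2 \<le> (cmod (\<Sum>j<L. p j * \<omega> ^ (k * j)))\<^sup>2"
      unfolding power_mult_distrib[symmetric] by (intro power_mono) auto
  qed
  also have "\<dots> \<le> (\<Sum>k<L. (cmod (\<Sum>j<L. p j * \<omega> ^ (k * j)))\<^sup>2)"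
    using N by (intro sum_mono2) auto
  also note 1
  finally have "(real L * real K / (real N)\<^sup>2)\<^sup>2 * (\<Sum>k<K. (cmod (c k))\<^sup>2) \<le> real L * S * (real L * (norm x)\<^sup>2 / real N)"
    by (simp add: sum_distrib_left)
  \<comment> \<open>With \<open>L = 4 K\<close> and \<open>N = 2 K\<close> the weight is exactly 1,
    and the right side has \<open>L^2 / N = 8 K\<close>.\<close>
  moreover have "real L * real K / (real N)\<^sup>2 = 1"
    unfolding LN NK using K by (simp add: power2_eq_square)
  ultimately show ?thesis unfolding LN NK c_def using K by (simp add: field_simps power2_eq_square)
qed

text \<open>The uniform estimate is available for lengths that are powers of two; monotonicity of
  the partial sums \<open>s\<close> fills the gaps.\<close>

lemma wiener_correlation_mean_tendsto_0:
  assumes V: "unitary V" and x: "x \<in> continuous_subspace V"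
  shows "(\<lambda>N. (1 / real N) * (\<Sum>k<N. (cmod (cinner x ((V ^^ k) x)))\<^sup>2)) \<longlonglongrightarrow> 0"
proof (rule LIMSEQ_I)
  fix e :: real assume e: "0 < e"
  \<comment> \<open>The \<open>+ 1\<close> avoids division by zero for \<open>x = 0\<close>. The
    factor 16 needed below is 8 from \<open>correlation_sum_le\<close>, doubled by rounding
    \<open>N\<close> up to a power of two.\<close>
  define \<delta> where "\<delta> = e / 32 / ((norm x)\<^sup>2 + 1)"
  have "(norm x)\<^sup>2 + 1 > 0" by (simp add: add_nonneg_pos)
  then have \<delta>: "\<delta> > 0" "16 * \<delta> * (norm x)\<^sup>2 < e"
  proof -
    show "\<delta> > 0" using e \<open>(norm x)\<^sup>2 + 1 > 0\<close> by (simp add: \<delta>_def)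
    then have "\<delta> * (norm x)\<^sup>2 \<le> \<delta> * ((norm x)\<^sup>2 + 1)" by simp
    also have "\<dots> = e / 32"
      unfolding \<delta>_def using \<open>(norm x)\<^sup>2 + 1 > 0\<close> by (metis nonzero_eq_divide_eq order_less_irrefl)
    finally show "16 * \<delta> * (norm x)\<^sup>2 < e" using e by simp
  qed
  obtain k0 where k0: "\<And>j z. j \<ge> k0 \<Longrightarrow> cmod z = 1 \<Longrightarrow> norm (twisted_mean V x (2 ^ j) z) < sqrt \<delta>"
    using twisted_mean_uniform[OF V x, of "sqrt \<delta>"] \<delta> by auto
  define s where "s N = (\<Sum>k<N. (cmod (cinner x ((V ^^ k) x)))\<^sup>2)" for N
  have s_mono: "s M \<le> s N" if "M \<le> N" for M N
    unfolding s_def using that by (intro sum_mono2) auto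
  have s_bound: "s (2 ^ j) \<le> 8 * real (2 ^ j) * \<delta> * (norm x)\<^sup>2" if "j \<ge> k0" for j
    unfolding s_def
  proof (rule correlation_sum_le[OF V])
    fix z :: complex assume z: "cmod z = 1"
    have "norm (twisted_mean V x (2 ^ Suc j) z) < sqrt \<delta>" using k0 that z by (metis le_SucI)
    then have "(norm (twisted_mean V x (2 ^ Suc j) z))\<^sup>2 \<le> (sqrt \<delta>)\<^sup>2" by (intro power_mono) auto
    then show "(norm (twisted_mean V x (2 * 2 ^ j) z))\<^sup>2 \<le> \<delta>" using \<delta>(1) by simp
  qed simp
  have "norm ((1 / real N) * s N) < e" if N: "N \<ge> 2 ^ k0" for N
  proof -
    have "N \<ge> 1" using N le_trans[OF one_le_power[of 2 k0]] by simp
    then obtain j where j: "2 ^ j \<le> N" "N < 2 ^ (j + 1)" using ex_power_ivl1[of 2 N] by auto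
    have "(2::nat) ^ k0 < 2 ^ (j + 1)" using j N by linarith
    then have "k0 \<le> j + 1" using power_less_imp_less_exp[of "2::nat" k0 "j + 1"] by simp
    then have "s N \<le> 8 * real (2 ^ (j + 1)) * \<delta> * (norm x)\<^sup>2"
      using s_mono[of N "2 ^ (j + 1)"] s_bound[of "j + 1"] j(2) by linarith
    also have "\<dots> \<le> 8 * (2 * real N) * \<delta> * (norm x)\<^sup>2"
      using j(1) \<delta>(1) of_nat_mono[OF j(1), where 'a = real] by (intro mult_right_mono) auto
    finally have "(1 / real N) * s N \<le> 16 * \<delta> * (norm x)\<^sup>2"
      using \<open>N \<ge> 1\<close> by (simp add: field_simps)
    moreover have "0 \<le> s N" unfolding s_def by (intro sum_nonneg) auto
    ultimately show ?thesis using \<delta>(2) by simp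
  qed
  then show "\<exists>N0. \<forall>N\<ge>N0. norm ((1 / real N) * (\<Sum>k<N. (cmod (cinner x ((V ^^ k) x)))\<^sup>2) - 0) < e"
    unfolding s_def by auto
qed

text \<open>A duality argument: the combination \<open>y\<close> of the orbit with coefficients
  \<open>cnj (f (\<xi> n))\<close> has \<open>f y = s N\<close>, while
  \<open>\<parallel>y\<parallel>\<close> is controlled by the Gram matrix, whose entries depend in
  modulus only on the lag \<open>n - m\<close>. Hence the autocorrelations of \<open>x\<close>
  control the values of every \<open>f\<close>.\<close>

lemma functional_mean_tendsto_0:
  fixes f :: "'h :: complex_hilbert_space \<Rightarrow> complex"
  assumes V: "unitary V" and x: "x \<in> continuous_subspace V"
    and f: "\<And>u v. f (u + v) = f u + f v" "\<And>c u. f (c *\<^sub>C u) = c * f u" "\<And>u. cmod (f u) \<le> F * norm u"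
  shows "(\<lambda>N. (1 / real N) * (\<Sum>n<N. cmod (f ((V ^^ n) x)))) \<longlonglongrightarrow> 0"
proof -
  define \<xi> where "\<xi> n = (V ^^ n) x" for n
  define c where "c k = (cmod (cinner x (\<xi> k)))\<^sup>2" for k
  define w where "w N = (1 / real N) * (\<Sum>k<N. c k)" for N
  have w: "w \<longlonglongrightarrow> 0"
    using wiener_correlation_mean_tendsto_0[OF V x] unfolding w_def c_def \<xi>_def .
  have c0: "0 \<le> c k" for k by (simp add: c_def)
  have corr: "(cmod (cinner (\<xi> n) (\<xi> m)))\<^sup>2 = c (if n \<le> m then m - n else n - m)" for n m
  proof -
    have *: "cinner (\<xi> n) (\<xi> (n + k)) = cinner x (\<xi> k)" for n k
      using unitary_funpow_cinner[OF V, of n x "(V ^^ k) x"] by (simp add: \<xi>_def funpow_add)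
    show ?thesis
    proof (cases "n \<le> m")
      case True
      then show ?thesis using *[of n "m - n"] by (simp add: c_def)
    next
      case False
      then show ?thesis using *[of m "n - m"] cinner_commute[of "\<xi> n" "\<xi> m"] by (simp add: c_def)
    qed
  qed
  have G: "(\<Sum>n<N. \<Sum>m<N. (cmod (cinner (\<xi> n) (\<xi> m)))\<^sup>2) \<le> 2 * real N * (\<Sum>k<N. c k)" for N
  proof -
    have "(\<Sum>m<N. (cmod (cinner (\<xi> n) (\<xi> m)))\<^sup>2) \<le> 2 * (\<Sum>k<N. c k)" if n: "n < N" for n
    proof -
      \<comment> \<open>Each lag occurs at most once on either side of the diagonal. The diagonal is
        counted twice, which is harmless for an upper bound.\<close>
      have "(\<Sum>m<N. (cmod (cinner (\<xi> n) (\<xi> m)))\<^sup>2) \<le> (\<Sum>m<N. (if n \<le> m then c (m - n) else 0) + (if m \<le> n then c (n - m) else 0))"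
        using c0 by (intro sum_mono) (auto simp: corr)
      also have "\<dots> = (\<Sum>m\<in>{n..<N}. c (m - n)) + (\<Sum>m\<in>{..n}. c (n - m))"
        unfolding sum.distrib using n
        by (intro arg_cong2[where f = "(+)"] sum.mono_neutral_cong_right) auto
      also have "(\<Sum>m\<in>{n..<N}. c (m - n)) = (\<Sum>k<N - n. c k)"
        using n by (intro sum.reindex_bij_witness[of _ "\<lambda>k. k + n" "\<lambda>m. m - n"]) auto
      also have "\<dots> \<le> (\<Sum>k<N. c k)" using c0 by (intro sum_mono2) auto
      also have "(\<Sum>m\<in>{..n}. c (n - m)) = (\<Sum>k\<in>{..n}. c k)"
        by (intro sum.reindex_bij_witness[of _ "\<lambda>k. n - k" "\<lambda>m. n - m"]) auto
      also have "\<dots> \<le> (\<Sum>k<N. c k)" using c0 n by (intro sum_mono2) auto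
      finally show ?thesis by simp
    qed
    then have "(\<Sum>n<N. \<Sum>m<N. (cmod (cinner (\<xi> n) (\<xi> m)))\<^sup>2) \<le> (\<Sum>n<N. 2 * (\<Sum>k<N. c k))"
      by (intro sum_mono) auto
    then show ?thesis by simp
  qed
  have f_sum: "f (\<Sum>n<N. b n *\<^sub>C \<xi> n) = (\<Sum>n<N. b n * f (\<xi> n))" for b N
  proof (induction N)
    case 0
    show ?case using f(2)[of 0 0] by (simp add: scaleC_simps)
  qed (simp add: f)
  define s where "s N = (\<Sum>n<N. (cmod (f (\<xi> n)))\<^sup>2)" for N
  have s0: "0 \<le> s N" for N unfolding s_def by (intro sum_nonneg) auto
  have s_bound: "s N \<le> F\<^sup>2 * sqrt (2 * real N * (\<Sum>k<N. c k))" for N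
  proof (cases "s N = 0")
    case True
    then show ?thesis using c0 by (simp add: sum_nonneg)
  next
    case False
    define y where "y = (\<Sum>n<N. cnj (f (\<xi> n)) *\<^sub>C \<xi> n)"
    define g where "g p = cmod (cinner (\<xi> (fst p)) (\<xi> (snd p)))" for p
    define b where "b p = cmod (f (\<xi> (fst p))) * cmod (f (\<xi> (snd p)))" for p
    have "f y = complex_of_real (s N)"
      unfolding y_def f_sum s_def of_real_sum by (intro sum.cong refl) (simp only: complex_norm_square mult.commute)
    then have "s N \<le> F * norm y" using f(3)[of y] s0[of N] by simp
    then have 1: "(s N)\<^sup>2 \<le> F\<^sup>2 * (norm y)\<^sup>2"
      using power_mono[OF _ s0[of N], of "F * norm y" 2] by (simp add: power_mult_distrib)
    have "cinner y y = (\<Sum>n<N. \<Sum>m<N. f (\<xi> n) * cnj (f (\<xi> m)) * cinner (\<xi> n) (\<xi> m))"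
      unfolding y_def bounded_bilinear.sum_left[OF bounded_bilinear_cinner]
      unfolding bounded_bilinear.sum_right[OF bounded_bilinear_cinner]
      by (simp add: cinner_scaleC_left cinner_scaleC_right mult.assoc mult.left_commute)
    then have "(norm y)\<^sup>2 = cmod (\<Sum>n<N. \<Sum>m<N. f (\<xi> n) * cnj (f (\<xi> m)) * cinner (\<xi> n) (\<xi> m))"
      by (metis cinner_self norm_of_real abs_of_nonneg zero_le_power2)
    also have "\<dots> \<le> (\<Sum>n<N. \<Sum>m<N. b (n, m) * g (n, m))"
      by (intro order_trans[OF norm_sum] sum_mono) (simp add: b_def g_def norm_mult)
    also have "\<dots> = (\<Sum>p\<in>{..<N} \<times> {..<N}. b p * g p)"
      by (simp add: sum.cartesian_product)
    finally have "((norm y)\<^sup>2)\<^sup>2 \<le> (\<Sum>p\<in>{..<N} \<times> {..<N}. b p * g p)\<^sup>2"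
      by (intro power_mono) auto
    \<comment> \<open>Cauchy-Schwarz over pairs of indices: the coefficients contribute
      \<open>(s N)^2\<close>, so one factor \<open>s N\<close> can be cancelled at the end.\<close>
    also have "\<dots> \<le> (\<Sum>p\<in>{..<N} \<times> {..<N}. (b p)\<^sup>2) * (\<Sum>p\<in>{..<N} \<times> {..<N}. (g p)\<^sup>2)"
      by (rule Cauchy_Schwarz_ineq_sum)
    also have "(\<Sum>p\<in>{..<N} \<times> {..<N}. (b p)\<^sup>2) = (s N)\<^sup>2"
      by (simp add: s_def b_def power2_eq_square[of "sum _ _"] sum_product power_mult_distrib
          sum.cartesian_product split_beta)
    also have "(\<Sum>p\<in>{..<N} \<times> {..<N}. (g p)\<^sup>2) = (\<Sum>n<N. \<Sum>m<N. (cmod (cinner (\<xi> n) (\<xi> m)))\<^sup>2)"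
      by (simp add: g_def sum.cartesian_product split_beta)
    also have "(s N)\<^sup>2 * \<dots> \<le> (s N)\<^sup>2 * (2 * real N * (\<Sum>k<N. c k))"
      by (intro mult_left_mono G) auto
    finally have "(norm y)\<^sup>2 \<le> sqrt ((s N)\<^sup>2 * (2 * real N * (\<Sum>k<N. c k)))"
      by (rule real_le_rsqrt)
    also have "\<dots> = s N * sqrt (2 * real N * (\<Sum>k<N. c k))"
      using s0[of N] by (simp add: real_sqrt_mult)
    finally have "(s N)\<^sup>2 \<le> F\<^sup>2 * (s N * sqrt (2 * real N * (\<Sum>k<N. c k)))"
      using 1 mult_left_mono[of "(norm y)\<^sup>2" _ "F\<^sup>2"] by fastforce
    then have "s N * s N \<le> s N * (F\<^sup>2 * sqrt (2 * real N * (\<Sum>k<N. c k)))"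
      by (simp add: power2_eq_square mult.left_commute)
    then show ?thesis using False s0[of N] by (simp add: mult_le_cancel_left)
  qed
  have bound: "(1 / real N) * (\<Sum>n<N. cmod (f (\<xi> n))) \<le> sqrt (F\<^sup>2 * sqrt (2 * w N))" for N
  proof (cases "N = 0")
    case False
    have "(\<Sum>n<N. cmod (f (\<xi> n)) * 1)\<^sup>2 \<le> s N * (\<Sum>n<N. 1\<^sup>2)"
      unfolding s_def by (rule Cauchy_Schwarz_ineq_sum)
    then have "(\<Sum>n<N. cmod (f (\<xi> n)))\<^sup>2 \<le> s N * real N" by simp
    then have "((1 / real N) * (\<Sum>n<N. cmod (f (\<xi> n))))\<^sup>2 \<le> s N / real N"
      using False by (simp add: power_mult_distrib power_divide power2_eq_square field_simps)
    also have "\<dots> \<le> F\<^sup>2 * sqrt (2 * real N * (\<Sum>k<N. c k)) / real N"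
      using s_bound by (intro divide_right_mono) auto
    also have "sqrt (2 * real N * (\<Sum>k<N. c k)) = real N * sqrt (2 * w N)"
    proof -
      have "2 * real N * (\<Sum>k<N. c k) = (real N)\<^sup>2 * (2 * w N)"
        using False by (simp add: w_def power2_eq_square)
      then show ?thesis by (simp only: real_sqrt_mult real_sqrt_abs abs_of_nat)
    qed
    finally show ?thesis using False by (intro real_le_rsqrt) simp
  qed (simp add: w_def)
  show ?thesis unfolding \<xi>_def[symmetric]
  proof (rule tendsto_sandwich[of "\<lambda>_. 0"])
    have "(\<lambda>N. sqrt (F\<^sup>2 * sqrt (2 * w N))) \<longlonglongrightarrow> sqrt (F\<^sup>2 * sqrt (2 * 0))"
      by (intro tendsto_intros w)
    then show "(\<lambda>N. sqrt (F\<^sup>2 * sqrt (2 * w N))) \<longlonglongrightarrow> 0" by simp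
    show "\<forall>\<^sub>F N in sequentially. 0 \<le> (1 / real N) * (\<Sum>n<N. cmod (f (\<xi> n)))"
      by (intro always_eventually allI mult_nonneg_nonneg sum_nonneg) auto
    show "\<forall>\<^sub>F N in sequentially. (1 / real N) * (\<Sum>n<N. cmod (f (\<xi> n))) \<le> sqrt (F\<^sup>2 * sqrt (2 * w N))"
      by (intro always_eventually allI bound)
  qed simp
qed

section \<open>Compact operators and decay in the discrete mean\<close>

lemma compact_operator_bounded:
  assumes "compact_operator C"
  shows "\<exists>K. \<forall>x. norm (C x) \<le> K * norm x"
proof -
  have C: "clinear C" "bounded (closure (C ` cball 0 1))"
    using assms by (auto simp: compact_operator_def compact_imp_bounded)
  then have "bounded (C ` cball 0 1)" using bounded_subset closure_subset by metis
  then obtain K where K: "\<And>y. y \<in> C ` cball 0 1 \<Longrightarrow> norm y \<le> K"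
    unfolding bounded_iff by metis
  have "norm (C x) \<le> K * norm x" for x
  proof (cases "x = 0")
    case False
    have "norm (C ((1 / norm x) *\<^sub>R x)) \<le> K" using False by (intro K imageI) simp
    then show ?thesis using False by (simp add: clinear_scaleR[OF C(1)] field_simps)
  qed (simp add: clinear_0[OF C(1)])
  then show ?thesis by blast
qed

text \<open>Replace one factor in \<open>\<langle>y, y\<rangle>\<close> by a nearby point of a
  finite net. This serves as finite-rank approximation, for compact operators as well as for
  precompact orbits.\<close>

lemma precompact_norm_le:
  fixes S :: "'h :: complex_hilbert_space set"
  assumes S: "compact (closure S)" and e: "e > 0"
  obtains F where "finite F" "\<And>y. y \<in> S \<Longrightarrow> (norm y)\<^sup>2 \<le> e * norm y + (\<Sum>v\<in>F. cmod (cinner v y))"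
proof -
  obtain F where F: "finite F" "S \<subseteq> (\<Union>v\<in>F. ball v e)"
    using S e unfolding compact_closure_iff by blast
  have "(norm y)\<^sup>2 \<le> e * norm y + (\<Sum>v\<in>F. cmod (cinner v y))" if y: "y \<in> S" for y
  proof -
    obtain v where v: "v \<in> F" "dist v y < e" using F(2) y by auto
    have "(norm y)\<^sup>2 = inner (y - v) y + inner v y" by (simp add: inner_simps power2_norm_eq_inner)
    also have "inner (y - v) y \<le> norm (y - v) * norm y" by (rule norm_cauchy_schwarz)
    also have "\<dots> \<le> e * norm y"
      using v(2) by (intro mult_right_mono) (auto simp: dist_norm norm_minus_commute)
    also have "inner v y \<le> cmod (cinner v y)"
      using complex_Re_le_cmod[of "cinner v y"] by (simp add: Re_cinner)
    also have "\<dots> \<le> (\<Sum>v\<in>F. cmod (cinner v y))"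
      using v(1) F(1) by (intro member_le_sum) auto
    finally show ?thesis by simp
  qed
  with F(1) that show thesis by blast
qed

lemma compact_operator_norm_le:
  assumes C: "compact_operator C" and e: "e > 0"
  obtains F where "finite F" "\<And>x. norm (C x) \<le> e * norm x + (2 / e) * (\<Sum>v\<in>F. cmod (cinner v (C x)))"
proof -
  have lin: "clinear C" using C by (simp add: compact_operator_def)
  obtain F where F: "finite F" "\<And>y. y \<in> C ` cball 0 1 \<Longrightarrow>
      (norm y)\<^sup>2 \<le> e / 2 * norm y + (\<Sum>v\<in>F. cmod (cinner v y))"
    using precompact_norm_le[of "C ` cball 0 1" "e / 2"] C e unfolding compact_operator_def by auto
  have unit: "norm y \<le> e + (2 / e) * (\<Sum>v\<in>F. cmod (cinner v y))" if y: "y \<in> C ` cball 0 1" for y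
  proof (cases "norm y \<le> e")
    case True
    then show ?thesis using e by (simp add: add_increasing2 sum_nonneg)
  next
    case False
    \<comment> \<open>For \<open>\<parallel>y\<parallel> > e\<close> the error term is at most half
      of \<open>\<parallel>y\<parallel>^2\<close> and is absorbed; dividing by \<open>e / 2\<close>
      yields the factor \<open>2 / e\<close>.\<close>
    then have "e / 2 * norm y + e / 2 * norm y \<le> norm y * norm y"
      using mult_right_mono[of e "norm y" "norm y"] by simp
    then have "e / 2 * norm y \<le> (\<Sum>v\<in>F. cmod (cinner v y))"
      using F(2)[OF y] by (simp add: power2_eq_square)
    then have "norm y \<le> (2 / e) * (\<Sum>v\<in>F. cmod (cinner v y))"
      using e by (simp add: field_simps)
    then show ?thesis using e by simp
  qed
  have "norm (C x) \<le> e * norm x + (2 / e) * (\<Sum>v\<in>F. cmod (cinner v (C x)))" for x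
  proof (cases "x = 0")
    case False
    let ?u = "(1 / norm x) *\<^sub>R x"
    have "norm (C ?u) \<le> e + (2 / e) * (\<Sum>v\<in>F. cmod (cinner v (C ?u)))"
      using False by (intro unit imageI) simp
    also have "(\<Sum>v\<in>F. cmod (cinner v (C ?u))) = (1 / norm x) * (\<Sum>v\<in>F. cmod (cinner v (C x)))"
      unfolding clinear_scaleR[OF lin] cinner_scaleR_right sum_distrib_left by simp
    also have "norm (C ?u) = (1 / norm x) * norm (C x)"
      unfolding clinear_scaleR[OF lin] by simp
    finally show ?thesis using False by (simp add: field_simps)
  qed (simp add: clinear_0[OF lin] cinner_simps)
  with F(1) that show thesis by blast
qed

text \<open>\<open>compact_operator_norm_le\<close> trades \<open>C\<close> for finitely many
  bounded functionals, each of which decays in the mean.\<close>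

lemma rage_discrete:
  assumes V: "unitary V" and x: "x \<in> continuous_subspace V" and C: "compact_operator C"
  shows "(\<lambda>N. (1 / real N) * (\<Sum>n<N. norm (C ((V ^^ n) x)))) \<longlonglongrightarrow> 0"
proof (rule LIMSEQ_I)
  fix \<epsilon> :: real assume \<epsilon>: "0 < \<epsilon>"
  have lin: "clinear C" using C by (simp add: compact_operator_def)
  obtain K where K: "\<And>x. norm (C x) \<le> K * norm x" using compact_operator_bounded[OF C] by blast
  define e where "e = \<epsilon> / 2 / (norm x + 1)"
  have nx: "norm x + 1 > 0" by (simp add: add_nonneg_pos)
  have e: "e > 0" using \<epsilon> nx by (simp add: e_def)
  have "e * norm x \<le> e * (norm x + 1)" using e by simp
  also have "\<dots> = \<epsilon> / 2" unfolding e_def using nx by (metis nonzero_eq_divide_eq order_less_irrefl)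
  finally have ex: "e * norm x \<le> \<epsilon> / 2" .
  obtain F where F: "finite F"
    "\<And>x. norm (C x) \<le> e * norm x + (2 / e) * (\<Sum>v\<in>F. cmod (cinner v (C x)))"
    using compact_operator_norm_le[OF C e] by blast
  define m where "m N = (2 / e) * (\<Sum>v\<in>F. (1 / real N) * (\<Sum>n<N. cmod (cinner v (C ((V ^^ n) x)))))" for N
  have "(\<lambda>N. (1 / real N) * (\<Sum>n<N. cmod (cinner v (C ((V ^^ n) x))))) \<longlonglongrightarrow> 0" for v
  proof (rule functional_mean_tendsto_0[OF V x, where f = "\<lambda>y. cinner v (C y)"])
    show "cmod (cinner v (C u)) \<le> norm v * K * norm u" for u
      using cmod_cinner_le[of v "C u"] mult_left_mono[OF K[of u], of "norm v"] by simp
  qed (use lin in \<open>auto simp: clinear_iff cinner_simps\<close>)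
  then have "m \<longlonglongrightarrow> (2 / e) * (\<Sum>v\<in>F. 0)" unfolding m_def by (intro tendsto_intros)
  then have "eventually (\<lambda>N. m N < \<epsilon> / 2) sequentially"
    by (rule order_tendstoD) (use \<epsilon> in auto)
  then obtain N0 where N0: "\<And>N. N \<ge> N0 \<Longrightarrow> m N < \<epsilon> / 2" unfolding eventually_sequentially by blast
  have "norm ((1 / real N) * (\<Sum>n<N. norm (C ((V ^^ n) x)))) < \<epsilon>" if N: "N \<ge> max N0 1" for N
  proof -
    have "(\<Sum>n<N. norm (C ((V ^^ n) x))) \<le>
        (\<Sum>n<N. e * norm x + (2 / e) * (\<Sum>v\<in>F. cmod (cinner v (C ((V ^^ n) x)))))"
      using F(2)[of "(V ^^ _) x"] by (intro sum_mono) (simp add: unitary_funpow_norm[OF V])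
    also have "\<dots> = real N * (e * norm x) + (2 / e) * (\<Sum>v\<in>F. \<Sum>n<N. cmod (cinner v (C ((V ^^ n) x))))"
      unfolding sum.distrib sum_distrib_left[symmetric] sum.swap[of _ F] by simp
    also have "\<dots> = real N * (e * norm x + m N)"
      using N by (simp add: m_def distrib_left flip: sum_divide_distrib)
    finally have "(1 / real N) * (\<Sum>n<N. norm (C ((V ^^ n) x))) \<le> e * norm x + m N"
      using N by (simp add: field_simps)
    moreover have "0 \<le> (1 / real N) * (\<Sum>n<N. norm (C ((V ^^ n) x)))"
      by (intro mult_nonneg_nonneg sum_nonneg) auto
    ultimately show ?thesis using ex N0[of N] N by simp
  qed
  then show "\<exists>N0. \<forall>N\<ge>N0. norm ((1 / real N) * (\<Sum>n<N. norm (C ((V ^^ n) x))) - 0) < \<epsilon>"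
    by (intro exI[of _ "max N0 1"]) simp
qed


section \<open>Periodic propagators\<close>

lemma compact_operator_if_finite_rank:
  fixes C :: "'h :: complex_hilbert_space \<Rightarrow> 'h"
  assumes "clinear C" "\<And>x. norm (C x) \<le> K * norm x" "finite B" "\<And>x. C x \<in> cspan B"
  shows "compact_operator C"
  unfolding compact_operator_def
proof (intro conjI assms(1) compact_closure_finite_cspan[OF assms(3)])
  show "C ` cball 0 1 \<subseteq> cspan B" using assms(4) by blast
  have "norm (C x) \<le> \<bar>K\<bar>" if "norm x \<le> 1" for x
  proof -
    have "norm (C x) \<le> \<bar>K\<bar> * norm x"
      using assms(2)[of x] mult_right_mono[OF abs_ge_self, of "norm x" K] by simp
    also have "\<dots> \<le> \<bar>K\<bar> * 1" using that by (intro mult_left_mono) auto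
    finally show ?thesis by simp
  qed
  then show "bounded (C ` cball 0 1)" unfolding bounded_iff by (intro exI[of _ "\<bar>K\<bar>"]) auto
qed

text \<open>Makes the discrete mean decay applicable to \<open>C\<close> composed with
  \<open>U t 0\<close> for each fixed \<open>t\<close>.\<close>

lemma compact_operator_unitary:
  assumes C: "compact_operator C" and W: "unitary W"
  shows "compact_operator (\<lambda>y. C (W y))"
  unfolding compact_operator_def
proof
  show "clinear (\<lambda>y. C (W y))"
    using C unitary_clinear[OF W] by (simp add: compact_operator_def clinear_iff)
  have "(\<lambda>y. C (W y)) ` cball 0 1 \<subseteq> closure (C ` cball 0 1)"
    using closure_subset[of "C ` cball 0 1"] by (auto simp: unitary_norm[OF W])
  then show "compact (closure ((\<lambda>y. C (W y)) ` cball 0 1))"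
    using C by (intro compact_closure_subset) (auto simp: compact_operator_def)
qed

text \<open>Folds the integral onto a single period; \<open>h\<close> itself is not assumed
  periodic.\<close>

lemma mean_integral_periodic_sum:
  fixes h :: "real \<Rightarrow> real"
  assumes h: "continuous_on UNIV h" and T: "T > 0"
  shows "integral {0..real N * T} h = integral {0..T} (\<lambda>t. \<Sum>n<N. h (t + real n * T))"
proof (induction N)
  case (Suc N)
  have int: "h integrable_on {a..b}" for a b
    by (intro integrable_continuous_real continuous_on_subset[OF h]) auto
  have cont: "continuous_on S (\<lambda>t. h (t + c))" for c S
    by (intro continuous_on_compose2[OF h] continuous_intros) auto
  have "integral {0..real (Suc N) * T} h =
      integral {0..real N * T} h + integral {real N * T..real (Suc N) * T} h"
    using T int by (intro Henstock_Kurzweil_Integration.integral_combine[symmetric]) (auto simp: algebra_simps)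
  also have "integral {real N * T..real (Suc N) * T} h = integral {0..T} (\<lambda>t. h (t + real N * T))"
    using integral_shift_Icc_real[of 0 T h "real N * T"] by (simp add: o_def algebra_simps)
  finally show ?case
    unfolding Suc using cont
    by (simp add: integral_add[symmetric] integrable_continuous_real integrable_sum)
qed simp

text \<open>What the rest of the argument keeps of the dynamics; \<open>U_periodic\<close> will be
  supplied by \<open>propagator_periodic\<close>.\<close>

locale periodic_propagator =
  fixes U :: "real \<Rightarrow> real \<Rightarrow> 'h :: complex_hilbert_space \<Rightarrow> 'h" and T :: real
  assumes T_pos: "T > 0"
    and U_unitary: "unitary (U t s)"
    and U_continuous: "continuous_on UNIV (\<lambda>(t, s). U t s \<xi>)"
    and U_compose: "U t r (U r s x) = U t s x"
    and U_id: "U t t x = x"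
    and U_periodic: "U (t + T) (r + T) = U t r"
begin

abbreviation V :: "'h \<Rightarrow> 'h" where "V \<equiv> U T 0"

lemma V_unitary: "unitary V" by (rule U_unitary)

lemma norm_U: "norm (U t s x) = norm x" by (rule unitary_norm[OF U_unitary])

lemmas U_lin = unitary_clinear[OF U_unitary]

lemma continuous_U: "continuous_on S (\<lambda>t. U t 0 \<xi>)"
proof -
  have "continuous_on S (\<lambda>t. (\<lambda>(t, s). U t s \<xi>) (t, 0))"
    by (rule continuous_on_compose2[OF U_continuous]) (auto intro!: continuous_intros)
  then show ?thesis by simp
qed

lemma U_shift_nat: "U (t + real n * T) (r + real n * T) = U t r"
proof (induction n)
  case (Suc n)
  then show ?case using U_periodic[of "t + real n * T" "r + real n * T"] by (simp add: algebra_simps)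
qed simp

lemma U_nat: "U (real n * T) 0 x = (V ^^ n) x"
proof (induction n)
  case (Suc n)
  have "U (real (Suc n) * T) (real n * T) = V"
    using U_shift_nat[of T n 0] by (simp add: algebra_simps)
  then show ?case using Suc U_compose[of "real (Suc n) * T" "real n * T" 0 x] by simp
qed (simp add: U_id)

lemma U_add_nat: "U (t + real n * T) 0 x = U t 0 ((V ^^ n) x)"
  using U_compose[of "t + real n * T" "real n * T" 0 x] U_shift_nat[of t n 0] by (simp add: U_nat)

lemma U_shift_int: "U (t + of_int n * T) (r + of_int n * T) = U t r"
proof (cases "n \<ge> 0")
  case True
  then show ?thesis using U_shift_nat[of t "nat n" r] by simp
next
  case False
  then show ?thesis using U_shift_nat[of "t + of_int n * T" "nat (- n)" "r + of_int n * T"] by simp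
qed

lemma U_add_int: "U (t + of_int n * T) 0 x = U t 0 (U (of_int n * T) 0 x)"
  using U_compose[of "t + of_int n * T" "of_int n * T" 0 x] U_shift_int[of t n 0] by simp

lemma closed_csubspace_point: "csubspace (point_subspace V)" "closed (point_subspace V)"
  unfolding point_subspace_def by (rule closed_csubspace_cspan)+

lemma spectral_decomp:
  obtains p c where "\<xi> = p + c" "p \<in> point_subspace V" "c \<in> continuous_subspace V"
  using closed_csubspace_decomp[OF closed_csubspace_point, of \<xi>]
  unfolding continuous_subspace_def by (metis add.commute diff_add_cancel)

section \<open>Precompact and almost periodic orbits\<close>

lemma H_pc_csubspace: "csubspace (H_pc U)"
proof (rule complex_vector.subspaceI)
  have "orbit U 0 \<subseteq> {0}" by (auto simp: orbit_def clinear_0[OF U_lin])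
  then show "0 \<in> H_pc U" unfolding H_pc_def by (auto intro: compact_closure_subset[of "{0}"])
next
  fix x y assume "x \<in> H_pc U" "y \<in> H_pc U"
  then have "compact ((\<lambda>(x, y). x + y) ` (closure (orbit U x) \<times> closure (orbit U y)))"
    unfolding H_pc_def split_beta
    by (intro compact_continuous_image compact_Times continuous_intros) auto
  moreover have "orbit U (x + y) \<subseteq> (\<lambda>(x, y). x + y) ` (closure (orbit U x) \<times> closure (orbit U y))"
  proof
    fix z assume "z \<in> orbit U (x + y)"
    then obtain t where t: "z = U t 0 x + U t 0 y"
      using U_lin by (auto simp: orbit_def clinear_iff)
    moreover have "U t 0 x \<in> closure (orbit U x)" "U t 0 y \<in> closure (orbit U y)"
      using closure_subset[of "orbit U _"] by (auto simp: orbit_def)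
    ultimately show "z \<in> (\<lambda>(x, y). x + y) ` (closure (orbit U x) \<times> closure (orbit U y))" by force
  qed
  ultimately show "x + y \<in> H_pc U" by (auto simp: H_pc_def intro: compact_closure_subset)
next
  fix c x assume "x \<in> H_pc U"
  then have "compact ((\<lambda>y. c *\<^sub>C y) ` closure (orbit U x))"
    unfolding H_pc_def by (intro compact_continuous_image continuous_intros) auto
  moreover have "orbit U (c *\<^sub>C x) \<subseteq> (\<lambda>y. c *\<^sub>C y) ` closure (orbit U x)"
  proof
    fix z assume "z \<in> orbit U (c *\<^sub>C x)"
    then obtain t where t: "z = c *\<^sub>C U t 0 x"
      using U_lin by (auto simp: orbit_def clinear_iff)
    moreover have "U t 0 x \<in> closure (orbit U x)" using closure_subset[of "orbit U x"] by (auto simp: orbit_def)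
    ultimately show "z \<in> (\<lambda>y. c *\<^sub>C y) ` closure (orbit U x)" by blast
  qed
  ultimately show "c *\<^sub>C x \<in> H_pc U" by (auto simp: H_pc_def intro: compact_closure_subset)
qed

text \<open>Unitarity makes an approximation of the initial vector uniform along the whole
  orbit.\<close>

lemma H_pc_closed: "closed (H_pc U)"
proof -
  have "x \<in> H_pc U" if x: "x \<in> closure (H_pc U)" for x
    unfolding H_pc_def mem_Collect_eq
  proof (rule compact_closure_approx)
    fix e :: real assume "e > 0"
    then obtain y where y: "y \<in> H_pc U" "dist y x < e" using x closure_approachable by blast
    have "dist (U t 0 x) (U t 0 y) < e" for t
      using y(2) by (simp add: dist_norm norm_U norm_minus_commute flip: clinear_diff[OF U_lin])
    then show "\<exists>K. compact (closure K) \<and> (\<forall>x\<in>orbit U x. \<exists>y\<in>K. dist x y < e)"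
      using y(1) by (intro exI[of _ "orbit U y"]) (auto simp: H_pc_def orbit_def)
  qed
  then show ?thesis using closure_subset by (metis closure_eq subsetI subset_antisym)
qed

lemma point_subset_H_pc: "point_subspace V \<subseteq> H_pc U"
  unfolding point_subspace_def
proof (intro closure_minimal H_pc_closed complex_vector.span_minimal H_pc_csubspace subsetI)
  fix x assume "x \<in> {x. x \<noteq> 0 \<and> (\<exists>z. V x = z *\<^sub>C x)}"
  then obtain z where x: "x \<noteq> 0" "V x = z *\<^sub>C x" by blast
  have z: "cmod z = 1" using norm_U[of T 0 x] x by (simp add: norm_scaleC)
  have Vn: "(V ^^ n) x = z ^ n *\<^sub>C x" for n
    by (induction n) (use x U_lin in \<open>auto simp: clinear_iff scaleC_scaleC mult.commute\<close>)
  define K where "K = (\<lambda>(c, t). c *\<^sub>C U t 0 x) ` (sphere 0 1 \<times> {0..T})"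
  have "compact K" unfolding K_def split_beta
    by (intro compact_continuous_image compact_Times continuous_intros
        continuous_on_compose2[OF continuous_U[of UNIV]]) auto
  moreover have "orbit U x \<subseteq> K"
  proof
    fix y assume "y \<in> orbit U x"
    then obtain t where t: "y = U t 0 x" by (auto simp: orbit_def)
    define n where "n = \<lfloor>t / T\<rfloor>"
    define s where "s = t - of_int n * T"
    have s: "s \<in> {0..T}"
    proof -
      have "of_int n \<le> t / T" "t / T < of_int n + 1" using floor_correct[of "t / T"] by (auto simp: n_def)
      then show ?thesis using T_pos by (simp add: s_def field_simps)
    qed
    have "\<exists>c. cmod c = 1 \<and> U (of_int n * T) 0 x = c *\<^sub>C x"
    proof (cases "n \<ge> 0")
      case True
      then have "U (of_int n * T) 0 x = z ^ nat n *\<^sub>C x" using U_nat[of "nat n" x] Vn by simp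
      then show ?thesis using z by (intro exI[of _ "z ^ nat n"]) (simp add: norm_power)
    next
      case False
      \<comment> \<open>Negative times: \<open>m\<close> further periods lead back to
        \<open>x\<close>, so the phase is the inverse of \<open>z ^ m\<close>, which is its
        conjugate.\<close>
      define m where "m = nat (- n)"
      have "x = U (of_int n * T + real m * T) 0 x" using False by (simp add: m_def U_id)
      also have "\<dots> = z ^ m *\<^sub>C U (of_int n * T) 0 x"
        unfolding U_add_nat Vn using U_lin by (simp add: clinear_iff)
      finally have "cnj (z ^ m) *\<^sub>C x = (cnj (z ^ m) * z ^ m) *\<^sub>C U (of_int n * T) 0 x"
        by (metis scaleC_scaleC)
      also have "cnj (z ^ m) * z ^ m = 1"
        using complex_norm_square[of "z ^ m"] z by (simp add: norm_power mult.commute)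
      finally have "U (of_int n * T) 0 x = cnj (z ^ m) *\<^sub>C x" by simp
      then show ?thesis using z by (intro exI[of _ "cnj (z ^ m)"]) (simp add: norm_power)
    qed
    then obtain c where c: "cmod c = 1" "U (of_int n * T) 0 x = c *\<^sub>C x" by blast
    have "y = c *\<^sub>C U s 0 x"
      using U_add_int[of s n x] c(2) U_lin by (simp add: t s_def clinear_iff)
    then show "y \<in> K" unfolding K_def using c(1) s by (intro image_eqI[of _ _ "(c, s)"]) auto
  qed
  ultimately show "x \<in> H_pc U" by (auto simp: H_pc_def intro: compact_closure_subset)
qed

text \<open>An almost period near \<open>-t\<close> moves \<open>t\<close> into
  \<open>{0..l}\<close>, so the orbit stays within \<open>e\<close> of a compact arc.\<close>

lemma H_ap_subset_H_pc: "H_ap U \<subseteq> H_pc U"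
proof
  fix x assume "x \<in> H_ap U"
  then have ap: "\<And>e. e > 0 \<Longrightarrow> \<exists>l>0. \<forall>a. \<exists>\<tau>\<in>{a..a + l}. \<forall>t. norm (U (t + \<tau>) 0 x - U t 0 x) < e"
    by (auto simp: H_ap_def almost_periodic_def)
  show "x \<in> H_pc U"
    unfolding H_pc_def mem_Collect_eq
  proof (rule compact_closure_approx)
    fix e :: real assume "e > 0"
    then obtain l where l: "l > 0" "\<And>a. \<exists>\<tau>\<in>{a..a + l}. \<forall>t. norm (U (t + \<tau>) 0 x - U t 0 x) < e"
      using ap by blast
    define K where "K = (\<lambda>t. U t 0 x) ` {0..l}"
    have "compact K" unfolding K_def by (intro compact_continuous_image continuous_U) auto
    moreover have "\<exists>y\<in>K. dist (U t 0 x) y < e" for t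
    proof -
      obtain \<tau> where \<tau>: "\<tau> \<in> {-t..-t + l}" "norm (U (t + \<tau>) 0 x - U t 0 x) < e" using l(2)[of "-t"] by blast
      then show ?thesis
        by (intro bexI[of _ "U (t + \<tau>) 0 x"]) (auto simp: K_def dist_norm norm_minus_commute)
    qed
    ultimately show "\<exists>K. compact (closure K) \<and> (\<forall>x\<in>orbit U x. \<exists>y\<in>K. dist x y < e)"
      by (intro exI[of _ K]) (auto simp: orbit_def compact_imp_closed)
  qed
qed

text \<open>If the points \<open>U (nT) 0 x\<close>, \<open>\<bar>n\<bar> \<le> m\<close>, form an \<open>e\<close>-net of the sequence of all such points, then
  every integer is within \<open>m\<close> of an \<open>e\<close>-period of the sequence, and a period \<open>p\<close> of the sequence is
  a period \<open>pT\<close> of the orbit.\<close>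

lemma H_pc_subset_H_ap: "H_pc U \<subseteq> H_ap U"
proof
  fix x assume "x \<in> H_pc U"
  then have pc: "compact (closure (orbit U x))" by (simp add: H_pc_def)
  define \<xi> where "\<xi> n = U (of_int n * T) 0 x" for n
  have "\<exists>l>0. \<forall>a. \<exists>\<tau>\<in>{a..a + l}. \<forall>t. norm (U (t + \<tau>) 0 x - U t 0 x) < e" if e: "e > 0" for e
  proof -
    have "\<exists>F. finite F \<and> (\<forall>n. \<exists>k\<in>F. dist (\<xi> n) (\<xi> k) < e)"
    proof -
      obtain N where N: "finite N" "orbit U x \<subseteq> (\<Union>y\<in>N. ball y (e / 2))"
        using pc e half_gt_zero unfolding compact_closure_iff by blast
      \<comment> \<open>The centres of the net need not lie on the sequence; each is replaced by a
        sequence point within \<open>e / 2\<close>, which doubles the radius.\<close>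
      define pick where "pick y = (SOME n. dist y (\<xi> n) < e / 2)" for y
      have "\<exists>k\<in>pick ` N. dist (\<xi> n) (\<xi> k) < e" for n
      proof -
        have "\<xi> n \<in> orbit U x" by (auto simp: \<xi>_def orbit_def)
        then obtain y where y: "y \<in> N" "dist y (\<xi> n) < e / 2" using N(2) by auto
        then have "dist y (\<xi> (pick y)) < e / 2" unfolding pick_def by (rule_tac someI)
        then have "dist (\<xi> n) (\<xi> (pick y)) < e"
          using y(2) dist_triangle_half_r by blast
        then show ?thesis using y(1) by blast
      qed
      then show ?thesis using N(1) by (intro exI[of _ "pick ` N"]) auto
    qed
    then obtain F where F: "finite F" "\<And>n. \<exists>k\<in>F. dist (\<xi> n) (\<xi> k) < e" by blast
    define m where "m = Max (insert 0 (abs ` F))"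
    have m: "\<bar>k\<bar> \<le> m" if "k \<in> F" for k
      unfolding m_def using F(1) that by (intro Max_ge) auto
    have m0: "0 \<le> m" unfolding m_def using F(1) by (intro Max_ge) auto
    \<comment> \<open>The difference \<open>m - k\<close> ranges over \<open>{0..2 m}\<close>, and
      rounding \<open>a / T\<close> up adds at most one more period.\<close>
    define l where "l = (2 * of_int m + 1) * T"
    have "\<exists>\<tau>\<in>{a..a + l}. \<forall>t. norm (U (t + \<tau>) 0 x - U t 0 x) < e" for a
    proof -
      define n where "n = \<lceil>a / T\<rceil> + m"
      obtain k where k: "k \<in> F" "dist (\<xi> n) (\<xi> k) < e" using F(2) by blast
      define \<tau> where "\<tau> = of_int (n - k) * T"
      have "of_int \<lceil>a / T\<rceil> * T \<ge> a" "of_int \<lceil>a / T\<rceil> * T \<le> a + T"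
      proof -
        show "of_int \<lceil>a / T\<rceil> * T \<ge> a"
          by (rule iffD1[OF pos_divide_le_eq[OF T_pos] le_of_int_ceiling])
        have "of_int \<lceil>a / T\<rceil> \<le> a / T + 1" using ceiling_correct[of "a / T"] by auto
        then show "of_int \<lceil>a / T\<rceil> * T \<le> a + T" using T_pos by (simp add: field_simps)
      qed
      moreover have "of_int (m - k) * T \<ge> 0" "of_int (m - k) * T \<le> 2 * of_int m * T"
        using m[OF k(1)] T_pos by (auto simp: mult_right_mono)
      ultimately have "\<tau> \<in> {a..a + l}" by (auto simp: \<tau>_def n_def l_def algebra_simps)
      moreover have "norm (U (t + \<tau>) 0 x - U t 0 x) < e" for t
      proof -
        have "U (of_int k * T) 0 (U \<tau> 0 x) = \<xi> n"
          using U_add_int[of "of_int k * T" "n - k" x] by (simp add: \<tau>_def \<xi>_def algebra_simps)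
        \<comment> \<open>Propagating by \<open>k T\<close> is isometric and moves the displacement
          over time \<tau> to the difference of two sequence points.\<close>
        then have "norm (U \<tau> 0 x - x) = norm (\<xi> n - \<xi> k)"
          using norm_U[of "of_int k * T" 0 "U \<tau> 0 x - x"] by (simp add: clinear_diff[OF U_lin] \<xi>_def)
        moreover have "U (t + \<tau>) 0 x - U t 0 x = U t 0 (U \<tau> 0 x - x)"
          unfolding \<tau>_def U_add_int by (simp add: clinear_diff[OF U_lin])
        ultimately show ?thesis using k(2) by (simp add: norm_U dist_norm)
      qed
      ultimately show ?thesis by blast
    qed
    moreover have "l > 0" using T_pos m0 by (simp add: l_def add_nonneg_pos)
    ultimately show ?thesis by blast
  qed
  then show "x \<in> H_ap U" by (auto simp: H_ap_def almost_periodic_def continuous_U)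
qed

section \<open>Decay in the mean over continuous time\<close>

lemma continuous_CU:
  assumes "compact_operator C"
  shows "continuous_on S (\<lambda>t. norm (C (U t 0 x)))"
proof -
  have lin: "clinear C" using assms by (simp add: compact_operator_def)
  obtain K where K: "\<And>x. norm (C x) \<le> K * norm x" using compact_operator_bounded[OF assms] by blast
  then have "bounded_linear C" by (intro bounded_linear_clinear[OF lin, of K]) (simp add: mult.commute)
  then have "continuous_on UNIV C" by (rule linear_continuous_on)
  then show ?thesis
    by (intro continuous_on_norm continuous_on_compose2[OF _ continuous_U]) auto
qed

text \<open>Dominated convergence over one period turns the discrete into the continuous mean.\<close>

lemma continuous_subset_H_f: "continuous_subspace V \<subseteq> H_f U"
proof
  fix x assume x: "x \<in> continuous_subspace V"
  show "x \<in> H_f U"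
    unfolding H_f_def
  proof (intro CollectI allI impI)
    fix C :: "'h \<Rightarrow> 'h" assume C: "compact_operator C"
    obtain K where K: "\<And>x. norm (C x) \<le> K * norm x" using compact_operator_bounded[OF C] by blast
    define h where "h t = norm (C (U t 0 x))" for t
    have h: "continuous_on S h" for S unfolding h_def by (rule continuous_CU[OF C])
    have h0: "0 \<le> h t" and hK: "h t \<le> K * norm x" for t
      using K[of "U t 0 x"] by (auto simp: h_def norm_U)
    define g where "g N t = (1 / real N) * (\<Sum>n<N. h (t + real n * T))" for N t
    have g_lim: "(\<lambda>N. g N t) \<longlonglongrightarrow> 0" for t
      using rage_discrete[OF V_unitary x compact_operator_unitary[OF C U_unitary[of t 0]]]
      by (simp add: g_def h_def U_add_nat)
    have gK: "norm (g N t) \<le> \<bar>K * norm x\<bar>" for N t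
    proof (cases "N = 0")
      case False
      have "(\<Sum>n<N. h (t + real n * T)) \<le> (\<Sum>n<N. \<bar>K * norm x\<bar>)"
        by (intro sum_mono order_trans[OF hK]) simp
      moreover have "0 \<le> (\<Sum>n<N. h (t + real n * T))" by (intro sum_nonneg h0)
      ultimately show ?thesis using False by (simp add: g_def field_simps)
    qed (simp add: g_def)
    have h_shift: "continuous_on S (\<lambda>t. h (t + c))" for c S
      by (intro continuous_on_compose2[OF h[of UNIV]] continuous_intros) auto
    have "(\<lambda>N. integral {0..T} (g N)) \<longlonglongrightarrow> integral {0..T} (\<lambda>t. 0)"
    proof (rule dominated_convergence(2)[where h = "\<lambda>t. \<bar>K * norm x\<bar>"])
      show "g N integrable_on {0..T}" for N
        unfolding g_def by (intro integrable_continuous_real continuous_intros h_shift)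
    qed (use gK g_lim in auto)
    then have lim: "(\<lambda>N. integral {0..T} (g N)) \<longlonglongrightarrow> 0" by simp
    have int_g: "integral {0..T} (g N) = (1 / real N) * integral {0..real N * T} h" for N
      unfolding mean_integral_periodic_sum[OF h T_pos] g_def by simp
    \<comment> \<open>The number of periods needed to cover \<open>{0..\<tau>}\<close>. For
      \<open>\<tau> \<ge> T\<close> rounding up at most doubles the length, hence the factor
      \<open>2 / T\<close>.\<close>
    define N where "N \<tau> = nat \<lceil>\<tau> / T\<rceil>" for \<tau>
    have "filterlim N at_top at_top"
      unfolding filterlim_at_top
    proof
      fix Z
      show "\<forall>\<^sub>F \<tau> in at_top. Z \<le> N \<tau>"
        using eventually_ge_at_top[of "real Z * T"]
      proof eventually_elim
        case (elim \<tau>)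
        then have "real Z \<le> \<tau> / T" using T_pos by (simp add: field_simps)
        then show ?case by (simp add: N_def) linarith
      qed
    qed
    then have "((\<lambda>\<tau>. 2 / T * integral {0..T} (g (N \<tau>))) \<longlongrightarrow> 2 / T * 0) at_top"
      by (intro tendsto_intros filterlim_compose[OF lim])
    then have lim2: "((\<lambda>\<tau>. 2 / T * integral {0..T} (g (N \<tau>))) \<longlongrightarrow> 0) at_top" by simp
    have int_nonneg: "0 \<le> integral {a..b} h" for a b
      by (intro integral_nonneg integrable_continuous_real h h0)
    have "((\<lambda>\<tau>. 1 / \<tau> * integral {0..\<tau>} h) \<longlongrightarrow> 0) at_top"
    proof (rule tendsto_sandwich[OF _ _ tendsto_const lim2])
      show "\<forall>\<^sub>F \<tau> in at_top. 0 \<le> 1 / \<tau> * integral {0..\<tau>} h"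
        using eventually_gt_at_top[of 0] by eventually_elim (simp add: int_nonneg)
      show "\<forall>\<^sub>F \<tau> in at_top. 1 / \<tau> * integral {0..\<tau>} h \<le> 2 / T * integral {0..T} (g (N \<tau>))"
        using eventually_ge_at_top[of T]
      proof eventually_elim
        case (elim \<tau>)
        have \<tau>: "\<tau> > 0" using elim T_pos by simp
        have "\<tau> / T \<le> real (N \<tau>)" "real (N \<tau>) \<le> \<tau> / T + 1"
          using \<tau> T_pos ceiling_correct[of "\<tau> / T"] by (auto simp: N_def zero_le_divide_iff)
        then have N: "\<tau> \<le> real (N \<tau>) * T" "real (N \<tau>) * T \<le> 2 * \<tau>"
          using T_pos elim by (auto simp: field_simps)
        have "real (N \<tau>) * T > 0" using N \<tau> by linarith
        then have Npos: "real (N \<tau>) > 0" using T_pos by (simp add: zero_less_mult_iff)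
        have "integral {0..\<tau>} h \<le> integral {0..real (N \<tau>) * T} h"
          using N h0 by (intro integral_subset_le integrable_continuous_real h) auto
        also have "\<dots> = real (N \<tau>) * integral {0..T} (g (N \<tau>))"
          using Npos by (simp add: int_g)
        also have "\<dots> \<le> (2 * \<tau> / T) * integral {0..T} (g (N \<tau>))"
        proof (rule mult_right_mono)
          show "real (N \<tau>) \<le> 2 * \<tau> / T" using N T_pos by (simp add: field_simps)
          show "0 \<le> integral {0..T} (g (N \<tau>))" unfolding int_g using int_nonneg by simp
        qed
        finally show ?case using \<tau> by (simp add: field_simps)
      qed
    qed
    then show "((\<lambda>\<tau>. 1 / \<tau> * integral {0..\<tau>} (\<lambda>t. norm (C (U t 0 x)))) \<longlongrightarrow> 0) at_top"
      unfolding h_def .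
  qed
qed

lemma H_f_diff:
  assumes x: "x \<in> H_f U" and y: "y \<in> H_f U"
  shows "x - y \<in> H_f U"
  unfolding H_f_def
proof (intro CollectI allI impI)
  fix C :: "'h \<Rightarrow> 'h" assume C: "compact_operator C"
  then have lin: "clinear C" by (simp add: compact_operator_def)
  let ?h = "\<lambda>x t. norm (C (U t 0 x))"
  have int: "?h x integrable_on {a..b}" for x a b
    by (intro integrable_continuous_real continuous_CU[OF C])
  have "((\<lambda>\<tau>. 1 / \<tau> * integral {0..\<tau>} (?h x) + 1 / \<tau> * integral {0..\<tau>} (?h y)) \<longlongrightarrow> 0 + 0) at_top"
    by (intro tendsto_add) (use x y C in \<open>auto simp: H_f_def\<close>)
  then have lim: "((\<lambda>\<tau>. 1 / \<tau> * integral {0..\<tau>} (?h x) + 1 / \<tau> * integral {0..\<tau>} (?h y)) \<longlongrightarrow> 0) at_top"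
    by simp
  show "((\<lambda>\<tau>. 1 / \<tau> * integral {0..\<tau>} (?h (x - y))) \<longlongrightarrow> 0) at_top"
  proof (rule tendsto_sandwich[OF _ _ tendsto_const lim])
    show "\<forall>\<^sub>F \<tau> in at_top. 0 \<le> 1 / \<tau> * integral {0..\<tau>} (?h (x - y))"
      using eventually_gt_at_top[of 0] by eventually_elim (simp add: integral_nonneg int)
    show "\<forall>\<^sub>F \<tau> in at_top. 1 / \<tau> * integral {0..\<tau>} (?h (x - y)) \<le>
        1 / \<tau> * integral {0..\<tau>} (?h x) + 1 / \<tau> * integral {0..\<tau>} (?h y)"
      using eventually_gt_at_top[of 0]
    proof eventually_elim
      case (elim \<tau>)
      have "integral {0..\<tau>} (?h (x - y)) \<le> integral {0..\<tau>} (\<lambda>t. ?h x t + ?h y t)"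
        by (intro integral_le int integrable_add)
          (simp add: clinear_diff[OF U_lin] clinear_diff[OF lin] norm_triangle_ineq4)
      also have "\<dots> = integral {0..\<tau>} (?h x) + integral {0..\<tau>} (?h y)"
        by (intro integral_add int)
      finally show ?case using elim by (simp add: field_simps)
    qed
  qed
qed

text \<open>A precompact orbit stays close to finitely many vectors, while a vector in \<open>H_f U\<close> leaves each
  of them in the mean.\<close>

lemma H_pc_Int_H_f:
  assumes pc: "x \<in> H_pc U" and f: "x \<in> H_f U"
  shows "x = 0"
proof (rule ccontr)
  assume x: "x \<noteq> 0"
  \<comment> \<open>With this choice the net error takes away only half of
    \<open>\<parallel>x\<parallel>^2\<close>; the other half must come from the functionals.\<close>
  define e where "e = norm x / 2"
  have e: "e > 0" using x by (simp add: e_def)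
  obtain F where F: "finite F" "\<And>y. y \<in> orbit U x \<Longrightarrow> (norm y)\<^sup>2 \<le> e * norm y + (\<Sum>v\<in>F. cmod (cinner v y))"
    using precompact_norm_le[OF _ e, of "orbit U x"] pc unfolding H_pc_def by blast
  \<comment> \<open>A rank-one operator whose norm at \<open>y\<close> is the modulus of the
    functional, so that membership in \<open>H_f U\<close> applies to functionals.\<close>
  define C :: "'h \<Rightarrow> 'h \<Rightarrow> 'h" where "C v y = cinner v y *\<^sub>C ((1 / norm x) *\<^sub>R x)" for v y
  have C_norm: "norm (C v y) = cmod (cinner v y)" for v y
    using x by (simp add: C_def norm_scaleC)
  have C: "compact_operator (C v)" for v
  proof (rule compact_operator_if_finite_rank)
    show "clinear (C v)" by (simp add: clinear_iff C_def cinner_simps scaleC_simps)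
    show "norm (C v y) \<le> norm v * norm y" for y unfolding C_norm by (rule cmod_cinner_le)
    show "finite {(1 / norm x) *\<^sub>R x}" by simp
    show "C v y \<in> cspan {(1 / norm x) *\<^sub>R x}" for y
      unfolding C_def by (intro complex_vector.span_scale complex_vector.span_base) simp
  qed
  have "((\<lambda>\<tau>. \<Sum>v\<in>F. 1 / \<tau> * integral {0..\<tau>} (\<lambda>t. norm (C v (U t 0 x)))) \<longlongrightarrow> (\<Sum>v\<in>F. 0)) at_top"
    by (intro tendsto_sum) (use f C in \<open>auto simp: H_f_def\<close>)
  then have lim: "((\<lambda>\<tau>. \<Sum>v\<in>F. 1 / \<tau> * integral {0..\<tau>} (\<lambda>t. norm (C v (U t 0 x)))) \<longlongrightarrow> 0) at_top"
    by simp
  have "e * norm x \<le> 0"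
  proof (rule tendsto_lowerbound[OF lim])
    show "\<forall>\<^sub>F \<tau> in at_top. e * norm x \<le> (\<Sum>v\<in>F. 1 / \<tau> * integral {0..\<tau>} (\<lambda>t. norm (C v (U t 0 x))))"
      using eventually_gt_at_top[of 0]
    proof eventually_elim
      case (elim \<tau>)
      have int: "(\<lambda>t. norm (C v (U t 0 x))) integrable_on {0..\<tau>}" for v
        by (intro integrable_continuous_real continuous_CU[OF C])
      have "integral {0..\<tau>} (\<lambda>t. e * norm x) \<le> integral {0..\<tau>} (\<lambda>t. \<Sum>v\<in>F. norm (C v (U t 0 x)))"
      proof (intro integral_le integrable_const_ivl integrable_sum F(1) int)
        fix t
        have "(norm x)\<^sup>2 \<le> e * norm x + (\<Sum>v\<in>F. cmod (cinner v (U t 0 x)))"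
          using F(2)[of "U t 0 x"] by (auto simp: orbit_def norm_U)
        then show "e * norm x \<le> (\<Sum>v\<in>F. norm (C v (U t 0 x)))"
          by (simp add: C_norm e_def power2_eq_square)
      qed
      also have "\<dots> = (\<Sum>v\<in>F. integral {0..\<tau>} (\<lambda>t. norm (C v (U t 0 x))))"
        by (intro integral_sum F(1) int)
      finally show ?case using elim by (simp add: field_simps flip: sum_divide_distrib)
    qed
  qed simp
  then show False using e x by (simp add: mult_le_0_iff)
qed

lemma H_pc_eq: "H_pc U = point_subspace V"
proof
  show "H_pc U \<subseteq> point_subspace V"
  proof
    fix \<xi> assume \<xi>: "\<xi> \<in> H_pc U"
    obtain p c where pc: "\<xi> = p + c" "p \<in> point_subspace V" "c \<in> continuous_subspace V"
      by (rule spectral_decomp)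
    have "\<xi> - p \<in> H_pc U"
      using complex_vector.subspace_diff[OF H_pc_csubspace \<xi>] pc(2) point_subset_H_pc by blast
    then have "c = 0" using pc H_pc_Int_H_f continuous_subset_H_f by auto
    then show "\<xi> \<in> point_subspace V" using pc by simp
  qed
qed (rule point_subset_H_pc)

lemma H_ap_eq: "H_ap U = H_pc U"
  using H_ap_subset_H_pc H_pc_subset_H_ap by blast

lemma H_f_eq: "H_f U = continuous_subspace V"
proof
  show "H_f U \<subseteq> continuous_subspace V"
  proof
    fix \<xi> assume \<xi>: "\<xi> \<in> H_f U"
    obtain p c where pc: "\<xi> = p + c" "p \<in> point_subspace V" "c \<in> continuous_subspace V"
      by (rule spectral_decomp)
    have "\<xi> - c \<in> H_f U" using H_f_diff[OF \<xi>] pc(3) continuous_subset_H_f by blast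
    then have "p = 0" using pc H_pc_Int_H_f point_subset_H_pc by auto
    then show "\<xi> \<in> continuous_subspace V" using pc by simp
  qed
qed (rule continuous_subset_H_f)

end

section \<open>Bounded and unbounded energy\<close>

locale probed_propagator = periodic_propagator U T + discrete_self_adjoint A
  for U :: "real \<Rightarrow> real \<Rightarrow> 'h :: complex_hilbert_space \<Rightarrow> 'h" and T :: real and A :: "'h \<rightharpoonup> 'h" +
  assumes positive: "positive_operator A"
begin

text \<open>The quantity in \<open>H_be\<close> and \<open>H_ue\<close> without normalization of the
  vector, which suits splitting a vector into its two parts.\<close>

definition escape :: "'h \<Rightarrow> real \<Rightarrow> real"
  where "escape \<xi> E = (SUP t. norm (spectral_tail A E (U t 0 \<xi>)))"

lemma norm_tail_le_norm: "norm (spectral_tail A E (U t 0 \<xi>)) \<le> norm \<xi>"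
  using norm_spectral_tail_le[of A E "U t 0 \<xi>"] by (simp add: norm_U)

lemma bdd_above_escape: "bdd_above (range (\<lambda>t. norm (spectral_tail A E (U t 0 \<xi>))))"
  by (rule bdd_aboveI[of _ "norm \<xi>"]) (auto intro: norm_tail_le_norm)

lemma norm_tail_le_escape: "norm (spectral_tail A E (U t 0 \<xi>)) \<le> escape \<xi> E"
  unfolding escape_def by (rule cSUP_upper[OF UNIV_I bdd_above_escape])

lemma escape_nonneg: "0 \<le> escape \<xi> E"
  using norm_tail_le_escape norm_ge_zero order_trans by blast

lemma escape_least:
  assumes "\<And>t. norm (spectral_tail A E (U t 0 \<xi>)) \<le> b"
  shows "escape \<xi> E \<le> b"
  unfolding escape_def by (rule cSUP_least) (use assms in auto)

lemma escape_le_norm: "escape \<xi> E \<le> norm \<xi>"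
  by (rule escape_least) (rule norm_tail_le_norm)

text \<open>Contractions converging strongly converge uniformly on a precompact set, by control on a
  finite net.\<close>

lemma escape_tendsto_0:
  assumes "\<xi> \<in> H_pc U"
  shows "(escape \<xi> \<longlongrightarrow> 0) at_top"
proof (rule tendstoI)
  fix e :: real assume e: "0 < e"
  obtain N where N: "finite N" "orbit U \<xi> \<subseteq> (\<Union>y\<in>N. ball y (e / 3))"
  proof -
    have "e / 3 > 0" using e by simp
    then show ?thesis using assms that unfolding H_pc_def compact_closure_iff by blast
  qed
  have "\<forall>y\<in>N. eventually (\<lambda>E. norm (spectral_tail A E y) < e / 3) at_top"
    using tendstoD[OF spectral_tail_tendsto_0, of "e / 3"] e by simp
  then have "eventually (\<lambda>E. \<forall>y\<in>N. norm (spectral_tail A E y) < e / 3) at_top"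
    using N(1) by (simp add: eventually_ball_finite)
  then show "eventually (\<lambda>E. dist (escape \<xi> E) 0 < e) at_top"
  proof eventually_elim
    case (elim E)
    \<comment> \<open>Thirds rather than halves, since the supremum turns strict bounds into weak
      ones.\<close>
    have "escape \<xi> E \<le> 2 * (e / 3)"
    proof (rule escape_least)
      fix t
      obtain y where y: "y \<in> N" "dist y (U t 0 \<xi>) < e / 3" using N(2) by (force simp: orbit_def)
      have "norm (spectral_tail A E (U t 0 \<xi>)) = norm (spectral_tail A E (U t 0 \<xi> - y) + spectral_tail A E y)"
        by (simp add: clinear_diff[OF clinear_spectral_tail])
      also have "\<dots> \<le> norm (U t 0 \<xi> - y) + norm (spectral_tail A E y)"
        by (intro norm_triangle_le add_right_mono norm_spectral_tail_le)
      also have "\<dots> \<le> 2 * (e / 3)"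
        using y elim by (force simp: dist_norm norm_minus_commute)
      finally show "norm (spectral_tail A E (U t 0 \<xi>)) \<le> 2 * (e / 3)" .
    qed
    then show ?case using escape_nonneg[of \<xi> E] e by simp
  qed
qed

text \<open>The low-energy parts of the orbit are bounded in a finite-dimensional space, hence
  precompact, and they approximate the orbit uniformly within \<open>escape \<xi> E\<close>.\<close>

lemma H_pc_if_escape_tendsto_0:
  assumes lim: "(escape \<xi> \<longlongrightarrow> 0) at_top"
  shows "\<xi> \<in> H_pc U"
  unfolding H_pc_def mem_Collect_eq
proof (rule compact_closure_approx)
  fix e :: real assume "0 < e"
  then have "eventually (\<lambda>E. escape \<xi> E < e) at_top" using order_tendstoD(2)[OF lim] by blast
  then obtain E where E: "escape \<xi> E < e" using eventually_happens' trivial_limit_at_top_linorder by blast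
  obtain B where B: "finite B" "\<And>x. x - spectral_tail A E x \<in> cspan B"
    using spectral_tail_compl_finite_rank[OF positive] by blast
  define K where "K = range (\<lambda>t. U t 0 \<xi> - spectral_tail A E (U t 0 \<xi>))"
  have "bounded K"
    unfolding bounded_iff K_def
    using norm_spectral_tail_compl_le[of "U _ 0 \<xi>" A E] by (auto simp: norm_U)
  then have "compact (closure K)"
    using B(2) by (intro compact_closure_finite_cspan[OF B(1)]) (auto simp: K_def)
  moreover have "\<exists>y\<in>K. dist (U t 0 \<xi>) y < e" for t
    using norm_tail_le_escape[of E t \<xi>] E
    by (intro bexI[of _ "U t 0 \<xi> - spectral_tail A E (U t 0 \<xi>)"]) (auto simp: K_def dist_norm)
  ultimately show "\<exists>K. compact (closure K) \<and> (\<forall>x\<in>orbit U \<xi>. \<exists>y\<in>K. dist x y < e)"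
    by (intro exI[of _ K]) (auto simp: orbit_def)
qed

text \<open>The projection to low energies is compact, so its mean along
  \<open>(V ^^ n) \<xi>\<close> decays. A single time at which the low-energy part is small brings
  the supremum close to the full norm, so equality holds at every \<open>E\<close> and not only in
  the limit.\<close>

lemma escape_continuous_subspace:
  assumes \<xi>: "\<xi> \<in> continuous_subspace V"
  shows "escape \<xi> E = norm \<xi>"
proof (rule antisym[OF escape_le_norm], rule field_le_epsilon)
  fix e :: real assume e: "0 < e"
  obtain B where B: "finite B" "\<And>x. x - spectral_tail A E x \<in> cspan B"
    using spectral_tail_compl_finite_rank[OF positive] by blast
  define C where "C x = x - spectral_tail A E x" for x
  have C: "compact_operator C"
  proof (rule compact_operator_if_finite_rank[OF _ _ B(1)])
    show "clinear C"
      by (simp add: clinear_iff C_def clinear_spectral_tail[unfolded clinear_iff] scaleC_simps)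
    show "norm (C x) \<le> 1 * norm x" for x
      by (simp add: C_def norm_spectral_tail_compl_le)
  qed (simp add: C_def B(2))
  have "\<exists>n. norm (C ((V ^^ n) \<xi>)) < e"
  proof (rule ccontr)
    assume "\<not> ?thesis"
    then have ge: "e \<le> norm (C ((V ^^ n) \<xi>))" for n by (simp add: not_less)
    have "e \<le> (1 / real N) * (\<Sum>n<N. norm (C ((V ^^ n) \<xi>)))" if "N \<ge> 1" for N
      using sum_mono[of "{..<N}" "\<lambda>_. e"] ge that by (simp add: field_simps)
    then have "e \<le> 0"
      by (intro LIMSEQ_le_const[OF rage_discrete[OF V_unitary \<xi> C]]) blast
    then show False using e by simp
  qed
  then obtain n where n: "norm (C ((V ^^ n) \<xi>)) < e" by blast
  have "norm \<xi> = norm (C ((V ^^ n) \<xi>) + spectral_tail A E ((V ^^ n) \<xi>))"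
    by (simp add: C_def unitary_funpow_norm[OF V_unitary])
  also have "\<dots> \<le> norm (C ((V ^^ n) \<xi>)) + norm (spectral_tail A E ((V ^^ n) \<xi>))"
    by (rule norm_triangle_ineq)
  finally show "norm \<xi> \<le> escape \<xi> E + e"
    using n norm_tail_le_escape[of E "real n * T" \<xi>] by (simp add: U_nat)
qed

text \<open>With \<open>\<xi> = p + c\<close> the escape rate of \<open>\<xi>\<close> is at most that of \<open>p\<close> plus \<open>\<parallel>c\<parallel>\<close>, so that a limit
  equal to \<open>\<parallel>\<xi>\<parallel>\<close> leaves no room for \<open>p\<close>.\<close>

lemma continuous_subspace_if_escape_tendsto_norm:
  assumes lim: "(escape \<xi> \<longlongrightarrow> norm \<xi>) at_top"
  shows "\<xi> \<in> continuous_subspace V"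
proof -
  obtain p c where pc: "\<xi> = p + c" "p \<in> point_subspace V" "c \<in> continuous_subspace V"
    by (rule spectral_decomp)
  have le: "escape \<xi> E \<le> escape p E + norm c" for E
  proof (rule escape_least)
    fix t
    have "norm (spectral_tail A E (U t 0 \<xi>)) \<le> norm (spectral_tail A E (U t 0 p)) + norm (spectral_tail A E (U t 0 c))"
      unfolding pc(1) using U_lin[of t 0] clinear_spectral_tail[of A E]
      by (simp add: clinear_iff norm_triangle_ineq)
    then show "norm (spectral_tail A E (U t 0 \<xi>)) \<le> escape p E + norm c"
      using norm_tail_le_escape[of E t p] norm_tail_le_norm[of E t c] by linarith
  qed
  have "p \<in> H_pc U" using pc(2) point_subset_H_pc by blast
  then have "((\<lambda>E. escape p E + norm c) \<longlongrightarrow> 0 + norm c) at_top"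
    by (intro tendsto_intros escape_tendsto_0)
  then have "norm \<xi> \<le> 0 + norm c"
    by (rule tendsto_le[OF trivial_limit_at_top_linorder _ lim]) (simp add: le)
  then have "(norm \<xi>)\<^sup>2 \<le> (norm c)\<^sup>2" by simp
  moreover have "(norm \<xi>)\<^sup>2 = (norm p)\<^sup>2 + (norm c)\<^sup>2"
    unfolding pc(1) using pc(2,3) by (intro pythagoras) (auto simp: continuous_subspace_def)
  ultimately have "p = 0" by simp
  then show ?thesis using pc by simp
qed

lemma H_be_eq: "H_be U A = H_pc U"
proof -
  have "\<xi> \<in> H_pc U \<longleftrightarrow> (escape (\<xi> /\<^sub>R norm \<xi>) \<longlongrightarrow> 0) at_top" if "\<xi> \<noteq> 0" for \<xi>
  proof -
    have "\<xi> \<in> H_pc U \<longleftrightarrow> \<xi> /\<^sub>R norm \<xi> \<in> H_pc U"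
      using subspace_scale[OF csubspace_imp_subspace[OF H_pc_csubspace], of \<xi> "inverse (norm \<xi>)"]
        subspace_scale[OF csubspace_imp_subspace[OF H_pc_csubspace], of "\<xi> /\<^sub>R norm \<xi>" "norm \<xi>"] that
      by auto
    then show ?thesis using escape_tendsto_0 H_pc_if_escape_tendsto_0 by blast
  qed
  moreover have "0 \<in> H_pc U" by (rule complex_vector.subspace_0[OF H_pc_csubspace])
  ultimately show ?thesis unfolding H_be_def escape_def by blast
qed

lemma H_ue_eq: "H_ue U A = continuous_subspace V"
proof -
  have sub: "csubspace (continuous_subspace V)"
    unfolding continuous_subspace_def by (rule csubspace_orth_compl)
  have "\<xi> \<in> continuous_subspace V \<longleftrightarrow> (escape (\<xi> /\<^sub>R norm \<xi>) \<longlongrightarrow> 1) at_top" if "\<xi> \<noteq> 0" for \<xi>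
  proof -
    have n: "norm (\<xi> /\<^sub>R norm \<xi>) = 1" using that by simp
    have "\<xi> \<in> continuous_subspace V \<longleftrightarrow> \<xi> /\<^sub>R norm \<xi> \<in> continuous_subspace V"
      using subspace_scale[OF csubspace_imp_subspace[OF sub], of \<xi> "inverse (norm \<xi>)"]
        subspace_scale[OF csubspace_imp_subspace[OF sub], of "\<xi> /\<^sub>R norm \<xi>" "norm \<xi>"] that
      by auto
    also have "\<dots> \<longleftrightarrow> (escape (\<xi> /\<^sub>R norm \<xi>) \<longlongrightarrow> 1) at_top"
    proof
      assume "\<xi> /\<^sub>R norm \<xi> \<in> continuous_subspace V"
      then have "escape (\<xi> /\<^sub>R norm \<xi>) = (\<lambda>E. 1)" using escape_continuous_subspace n by auto
      then show "(escape (\<xi> /\<^sub>R norm \<xi>) \<longlongrightarrow> 1) at_top" by simp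
    next
      assume "(escape (\<xi> /\<^sub>R norm \<xi>) \<longlongrightarrow> 1) at_top"
      then show "\<xi> /\<^sub>R norm \<xi> \<in> continuous_subspace V"
        by (intro continuous_subspace_if_escape_tendsto_norm) (simp only: n)
    qed
    finally show ?thesis .
  qed
  moreover have "0 \<in> continuous_subspace V" by (rule complex_vector.subspace_0[OF sub])
  ultimately show ?thesis unfolding H_ue_def escape_def by blast
qed

end

theorem theorem5:
  fixes H :: "real \<Rightarrow> ('h :: complex_hilbert_space \<rightharpoonup> 'h)"
    and U :: "real \<Rightarrow> real \<Rightarrow> 'h \<Rightarrow> 'h"
    and A :: "'h \<rightharpoonup> 'h"
    and T :: real
  assumes separable: "\<exists>D :: 'h set. countable D \<and> closure D = UNIV"
    and self_adjoint: "\<And>t. self_adjoint (H t)"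
    and period_pos: "T > 0"
    and periodic: "\<And>t. H (t + T) = H t"
    and propagator: "propagator H U"
    and probe: "probe_operator U A"
  shows "(point_subspace (U T 0) = H_be U A \<and> H_be U A = H_pc U \<and> H_pc U = H_ap U) \<and>
    (continuous_subspace (U T 0) = H_ue U A \<and> H_ue U A = H_f U)"
proof -
  interpret probed_propagator U T A
  proof
    show "U t r (U r s x) = U t s x" for t r s x
      using propagator unfolding propagator_def by (metis comp_apply)
    show "U (t + T) (r + T) = U t r" for t r
      by (rule propagator_periodic[OF self_adjoint periodic propagator])
  qed (use period_pos propagator probe in \<open>auto simp: propagator_def probe_operator_def\<close>)
  show ?thesis
    using H_be_eq H_pc_eq H_ap_eq H_ue_eq H_f_eq by simp
qed

end
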